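(* Let $K$ be a field and let $t,n,d$ be integers with $4\leq t\leq n+1$. Suppose that one of the following conditions is satisfied: (1) $n\geq 3$ and $d=2n-2$; (2) $n\geq 5$ and $d=2n-3$. Then there exists a finite connected graph $G$ on $n$ vertices with $\operatorname{depth}(S/J_G)=t$ and $\dim(S/J_G)=d$ if and only if $t=n+1$, where $S=K[x_1,\ldots,x_n,y_1,\ldots,y_n]$ and $J_G\subset S$ is the binomial edge ideal of $G$.
   Context: Every graph is finite, with no loops and no multiple edges (and no isolated vertices, which is automatic for connected graphs on at least two vertices). For a graph $G$ on the vertex set $[n]=\{1,\ldots,n\}$ with edge set $E(G)$, let $S=K[x_1,\ldots,x_n,y_1,\ldots,y_n]$ be the polynomial ring in $2n$ variables over a field $K$. The binomial edge ideal $J_G$ of $G$ is the ideal of $S$ generated by the binomials $x_iy_j-x_jy_i$ with $i<j$ and $\{i,j\}\in E(G)$. Here $\dim(S/J_G)$ is the Krull dimension and $\operatorname{depth}(S/J_G)$ is the depth of $S/J_G$ as a finitely generated graded $S$-module (with respect to the graded maximal ideal of $S$). *)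

theory Defs
  imports
    "HOL-Algebra.QuotRing"
    "HOL-Algebra.Module"
    "HOL-Library.Poly_Mapping"
    "HOL-Library.Extended_Nat"
    "Graph_Theory.Digraph_Component"
begin

text \<open>
  Simple graphs are the \<^locale>\<open>pair_graph\<close>s: each edge \<open>{i, j}\<close> is represented by
  the two arcs \<open>(i, j)\<close> and \<open>(j, i)\<close>.  Polynomials with coefficients in \<open>'k\<close> are finitely
  supported maps from monomials, which are finitely supported exponent maps, to \<open>'k\<close>.
\<close>

definition poly_ring :: "'k itself \<Rightarrow> 'v set \<Rightarrow> (('v \<Rightarrow>\<^sub>0 nat) \<Rightarrow>\<^sub>0 'k::comm_ring_1) ring"
  where "poly_ring K V =
    \<lparr>carrier = {p. \<forall>m \<in> Poly_Mapping.keys p. Poly_Mapping.keys m \<subseteq> V},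
     monoid.mult = (*), one = 1, zero = 0, add = (+)\<rparr>"

definition indet :: "'v \<Rightarrow> (('v \<Rightarrow>\<^sub>0 nat) \<Rightarrow>\<^sub>0 'k::comm_ring_1)"
  where "indet v = Poly_Mapping.single (Poly_Mapping.single v 1) 1"

text \<open>
  The Krull dimension is the supremum of the lengths \<open>l\<close> of the strict chains
  \<open>P 0 \<subset> \<dots> \<subset> P l\<close> of prime ideals.  (The zero ring gets dimension 0 here.)
\<close>

definition krull_dim :: "('a, 'b) ring_scheme \<Rightarrow> enat"
  where "krull_dim R = Sup {enat l | l.
    \<exists>P. (\<forall>i\<le>l. primeideal (P i) R) \<and> (\<forall>i<l. P i \<subset> P (Suc i))}"

definition quotient_module :: "'a ring \<Rightarrow> 'a set \<Rightarrow> ('a, 'a set) module"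
  where "quotient_module R J =
    \<lparr>carrier = carrier (R Quot J), monoid.mult = monoid.mult (R Quot J), one = one (R Quot J),
     zero = zero (R Quot J), add = add (R Quot J),
     smult = (\<lambda>a X. (J +>\<^bsub>R\<^esub> a) \<otimes>\<^bsub>R Quot J\<^esub> X)\<rparr>"

text \<open>\<open>list_smult M [x\<^sub>1, \<dots>, x\<^sub>r]\<close> is the submodule \<open>(x\<^sub>1, \<dots>, x\<^sub>r)M = x\<^sub>1M + \<dots> + x\<^sub>rM\<close>.\<close>

fun list_smult :: "('a, 'm) module \<Rightarrow> 'a list \<Rightarrow> 'm set"
  where
    "list_smult M [] = {\<zero>\<^bsub>M\<^esub>}"
  | "list_smult M (x # xs) =
      {(x \<odot>\<^bsub>M\<^esub> m) \<oplus>\<^bsub>M\<^esub> u | m u. m \<in> carrier M \<and> u \<in> list_smult M xs}"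

text \<open>
  \<open>x\<^sub>1, \<dots>, x\<^sub>r\<close> is an \<open>M\<close>-regular sequence if \<open>(x\<^sub>1, \<dots>, x\<^sub>r)M \<noteq> M\<close> and every \<open>x\<^sub>i\<close> is a
  nonzerodivisor on \<open>M / (x\<^sub>1, \<dots>, x\<^sub>i\<^sub>-\<^sub>1)M\<close>; the latter is expressed on representatives.
\<close>

definition regular_sequence :: "'a ring \<Rightarrow> ('a, 'm) module \<Rightarrow> 'a list \<Rightarrow> bool"
  where "regular_sequence R M xs \<longleftrightarrow>
    set xs \<subseteq> carrier R \<and> list_smult M xs \<noteq> carrier M \<and>
    (\<forall>i<length xs. \<forall>m\<in>carrier M.
      (xs ! i) \<odot>\<^bsub>M\<^esub> m \<in> list_smult M (take i xs) \<longrightarrow> m \<in> list_smult M (take i xs))"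

text \<open>
  Over a Noetherian ring and for finitely generated \<open>M \<noteq> IM\<close>, all maximal \<open>M\<close>-regular sequences
  in \<open>I\<close> have the same length, namely this supremum.
\<close>

definition depth :: "'a ring \<Rightarrow> 'a set \<Rightarrow> ('a, 'm) module \<Rightarrow> enat"
  where "depth R I M =
    Sup {enat (length xs) | xs. set xs \<subseteq> I \<and> regular_sequence R M xs}"

datatype xyvar = Xvar nat | Yvar nat

type_synonym 'k xypoly = "(xyvar \<Rightarrow>\<^sub>0 nat) \<Rightarrow>\<^sub>0 'k"

definition xy_ring :: "'k itself \<Rightarrow> nat \<Rightarrow> ('k::field) xypoly ring"
  where "xy_ring K n = poly_ring K (Xvar ` {1..n} \<union> Yvar ` {1..n})"

definition graded_max_ideal :: "'k itself \<Rightarrow> nat \<Rightarrow> ('k::field) xypoly set"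
  where "graded_max_ideal K n =
    Idl\<^bsub>xy_ring K n\<^esub> (indet ` (Xvar ` {1..n} \<union> Yvar ` {1..n}))"

definition binomial_edge_ideal :: "'k itself \<Rightarrow> nat \<Rightarrow> nat pair_pre_digraph \<Rightarrow> ('k::field) xypoly set"
  where "binomial_edge_ideal K n G =
    Idl\<^bsub>xy_ring K n\<^esub> {indet (Xvar i) * indet (Yvar j) - indet (Xvar j) * indet (Yvar i) | i j.
      i < j \<and> (i, j) \<in> parcs G}"

subsection \<open>Well-definedness\<close>

lemma keys_mult_vars:
  fixes p q :: "('v \<Rightarrow>\<^sub>0 nat) \<Rightarrow>\<^sub>0 'k::comm_ring_1"
  assumes "\<forall>m \<in> Poly_Mapping.keys p. Poly_Mapping.keys m \<subseteq> V"
    "\<forall>m \<in> Poly_Mapping.keys q. Poly_Mapping.keys m \<subseteq> V"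
  shows "\<forall>m \<in> Poly_Mapping.keys (p * q). Poly_Mapping.keys m \<subseteq> V"
proof
  fix m assume "m \<in> Poly_Mapping.keys (p * q)"
  then obtain a b where ab: "m = a + b" "a \<in> Poly_Mapping.keys p" "b \<in> Poly_Mapping.keys q"
    using keys_mult[of p q] by blast
  show "Poly_Mapping.keys m \<subseteq> V"
    using ab assms Poly_Mapping.keys_add[of a b] by blast
qed

lemma poly_ring_simps [simp]:
  "p \<otimes>\<^bsub>poly_ring K V\<^esub> q = p * q" "p \<oplus>\<^bsub>poly_ring K V\<^esub> q = p + q"
  "\<one>\<^bsub>poly_ring K V\<^esub> = 1" "\<zero>\<^bsub>poly_ring K V\<^esub> = 0"
  by (simp_all add: poly_ring_def)

lemma poly_ring_carrier:
  "p \<in> carrier (poly_ring K V) \<longleftrightarrow>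
    (\<forall>m \<in> Poly_Mapping.keys p. Poly_Mapping.keys m \<subseteq> V)"
  by (simp add: poly_ring_def)

lemma poly_ring_closed:
  assumes "p \<in> carrier (poly_ring K V)" "q \<in> carrier (poly_ring K V)"
  shows "p + q \<in> carrier (poly_ring K V)" "p * q \<in> carrier (poly_ring K V)"
  using assms Poly_Mapping.keys_add[of p q] keys_mult_vars[of p V q]
  unfolding poly_ring_carrier by (blast, blast)

lemma poly_ring_uminus_closed:
  "p \<in> carrier (poly_ring K V) \<Longrightarrow> - p \<in> carrier (poly_ring K V)"
  by (simp add: poly_ring_carrier)

lemma cring_poly_ring: "cring (poly_ring K V)"
proof (rule cringI)
  show "abelian_group (poly_ring K V)"
  proof (rule abelian_groupI)
    fix x assume "x \<in> carrier (poly_ring K V)"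
    then show "\<exists>y\<in>carrier (poly_ring K V). y \<oplus>\<^bsub>poly_ring K V\<^esub> x = \<zero>\<^bsub>poly_ring K V\<^esub>"
      by (intro bexI[of _ "- x"] poly_ring_uminus_closed) simp_all
  qed (simp_all add: poly_ring_closed add.assoc add.commute poly_ring_carrier[of 0])
  show "Group.comm_monoid (poly_ring K V)"
    by (rule comm_monoidI)
      (simp_all add: poly_ring_closed mult.assoc mult.commute poly_ring_carrier[of 1])
qed (simp add: distrib_right)

lemma cring_xy_ring: "cring (xy_ring K n)"
  unfolding xy_ring_def by (rule cring_poly_ring)

lemma indet_in_poly_ring: "v \<in> V \<Longrightarrow> indet v \<in> carrier (poly_ring K V)"
  by (auto simp: poly_ring_def indet_def)

lemma ideal_graded_max_ideal: "ideal (graded_max_ideal K n) (xy_ring K n)"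
proof -
  interpret cring "xy_ring K n" by (rule cring_xy_ring)
  show ?thesis
    unfolding graded_max_ideal_def
    by (rule genideal_ideal) (auto simp: xy_ring_def intro!: indet_in_poly_ring)
qed

lemma ideal_binomial_edge_ideal:
  fixes K :: "'k::field itself"
  assumes "pair_graph G" "pverts G = {1..n}"
  shows "ideal (binomial_edge_ideal K n G) (xy_ring K n)"
proof -
  interpret cring "xy_ring K n" by (rule cring_xy_ring)
  interpret pair_graph G by fact
  have diff: "p * q - r * s \<in> carrier (xy_ring K n)"
    if "p \<in> carrier (xy_ring K n)" "q \<in> carrier (xy_ring K n)"
       "r \<in> carrier (xy_ring K n)" "s \<in> carrier (xy_ring K n)" for p q r s
    using that unfolding xy_ring_def diff_conv_add_uminus
    by (intro poly_ring_closed poly_ring_uminus_closed)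
  have var: "indet (Xvar i) \<in> carrier (xy_ring K n)" "indet (Yvar i) \<in> carrier (xy_ring K n)"
    if "i \<in> {1..n}" for i
    using that by (auto simp: xy_ring_def intro!: indet_in_poly_ring)
  show ?thesis
    unfolding binomial_edge_ideal_def
  proof (intro genideal_ideal subsetI)
    fix f :: "'k xypoly"
    assume "f \<in> {indet (Xvar i) * indet (Yvar j) - indet (Xvar j) * indet (Yvar i) | i j.
      i < j \<and> (i, j) \<in> parcs G}"
    then obtain i j where f: "f = indet (Xvar i) * indet (Yvar j) - indet (Xvar j) * indet (Yvar i)"
      and ij: "(i, j) \<in> parcs G" by blast
    have "i \<in> {1..n}" "j \<in> {1..n}"
      using wellformed'[OF ij] assms(2) by simp_all
    then show "f \<in> carrier (xy_ring K n)"
      unfolding f by (intro diff var)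
  qed
qed

lemma quotient_module_simps [simp]:
  "carrier (quotient_module R J) = carrier (R Quot J)"
  "X \<oplus>\<^bsub>quotient_module R J\<^esub> Z = X \<oplus>\<^bsub>R Quot J\<^esub> Z"
  "\<zero>\<^bsub>quotient_module R J\<^esub> = \<zero>\<^bsub>R Quot J\<^esub>"
  "a \<odot>\<^bsub>quotient_module R J\<^esub> X = (J +>\<^bsub>R\<^esub> a) \<otimes>\<^bsub>R Quot J\<^esub> X"
  by (simp_all add: quotient_module_def)

lemma module_quotient_module:
  assumes "cring R" "ideal J R"
  shows "Module.module R (quotient_module R J)"
proof -
  interpret cring R by fact
  interpret J: ideal J R by fact
  interpret Q: cring "R Quot J" by (rule J.quotient_is_cring[OF \<open>cring R\<close>])
  interpret h: ring_hom_ring R "R Quot J" "(+>\<^bsub>R\<^esub>) J" by (rule J.rcos_ring_hom_ring)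
  have ab: "abelian_group (quotient_module R J)"
  proof (rule abelian_groupI)
    fix x assume "x \<in> carrier (quotient_module R J)"
    then show "\<exists>y\<in>carrier (quotient_module R J).
        y \<oplus>\<^bsub>quotient_module R J\<^esub> x = \<zero>\<^bsub>quotient_module R J\<^esub>"
      unfolding quotient_module_simps by (intro bexI[of _ "\<ominus>\<^bsub>R Quot J\<^esub> x"] Q.l_neg Q.a_inv_closed)
  qed (unfold quotient_module_simps, (intro Q.a_closed Q.zero_closed Q.l_zero Q.a_assoc Q.a_comm; assumption)+)
  show ?thesis
    by (rule moduleI[OF \<open>cring R\<close> ab], unfold quotient_module_simps)
      (simp_all only: h.hom_closed h.hom_add h.hom_mult h.hom_one
        Q.m_closed Q.l_distr Q.r_distr Q.m_assoc Q.l_one)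
qed

end

(* Suppose that G is connected and that a chain of primes of length d > n + 1, d >= 2n - 3, starts at a
   prime P containing J_G.  Counting the nonzero columns (x_i, y_i) modulo P up to proportionality shows
   that exactly one column vanishes, say that of v, and that at most two of the others are
   proportional.  Hence at most one edge of G avoids v: up to labelling, G is a star, a star with an
   edge between two leaves, or a star with a pendant edge at a leaf.

   For these graphs a regular sequence of length n + 1 is made of Hankel forms y_i + x_j.  It is
   checked on the components: a sequence which is regular modulo I and modulo J, and regular modulo
   I + J up to its last element, is regular modulo the intersection of I and J.  For a star the components
   are the ideal of all 2-minors, which is the kernel of the Segre map, and (x_v, y_v); the ideal of 2-minors
   is treated by the same principle after adding one variable.  Homogeneous regular sequences can be permuted,
   so that the order may be adapted to each component.

   The bound depth <= n + 1 for the cones comes from the annihilator of x_v, which is the ideal of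
   2-minors: a regular sequence is algebraically independent modulo the annihilator of any element
   surviving in the localisation at the origin.  Likewise elements f_i of P_i outside P_(i-1) are
   algebraically independent modulo P_0.  In both cases counting monomials bounds the length. *)

theory Submission
  imports Defs
begin

subsection \<open>Ideals and regular sequences in a commutative ring\<close>

text \<open>The constant \<open>n + 1\<close> is the dimension of the determinantal ring of
  \<open>2 \<times> n\<close> matrices of rank at most one, a component for every connected graph.
  Since \<open>t \<le> n + 1\<close> is assumed, an arbitrary graph with large \<open>d\<close>
  needs only a lower bound for its depth; an exact depth is computed only for the two cones that
  realise the values.

  The lower bound is graded throughout. A generator of degree two enters a regular sequence as the
  square of a spare variable modulo the linear forms already used.

  The upper bound cannot use degrees, since the supremum defining depth ranges over arbitrary
  sequences in the maximal ideal. There, polynomials with constant term 1 act as units and a chain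
  condition replaces induction on degree. Independence modulo annihilators stands in for associated
  primes, and the growth of numbers of monomials for transcendence degree.\<close>

interpretation ideal: Modules.module "(*) :: 'a::comm_ring_1 \<Rightarrow> 'a \<Rightarrow> 'a"
  by standard (simp_all add: algebra_simps)

declare ideal.scale_scale [simp del]

definition nonzerodivisor :: "'a::comm_ring_1 set \<Rightarrow> 'a \<Rightarrow> bool"
  where "nonzerodivisor I x \<longleftrightarrow> (\<forall>p. x * p \<in> I \<longrightarrow> p \<in> I)"

text \<open>The quotient by the entries already used is represented by an ideal that grows along the
  list. Properness of the final ideal is kept apart and is established in
  \<open>depth_ge\<close>.\<close>

fun regular_on :: "'a::comm_ring_1 set \<Rightarrow> 'a list \<Rightarrow> bool"
  where
    "regular_on I [] = True"
  | "regular_on I (x # xs) = (nonzerodivisor I x \<and> regular_on (ideal.span (insert x I)) xs)"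

lemma nonzerodivisorD: "nonzerodivisor I x \<Longrightarrow> x * p \<in> I \<Longrightarrow> p \<in> I"
  by (simp add: nonzerodivisor_def)

lemma ideal_minus_commute:
  "ideal.subspace I \<Longrightarrow> x - y \<in> I \<longleftrightarrow> y - x \<in> I" for x :: "'a::comm_ring_1"
  using ideal.subspace_neg[of I "x - y"] ideal.subspace_neg[of I "y - x"] by auto

lemma ideal_mem_cong:
  "ideal.subspace I \<Longrightarrow> x - y \<in> I \<Longrightarrow> x \<in> I \<longleftrightarrow> y \<in> I" for x :: "'a::comm_ring_1"
  using ideal.subspace_diff[of I x "x - y"] ideal.subspace_add[of I "x - y" y] by auto

lemma mem_span_insert:
  "ideal.subspace I \<Longrightarrow> p \<in> ideal.span (insert x I) \<longleftrightarrow> (\<exists>q. p - q * x \<in> I)"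
  for x :: "'a::comm_ring_1"
  by (simp add: ideal.span_breakdown_eq ideal.span_eq_iff[THEN iffD2])

lemma span_Un_span:
  "ideal.span (A \<union> ideal.span B) = ideal.span (A \<union> B)" for A :: "'a::comm_ring_1 set"
proof (rule subset_antisym; rule ideal.span_minimal)
  have "A \<subseteq> ideal.span (A \<union> B)" "ideal.span B \<subseteq> ideal.span (A \<union> B)"
    by (auto intro: ideal.span_base ideal.span_mono[THEN subsetD])
  then show "A \<union> ideal.span B \<subseteq> ideal.span (A \<union> B)" by blast
  show "A \<union> B \<subseteq> ideal.span (A \<union> ideal.span B)"
    by (blast intro: ideal.span_base)
qed auto

lemma span_insert_span:
  "ideal.span (insert x (ideal.span B)) = ideal.span (insert x B)" for x :: "'a::comm_ring_1"
  using span_Un_span[of "{x}" B] by simp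

lemma span_insert_cong:
  fixes x y :: "'a::comm_ring_1"
  assumes "ideal.subspace I" "x - y \<in> I"
  shows "ideal.span (insert x I) = ideal.span (insert y I)"
proof -
  have "p \<in> ideal.span (insert x I) \<Longrightarrow> p \<in> ideal.span (insert y I)"
    if "x - y \<in> I" for p x y
  proof -
    assume "p \<in> ideal.span (insert x I)"
    then obtain q where "p - q * x \<in> I" using mem_span_insert[OF assms(1)] by blast
    moreover have "q * (x - y) \<in> I" using that assms(1) by (rule ideal.subspace_scale[rotated])
    ultimately have "(p - q * x) + q * (x - y) \<in> I" using assms(1) by (blast intro: ideal.subspace_add)
    then have "p - q * y \<in> I" by (simp add: algebra_simps)
    then show ?thesis using mem_span_insert[OF assms(1)] by blast
  qed
  from this[of x y] this[of y x] show ?thesis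
    using assms ideal_minus_commute[OF assms(1)] by blast
qed

lemma nonzerodivisor_cong:
  assumes "ideal.subspace I" "x - y \<in> I" "nonzerodivisor I x"
  shows "nonzerodivisor I y"
  unfolding nonzerodivisor_def
proof (intro allI impI)
  fix p assume yp: "y * p \<in> I"
  have "p * (x - y) \<in> I" by (rule ideal.subspace_scale[OF assms(1,2)])
  then have "x * p \<in> I" using ideal.subspace_add[OF assms(1) _ yp, of "p * (x - y)"]
    by (simp add: algebra_simps)
  then show "p \<in> I" using assms(3) by (rule nonzerodivisorD[rotated])
qed

lemma nonzerodivisor_mult:
  "nonzerodivisor I x \<Longrightarrow> nonzerodivisor I y \<Longrightarrow> nonzerodivisor I (x * y)"
  unfolding nonzerodivisor_def mult.assoc by blast

lemma nonzerodivisor_Int: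
  "nonzerodivisor I x \<Longrightarrow> nonzerodivisor J x \<Longrightarrow> nonzerodivisor (I \<inter> J) x"
  unfolding nonzerodivisor_def by blast

text \<open>If \<open>(x + w) p\<close> lies in \<open>I\<close>, then \<open>x\<close> and
  \<open>- w\<close> act alike on \<open>p\<close> modulo \<open>I\<close>, hence so do their
  \<open>k\<close>-th powers, and \<open>w ^ k\<close> acts as zero. It allows \<open>x_v\<close> to
  be replaced by \<open>x_v + x_l\<close> where \<open>x_l\<close> is nilpotent.\<close>

lemma nonzerodivisor_add_nilpotent:
  assumes I: "ideal.subspace I" and "nonzerodivisor I x" and "w ^ k \<in> I"
  shows "nonzerodivisor I (x + w)"
  unfolding nonzerodivisor_def
proof (intro allI impI)
  fix p assume "(x + w) * p \<in> I"
  have "x ^ j * p - (- w) ^ j * p \<in> I" for j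
  proof (induction j)
    case 0 show ?case using ideal.subspace_0[OF I] by simp
  next
    case (Suc j)
    have "x * (x ^ j * p - (- w) ^ j * p) \<in> I" "(- w) ^ j * ((x + w) * p) \<in> I"
      by (rule ideal.subspace_scale[OF I Suc], rule ideal.subspace_scale[OF I \<open>(x + w) * p \<in> I\<close>])
    from ideal.subspace_add[OF I this]
    have "x * (x ^ j * p - (- w) ^ j * p) + (- w) ^ j * ((x + w) * p) \<in> I" .
    moreover have "x * (u * p - v * p) + v * ((x + w) * p) = x * u * p - - w * v * p" for u v
      by (simp add: algebra_simps)
    ultimately show ?case unfolding power_Suc by (simp only:)
  qed
  from this[of k] have "x ^ k * p - (- w) ^ k * p \<in> I" .
  moreover have "((-1) ^ k * p) * w ^ k \<in> I" using assms(3) by (rule ideal.subspace_scale[OF I])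
  then have "(- w) ^ k * p \<in> I" by (subst power_minus) (simp only: mult_ac)
  ultimately have "x ^ k * p \<in> I" using ideal_mem_cong[OF I] by metis
  moreover have "nonzerodivisor I (x ^ k)"
  proof (induction k)
    case (Suc k) then show ?case unfolding power_Suc by (rule nonzerodivisor_mult[OF assms(2)])
  qed (simp add: nonzerodivisor_def)
  ultimately show "p \<in> I" by (rule nonzerodivisorD[rotated])
qed

lemma regular_on_append:
  "ideal.subspace I \<Longrightarrow>
    regular_on I (xs @ ys) \<longleftrightarrow> regular_on I xs \<and> regular_on (ideal.span (set xs \<union> I)) ys"
proof (induction xs arbitrary: I)
  case (Cons x xs)
  have *: "ideal.span (set xs \<union> ideal.span (insert x I)) = ideal.span (set (x # xs) \<union> I)"
    by (simp add: span_Un_span)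
  show ?case using Cons.IH[of "ideal.span (insert x I)"] unfolding * by simp
next
  case Nil
  then show ?case by (simp add: ideal.span_eq_iff[THEN iffD2])
qed

text \<open>A form \<open>y_i + x_j\<close> looks different on each component; every entry may be
  exchanged for the simpler form to which it reduces there.\<close>

lemma regular_on_cong:
  "ideal.subspace I \<Longrightarrow> list_all2 (\<lambda>x y. x - y \<in> I) xs ys \<Longrightarrow> regular_on I xs \<Longrightarrow> regular_on I ys"
proof (induction xs arbitrary: I ys)
  case (Cons x xs)
  then obtain y zs where ys: "ys = y # zs" and xy: "x - y \<in> I"
    and rest: "list_all2 (\<lambda>x y. x - y \<in> I) xs zs"
    by (auto simp: list_all2_Cons1)
  have "list_all2 (\<lambda>u v. u - v \<in> ideal.span (insert x I)) xs zs"
    using rest by (rule list_all2_mono) (auto intro: ideal.span_base)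
  then have "regular_on (ideal.span (insert x I)) zs"
    using Cons.prems(3) by (simp add: Cons.IH[OF ideal.subspace_span])
  moreover have "nonzerodivisor I x" using Cons.prems(3) by simp
  ultimately show ?case
    using nonzerodivisor_cong[OF Cons.prems(1) xy \<open>nonzerodivisor I x\<close>]
      span_insert_cong[OF Cons.prems(1) xy] by (simp add: ys)
qed simp

text \<open>If \<open>i\<^sub>1 + x s\<^sub>1 = i\<^sub>2 + x s\<^sub>2\<close>, then \<open>s\<^sub>1 - s\<^sub>2 \<in> I + J\<close> can be split, which moves the element
  into \<open>(I \<inter> J) + (x)\<close>.\<close>

lemma span_insert_Int:
  assumes I: "ideal.subspace I" and J: "ideal.subspace J" and x: "nonzerodivisor (ideal.span (I \<union> J)) x"
  shows "ideal.span (insert x (I \<inter> J)) = ideal.span (insert x I) \<inter> ideal.span (insert x J)"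
proof
  show "ideal.span (insert x (I \<inter> J)) \<subseteq> ideal.span (insert x I) \<inter> ideal.span (insert x J)"
    using ideal.span_mono[of "insert x (I \<inter> J)" "insert x I"]
      ideal.span_mono[of "insert x (I \<inter> J)" "insert x J"] by auto
  show "ideal.span (insert x I) \<inter> ideal.span (insert x J) \<subseteq> ideal.span (insert x (I \<inter> J))"
  proof
    fix p assume "p \<in> ideal.span (insert x I) \<inter> ideal.span (insert x J)"
    then obtain s s' where s: "p - s * x \<in> I" and s': "p - s' * x \<in> J"
      using mem_span_insert I J by blast
    have "(p - s * x) - (p - s' * x) \<in> ideal.span (I \<union> J)"
      by (rule ideal.span_diff) (use s s' in \<open>auto intro: ideal.span_base\<close>)
    then have "x * (s' - s) \<in> ideal.span (I \<union> J)" by (simp add: algebra_simps)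
    then have "s' - s \<in> ideal.span (I \<union> J)" using x by (rule nonzerodivisorD[rotated])
    then obtain a b where a: "a \<in> I" and b: "b \<in> J" and ab: "s' - s = a + b"
      unfolding ideal.span_Un using I J by (auto simp: ideal.span_eq_iff[THEN iffD2])
    have "(p - s * x) - x * a \<in> I" "(p - s' * x) + x * b \<in> J"
      using s s' a b I J by (auto intro: ideal.subspace_diff ideal.subspace_add ideal.subspace_scale)
    moreover have "(p - s * x) - x * a = p - (s + a) * x" by (simp add: algebra_simps)
    moreover have "(p - s' * x) + x * b = p - (s + a) * x"
      using arg_cong[OF ab, of "\<lambda>r. x * r"] by (simp add: algebra_simps)
    ultimately have "p - (s + a) * x \<in> I \<inter> J" by simp
    then show "p \<in> ideal.span (insert x (I \<inter> J))"
      using mem_span_insert[OF ideal.subspace_inter[OF I J]] by blast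
  qed
qed

text \<open>An entry \<open>x\<close> that is regular modulo \<open>I\<close> and modulo
  \<open>J\<close> is regular modulo \<open>I \<inter> J\<close>. Passing to the next entry needs
  \<open>(I \<inter> J) + (x) = (I + (x)) \<inter> (J + (x))\<close>, which is where
  \<open>I + J\<close> enters. After the last entry there is no next one, hence
  \<open>butlast\<close>; the form so exempted is the one that fails on the sum of the
  components.\<close>

lemma regular_on_Int:
  "ideal.subspace I \<Longrightarrow> ideal.subspace J \<Longrightarrow> regular_on I xs \<Longrightarrow> regular_on J xs \<Longrightarrow>
    regular_on (ideal.span (I \<union> J)) (butlast xs) \<Longrightarrow> regular_on (I \<inter> J) xs"
proof (induction xs arbitrary: I J)
  case (Cons x xs)
  have x: "nonzerodivisor (I \<inter> J) x" using Cons.prems by (intro nonzerodivisor_Int) simp_all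
  show ?case
  proof (cases "xs = []")
    case False
    then have sum: "nonzerodivisor (ideal.span (I \<union> J)) x"
      "regular_on (ideal.span (insert x (ideal.span (I \<union> J)))) (butlast xs)"
      using Cons.prems by auto
    have "ideal.span (ideal.span (insert x I) \<union> ideal.span (insert x J)) =
        ideal.span (insert x (ideal.span (I \<union> J)))"
      by (metis (no_types, lifting) Un_insert_left Un_insert_right insert_absorb2 span_Un_span
          span_insert_span sup_commute)
    then show ?thesis
      using x sum Cons.IH[of "ideal.span (insert x I)" "ideal.span (insert x J)"] Cons.prems
        span_insert_Int[OF Cons.prems(1,2) sum(1)] by simp
  qed (use x in simp)
qed simp

subsection \<open>Substitution homomorphisms\<close>

text \<open>The order of the variables induces a linear order of the monomials that is compatible
  with multiplication. It makes the polynomials over a field an integral domain and provides leading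
  monomials for the chain condition.\<close>

instantiation xyvar :: linorder
begin

primrec xyvar_code :: "xyvar \<Rightarrow> nat" where
  "xyvar_code (Xvar i) = 2 * i"
| "xyvar_code (Yvar i) = 2 * i + 1"

definition less_eq_xyvar :: "xyvar \<Rightarrow> xyvar \<Rightarrow> bool"
  where "less_eq_xyvar u v \<longleftrightarrow> xyvar_code u \<le> xyvar_code v"

definition less_xyvar :: "xyvar \<Rightarrow> xyvar \<Rightarrow> bool"
  where "less_xyvar u v \<longleftrightarrow> xyvar_code u < xyvar_code v"

instance
proof
  fix u v :: xyvar
  show "u \<le> v \<Longrightarrow> v \<le> u \<Longrightarrow> u = v"
    by (cases u; cases v) (simp_all add: less_eq_xyvar_def, presburger+)
qed (auto simp: less_eq_xyvar_def less_xyvar_def)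

end

abbreviation (input) lookup :: "('a \<Rightarrow>\<^sub>0 'b::zero) \<Rightarrow> 'a \<Rightarrow> 'b"
  where "lookup \<equiv> Poly_Mapping.lookup"

definition const :: "'k \<Rightarrow> ('v \<Rightarrow>\<^sub>0 nat) \<Rightarrow>\<^sub>0 'k::comm_ring_1"
  where "const c = Poly_Mapping.single 0 c"

lemma const_simps [simp]:
  "const 0 = 0" "const 1 = 1" "const (a + b) = const a + const b" "const (a * b) = const a * const b"
  "const (- a) = - const a"
  by (simp_all add: const_def single_add mult_single single_uminus)

lemma single_eq_const_mult:
  "Poly_Mapping.single m c = const c * Poly_Mapping.single m (1::'k::comm_ring_1)"
  for m :: "'v \<Rightarrow>\<^sub>0 nat"
  by (simp add: const_def mult_single)

lemma indet_power: "indet v ^ k = Poly_Mapping.single (Poly_Mapping.single v k) (1::'k::comm_ring_1)"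
proof (induction k)
  case (Suc k)
  have "Poly_Mapping.single v 1 + Poly_Mapping.single v k = Poly_Mapping.single v (Suc k)"
    by (simp add: single_add[symmetric])
  then show ?case using Suc by (simp add: indet_def mult_single)
qed simp

lemma poly_mapping_sum_single:
  "p = (\<Sum>m\<in>Poly_Mapping.keys p. Poly_Mapping.single m (lookup p m))"
  by (rule poly_mapping_eqI) (auto simp: lookup_sum lookup_single when_def in_keys_iff)

definition mono_subst :: "('v \<Rightarrow> 'a::comm_ring_1) \<Rightarrow> ('v \<Rightarrow>\<^sub>0 nat) \<Rightarrow> 'a"
  where "mono_subst f m = (\<Prod>v\<in>Poly_Mapping.keys m. f v ^ lookup m v)"

lemma mono_subst_superset:
  "finite A \<Longrightarrow> Poly_Mapping.keys m \<subseteq> A \<Longrightarrow> mono_subst f m = (\<Prod>v\<in>A. f v ^ lookup m v)"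
  unfolding mono_subst_def
  by (rule prod.mono_neutral_left) (auto simp: in_keys_iff)

lemma mono_subst_0 [simp]: "mono_subst f 0 = 1"
  by (simp add: mono_subst_def)

lemma mono_subst_add: "mono_subst f (m + n) = mono_subst f m * mono_subst f n"
proof -
  let ?A = "Poly_Mapping.keys m \<union> Poly_Mapping.keys n"
  have "Poly_Mapping.keys (m + n) \<subseteq> ?A" by (rule Poly_Mapping.keys_add)
  then show ?thesis
    by (simp add: mono_subst_superset[of ?A] lookup_add power_add prod.distrib)
qed

lemma mono_subst_single [simp]: "mono_subst f (Poly_Mapping.single v k) = f v ^ k"
  by (simp add: mono_subst_def)

lemma mono_subst_indet: "mono_subst indet m = Poly_Mapping.single m (1::'k::comm_ring_1)"
proof -
  have "(\<Prod>v\<in>A. Poly_Mapping.single (Poly_Mapping.single v (lookup m v)) (1::'k)) =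
      Poly_Mapping.single (\<Sum>v\<in>A. Poly_Mapping.single v (lookup m v)) 1" if "finite A" for A
    using that by (induction A) (auto simp: mult_single)
  from this[of "Poly_Mapping.keys m"] show ?thesis
    by (simp add: mono_subst_def indet_power poly_mapping_sum_single[symmetric])
qed

definition subst :: "('v \<Rightarrow> ('w \<Rightarrow>\<^sub>0 nat) \<Rightarrow>\<^sub>0 'k) \<Rightarrow> (('v \<Rightarrow>\<^sub>0 nat) \<Rightarrow>\<^sub>0 'k) \<Rightarrow> ('w \<Rightarrow>\<^sub>0 nat) \<Rightarrow>\<^sub>0 'k::comm_ring_1"
  where "subst f p = (\<Sum>m\<in>Poly_Mapping.keys p. const (lookup p m) * mono_subst f m)"

lemma subst_superset:
  "finite A \<Longrightarrow> Poly_Mapping.keys p \<subseteq> A \<Longrightarrow> subst f p = (\<Sum>m\<in>A. const (lookup p m) * mono_subst f m)"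
  unfolding subst_def by (rule sum.mono_neutral_left) (auto simp: in_keys_iff)

lemma subst_0 [simp]: "subst f 0 = 0"
  by (simp add: subst_def)

lemma subst_single: "subst f (Poly_Mapping.single m c) = const c * mono_subst f m"
  by (simp add: subst_def)

lemma subst_add [simp]: "subst f (p + q) = subst f p + subst f q"
proof -
  let ?A = "Poly_Mapping.keys p \<union> Poly_Mapping.keys q"
  have "Poly_Mapping.keys (p + q) \<subseteq> ?A" by (rule Poly_Mapping.keys_add)
  then show ?thesis
    by (simp add: subst_superset[of ?A] lookup_add distrib_right sum.distrib)
qed

lemma subst_sum: "subst f (sum g A) = (\<Sum>a\<in>A. subst f (g a))"
  by (induction A rule: infinite_finite_induct) auto

lemma subst_mult [simp]: "subst f (p * q) = subst f p * subst f q"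
proof -
  let ?s = "\<lambda>p m. Poly_Mapping.single m (lookup p m)"
  have "p * q = (\<Sum>m\<in>Poly_Mapping.keys p. \<Sum>n\<in>Poly_Mapping.keys q. ?s p m * ?s q n)"
    by (subst (1) poly_mapping_sum_single[of p], subst (1) poly_mapping_sum_single[of q])
      (simp add: sum_product)
  moreover have "subst f (?s p m * ?s q n) = subst f (?s p m) * subst f (?s q n)" for m n
    by (simp add: mult_single subst_single mono_subst_add mult_ac)
  ultimately have "subst f (p * q) =
      (\<Sum>m\<in>Poly_Mapping.keys p. \<Sum>n\<in>Poly_Mapping.keys q. subst f (?s p m) * subst f (?s q n))"
    by (simp add: subst_sum)
  also have "\<dots> = subst f (\<Sum>m\<in>Poly_Mapping.keys p. ?s p m) * subst f (\<Sum>n\<in>Poly_Mapping.keys q. ?s q n)"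
    by (simp add: subst_sum sum_product)
  finally show ?thesis by (simp add: poly_mapping_sum_single[symmetric])
qed

lemma subst_const [simp]: "subst f (const c) = const c"
  by (simp add: const_def subst_single)

lemma subst_1 [simp]: "subst f 1 = 1"
  using subst_const[of f 1] by (simp del: subst_const)

lemma subst_uminus [simp]: "subst f (- p) = - subst f p"
  by (metis add_eq_0_iff subst_0 subst_add)

lemma subst_diff [simp]: "subst f (p - q) = subst f p - subst f q"
  by (metis add_uminus_conv_diff subst_add subst_uminus)

lemma subst_power [simp]: "subst f (p ^ k) = subst f p ^ k"
  by (induction k) auto

lemma subst_indet [simp]: "subst f (indet v) = f v"
  by (simp add: indet_def subst_single)

definition polys_over :: "'v set \<Rightarrow> (('v \<Rightarrow>\<^sub>0 nat) \<Rightarrow>\<^sub>0 'k::comm_ring_1) set"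
  where "polys_over V = {p. \<forall>m\<in>Poly_Mapping.keys p. Poly_Mapping.keys m \<subseteq> V}"

lemma polys_over_UNIV [simp]: "polys_over UNIV = UNIV"
  by (simp add: polys_over_def)

lemma carrier_poly_ring: "carrier (poly_ring K V) = polys_over V"
  by (simp add: poly_ring_def polys_over_def)

lemma polys_over_closed [intro]:
  fixes p q :: "('v \<Rightarrow>\<^sub>0 nat) \<Rightarrow>\<^sub>0 'k::comm_ring_1"
  shows "p \<in> polys_over V \<Longrightarrow> q \<in> polys_over V \<Longrightarrow> p + q \<in> polys_over V"
    "p \<in> polys_over V \<Longrightarrow> q \<in> polys_over V \<Longrightarrow> p * q \<in> polys_over V"
    "p \<in> polys_over V \<Longrightarrow> - p \<in> polys_over V"
    "v \<in> V \<Longrightarrow> (indet v :: ('v \<Rightarrow>\<^sub>0 nat) \<Rightarrow>\<^sub>0 'k) \<in> polys_over V"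
  using poly_ring_closed[of p "TYPE('k)" V q] poly_ring_uminus_closed[of p "TYPE('k)" V]
    indet_in_poly_ring[of v V "TYPE('k)"]
  by (simp_all add: carrier_poly_ring)

lemma polys_over_const [intro]: "const c \<in> polys_over V"
  by (simp add: polys_over_def const_def)

lemma polys_over_closed' [intro]:
  "0 \<in> polys_over V" "1 \<in> polys_over V"
  "p \<in> polys_over V \<Longrightarrow> q \<in> polys_over V \<Longrightarrow> p - q \<in> polys_over V"
  "p \<in> polys_over V \<Longrightarrow> p ^ k \<in> polys_over V"
proof -
  show "0 \<in> polys_over V" and 1: "1 \<in> polys_over V"
    using polys_over_const[of 0 V] polys_over_const[of 1 V] by simp_all
  show "p \<in> polys_over V \<Longrightarrow> q \<in> polys_over V \<Longrightarrow> p - q \<in> polys_over V"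
    using polys_over_closed(1)[of p V "- q"] polys_over_closed(3)[of q V] by simp
  show "p \<in> polys_over V \<Longrightarrow> p ^ k \<in> polys_over V"
    by (induction k) (auto intro: 1)
qed

lemma polys_over_sum: "(\<And>a. a \<in> A \<Longrightarrow> g a \<in> polys_over V) \<Longrightarrow> sum g A \<in> polys_over V"
  by (induction A rule: infinite_finite_induct) auto

text \<open>A polynomial is a sum of constants times products of variables, and the polynomials with
  the property are closed under both operations. Identities between homomorphisms are thereby
  checked on constants and variables.\<close>

lemma polys_over_induct [consumes 1, case_names const indet add mult]:
  assumes p: "p \<in> polys_over V"
    and "\<And>c. P (const c)" "\<And>v. v \<in> V \<Longrightarrow> P (indet v)"
    and "\<And>p q. p \<in> polys_over V \<Longrightarrow> q \<in> polys_over V \<Longrightarrow> P p \<Longrightarrow> P q \<Longrightarrow> P (p + q)"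
    and "\<And>p q. p \<in> polys_over V \<Longrightarrow> q \<in> polys_over V \<Longrightarrow> P p \<Longrightarrow> P q \<Longrightarrow> P (p * q)"
  shows "P p"
proof -
  define S where "S = {p \<in> polys_over V. P p}"
  have 1: "1 \<in> S" and 0: "0 \<in> S" using assms(2)[of 1] assms(2)[of 0] by (auto simp: S_def)
  have add: "p + q \<in> S" and mult: "p * q \<in> S" if "p \<in> S" "q \<in> S" for p q
    using that assms(4,5) by (auto simp: S_def)
  have sum: "(\<And>a. a \<in> A \<Longrightarrow> g a \<in> S) \<Longrightarrow> sum g A \<in> S" for A and g :: "('a \<Rightarrow>\<^sub>0 nat) \<Rightarrow> _"
    by (induction A rule: infinite_finite_induct) (auto intro: add 0)
  have prod: "(\<And>a. a \<in> A \<Longrightarrow> g a \<in> S) \<Longrightarrow> prod g A \<in> S" for A and g :: "'a \<Rightarrow> _"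
    by (induction A rule: infinite_finite_induct) (auto intro: mult 1)
  have power: "q \<in> S \<Longrightarrow> q ^ k \<in> S" for q k by (induction k) (auto intro: mult 1)
  have const: "const c \<in> S" for c using assms(2) by (auto simp: S_def)
  have indet: "indet v \<in> S" if "v \<in> V" for v using that assms(3) by (auto simp: S_def)
  have single: "Poly_Mapping.single m (lookup p m) \<in> S" if "m \<in> Poly_Mapping.keys p" for m
  proof -
    have "Poly_Mapping.keys m \<subseteq> V" using p that by (auto simp: polys_over_def)
    then have "mono_subst indet m \<in> S"
      unfolding mono_subst_def by (auto intro!: prod power indet)
    then show ?thesis
      unfolding mono_subst_indet single_eq_const_mult[of m "lookup p m"] by (rule mult[OF const])
  qed
  have "(\<Sum>m\<in>Poly_Mapping.keys p. Poly_Mapping.single m (lookup p m)) \<in> S"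
    by (rule sum) (rule single)
  then have "p \<in> S" by (simp add: poly_mapping_sum_single[symmetric])
  then show ?thesis by (simp add: S_def)
qed

lemma subst_cong:
  "p \<in> polys_over V \<Longrightarrow> (\<And>v. v \<in> V \<Longrightarrow> f v = g v) \<Longrightarrow> subst f p = subst g p"
  by (induction p rule: polys_over_induct) auto

lemma subst_subst: "subst g (subst f p) = subst (\<lambda>v. subst g (f v)) p"
proof -
  have "p \<in> polys_over UNIV" by simp
  then show ?thesis by (induction p rule: polys_over_induct) auto
qed

lemma subst_indet_id [simp]: "subst indet p = p"
proof -
  have "p \<in> polys_over UNIV" by simp
  then show ?thesis by (induction p rule: polys_over_induct) auto
qed

lemma subst_polys_over:
  "p \<in> polys_over V \<Longrightarrow> (\<And>v. v \<in> V \<Longrightarrow> f v \<in> polys_over W) \<Longrightarrow> subst f p \<in> polys_over W"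
  by (induction p rule: polys_over_induct) auto

lemma subst_span:
  assumes "ideal.subspace I" "\<And>a. a \<in> A \<Longrightarrow> subst f a \<in> I" "p \<in> ideal.span A"
  shows "subst f p \<in> I"
  using assms(3)
  by (induction rule: ideal.span_induct_alt)
    (auto intro!: ideal.subspace_0 ideal.subspace_add ideal.subspace_scale assms)

section \<open>Setting a set of variables to zero\<close>

definition kill :: "'v set \<Rightarrow> (('v \<Rightarrow>\<^sub>0 nat) \<Rightarrow>\<^sub>0 'k) \<Rightarrow> ('v \<Rightarrow>\<^sub>0 nat) \<Rightarrow>\<^sub>0 'k::comm_ring_1"
  where "kill W = subst (\<lambda>v. if v \<in> W then 0 else indet v)"

lemma kill_simps [simp]:
  "kill W (p + q) = kill W p + kill W q" "kill W (p * q) = kill W p * kill W q"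
  "kill W (p - q) = kill W p - kill W q" "kill W (- p) = - kill W p" "kill W (p ^ k) = kill W p ^ k"
  "kill W 0 = 0" "kill W 1 = 1" "kill W (const c) = const c"
  "kill W (indet v) = (if v \<in> W then 0 else indet v)"
  by (simp_all add: kill_def)

lemma kill_id: "p \<in> polys_over V \<Longrightarrow> V \<inter> W = {} \<Longrightarrow> kill W p = p"
  by (induction p rule: polys_over_induct) auto

lemma kill_polys_over: "kill W p \<in> polys_over (- W)"
  unfolding kill_def by (rule subst_polys_over[of p UNIV]) auto

lemma kill_kill: "kill W (kill W' p) = kill (W \<union> W') p"
  unfolding kill_def subst_subst by (rule arg_cong[of _ _ "\<lambda>f. subst f p"]) (auto simp: fun_eq_iff)

lemma diff_kill_in_span: "p - kill W p \<in> ideal.span (indet ` W)"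
proof -
  have "p \<in> polys_over UNIV" by simp
  then show ?thesis
  proof (induction p rule: polys_over_induct)
    case (add p q)
    have "p + q - kill W (p + q) = (p - kill W p) + (q - kill W q)" by simp
    then show ?case using add by (metis ideal.span_add)
  next
    case (mult p q)
    have "p * q - kill W (p * q) = p * (q - kill W q) + kill W q * (p - kill W p)"
      by (simp add: algebra_simps)
    then show ?case using mult by (metis ideal.span_add ideal.span_scale)
  qed (auto intro: ideal.span_base ideal.span_zero)
qed

lemma kill_subspace: "ideal.subspace I \<Longrightarrow> ideal.subspace {p. kill W p \<in> I}"
  unfolding ideal.subspace_def by auto

text \<open>\<open>kill W\<close> is a retraction whose kernel is generated by the variables in
  \<open>W\<close>. If it preserves \<open>I\<close>, membership in \<open>I\<close> plus these
  variables is membership of the image in \<open>I\<close>, so questions modulo the larger ideal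
  return to \<open>I\<close>.\<close>

lemma span_Un_indets:
  assumes I: "ideal.subspace I" and "\<And>p. p \<in> I \<Longrightarrow> kill W p \<in> I"
  shows "ideal.span (I \<union> indet ` W) = {p. kill W p \<in> I}"
proof
  show "ideal.span (I \<union> indet ` W) \<subseteq> {p. kill W p \<in> I}"
    using assms ideal.subspace_0[OF I] by (intro ideal.span_minimal kill_subspace) auto
  show "{p. kill W p \<in> I} \<subseteq> ideal.span (I \<union> indet ` W)"
  proof
    fix p assume "p \<in> {p. kill W p \<in> I}"
    then have "kill W p \<in> ideal.span (I \<union> indet ` W)" by (auto intro: ideal.span_base)
    moreover have "p - kill W p \<in> ideal.span (I \<union> indet ` W)"
      using diff_kill_in_span ideal.span_mono[of "indet ` W" "I \<union> indet ` W"] by blast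
    ultimately show "p \<in> ideal.span (I \<union> indet ` W)"
      using ideal.span_add[of "kill W p" _ "p - kill W p"] by simp
  qed
qed

lemma span_indets: "p \<in> ideal.span (indet ` W) \<longleftrightarrow> kill W p = 0"
  for p :: "('v \<Rightarrow>\<^sub>0 nat) \<Rightarrow>\<^sub>0 'k::comm_ring_1"
proof -
  have "ideal.span (indet ` W) = {p :: (_ \<Rightarrow>\<^sub>0 'k). kill W p = 0}"
    using span_Un_indets[of "{0 :: _ \<Rightarrow>\<^sub>0 'k}" W]
      span_Un_span[of "indet ` W :: (_ \<Rightarrow>\<^sub>0 'k) set" "{}"] by simp
  then show ?thesis by auto
qed

lemma kill_span_insert:
  assumes "\<And>p. p \<in> I \<Longrightarrow> kill W p \<in> I" "ideal.subspace I" "kill W x = x" "p \<in> ideal.span (insert x I)"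
  shows "kill W p \<in> ideal.span (insert x I)"
proof -
  obtain q where "p - q * x \<in> I" using assms mem_span_insert by blast
  then have "kill W p - kill W q * x \<in> I" using assms(1)[of "p - q * x"] assms(3) by simp
  then show ?thesis using assms(2) mem_span_insert by blast
qed

lemma span_span_insert_Un:
  "ideal.span (ideal.span (insert x I) \<union> A) = ideal.span (insert x (ideal.span (I \<union> A)))"
  for x :: "'a::comm_ring_1"
proof -
  have "A \<union> insert x I = insert x (I \<union> A)" by auto
  then show ?thesis
    using span_Un_span[of A "insert x I"] by (simp add: span_insert_span Un_commute)
qed

text \<open>For entries fixed by \<open>kill W\<close>, the condition on \<open>p\<close> modulo the
  larger ideal is the condition on \<open>kill W p\<close> modulo \<open>I\<close>. Stability under
  \<open>kill W\<close> survives adjoining such an entry to \<open>I\<close>, which carries the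
  induction.\<close>

lemma regular_on_Un_indets:
  "ideal.subspace I \<Longrightarrow> (\<And>p. p \<in> I \<Longrightarrow> kill W p \<in> I) \<Longrightarrow> (\<And>x. x \<in> set xs \<Longrightarrow> kill W x = x) \<Longrightarrow>
    regular_on I xs \<Longrightarrow> regular_on (ideal.span (I \<union> indet ` W)) xs"
proof (induction xs arbitrary: I)
  case (Cons x xs)
  have eq: "ideal.span (I \<union> indet ` W) = {p. kill W p \<in> I}"
    by (rule span_Un_indets[OF Cons.prems(1)]) (rule Cons.prems(2))
  have "nonzerodivisor I x" "kill W x = x" using Cons.prems by simp_all
  then have "nonzerodivisor (ideal.span (I \<union> indet ` W)) x"
    unfolding nonzerodivisor_def eq by simp
  moreover have "regular_on (ideal.span (ideal.span (insert x I) \<union> indet ` W)) xs"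
  proof (rule Cons.IH)
    show "kill W p \<in> ideal.span (insert x I)" if "p \<in> ideal.span (insert x I)" for p
      using kill_span_insert[OF Cons.prems(2,1) \<open>kill W x = x\<close> that] .
  qed (use Cons.prems in auto)
  moreover have "ideal.span (ideal.span (insert x I) \<union> indet ` W) =
      ideal.span (insert x (ideal.span (I \<union> indet ` W)))"
    by (rule span_span_insert_Un)
  ultimately show ?case by simp
qed simp

lemma indet_neq_0 [simp]: "indet v \<noteq> (0 :: _ \<Rightarrow>\<^sub>0 'k::comm_ring_1)"
  unfolding indet_def by (metis lookup_single_eq lookup_zero zero_neq_one)

lemma regular_on_indets:
  fixes vs :: "'v::linorder list"
  shows "distinct vs \<Longrightarrow> set vs \<inter> W = {} \<Longrightarrow>
    regular_on (ideal.span (indet ` W) :: (_ \<Rightarrow>\<^sub>0 'k::idom) set) (map indet vs)"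
proof (induction vs arbitrary: W)
  case (Cons v vs)
  have "nonzerodivisor (ideal.span (indet ` W) :: (_ \<Rightarrow>\<^sub>0 'k) set) (indet v)"
    using Cons.prems by (auto simp: nonzerodivisor_def span_indets)
  moreover have "ideal.span (insert (indet v) (ideal.span (indet ` W))) =
      (ideal.span (indet ` insert v W) :: (_ \<Rightarrow>\<^sub>0 'k) set)"
    by (simp add: span_insert_span)
  ultimately show ?case using Cons.IH[of "insert v W"] Cons.prems by auto
qed simp

subsection \<open>Graded ideals and permutability of regular sequences\<close>

text \<open>Three weights occur: \<open>std_wt\<close>, the weight \<open>row_wt\<close> that
  ignores the two row parameters of the Segre map, and the constant weight 1 in the counting of
  monomials.\<close>

definition wdeg :: "('v \<Rightarrow> nat) \<Rightarrow> ('v \<Rightarrow>\<^sub>0 nat) \<Rightarrow> nat"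
  where "wdeg w m = (\<Sum>v\<in>Poly_Mapping.keys m. w v * lookup m v)"

lemma wdeg_superset:
  "finite A \<Longrightarrow> Poly_Mapping.keys m \<subseteq> A \<Longrightarrow> wdeg w m = (\<Sum>v\<in>A. w v * lookup m v)"
  unfolding wdeg_def by (rule sum.mono_neutral_left) (auto simp: in_keys_iff)

lemma wdeg_add [simp]: "wdeg w (m + n) = wdeg w m + wdeg w n"
proof -
  let ?A = "Poly_Mapping.keys m \<union> Poly_Mapping.keys n"
  have "Poly_Mapping.keys (m + n) \<subseteq> ?A" by (rule Poly_Mapping.keys_add)
  then show ?thesis
    by (simp add: wdeg_superset[of ?A] lookup_add distrib_left sum.distrib)
qed

lemma wdeg_0 [simp]: "wdeg w 0 = 0"
  by (simp add: wdeg_def)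

lemma wdeg_single [simp]: "wdeg w (Poly_Mapping.single v k) = w v * k"
  by (simp add: wdeg_def)

definition homogeneous :: "('v \<Rightarrow> nat) \<Rightarrow> nat \<Rightarrow> (('v \<Rightarrow>\<^sub>0 nat) \<Rightarrow>\<^sub>0 'k::comm_ring_1) \<Rightarrow> bool"
  where "homogeneous w d p \<longleftrightarrow> (\<forall>m\<in>Poly_Mapping.keys p. wdeg w m = d)"

lemma homogeneous_0 [simp]: "homogeneous w d 0"
  by (simp add: homogeneous_def)

lemma homogeneous_const [simp]: "homogeneous w 0 (const c)"
  by (simp add: homogeneous_def const_def)

lemma homogeneous_1 [simp]: "homogeneous w 0 1"
  using homogeneous_const[of w 1] by simp

lemma homogeneous_indet: "w v = d \<Longrightarrow> homogeneous w d (indet v)"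
  by (simp add: homogeneous_def indet_def)

lemma homogeneous_add: "homogeneous w d p \<Longrightarrow> homogeneous w d q \<Longrightarrow> homogeneous w d (p + q)"
  unfolding homogeneous_def using Poly_Mapping.keys_add[of p q] by blast

lemma homogeneous_uminus: "homogeneous w d p \<Longrightarrow> homogeneous w d (- p)"
  unfolding homogeneous_def by simp

lemma homogeneous_diff: "homogeneous w d p \<Longrightarrow> homogeneous w d q \<Longrightarrow> homogeneous w d (p - q)"
  using homogeneous_add[of w d p "- q"] homogeneous_uminus[of w d q] by simp

lemma homogeneous_sum: "(\<And>a. a \<in> A \<Longrightarrow> homogeneous w d (g a)) \<Longrightarrow> homogeneous w d (sum g A)"
  by (induction A rule: infinite_finite_induct) (auto intro: homogeneous_add)

lemma homogeneous_mult: "homogeneous w d p \<Longrightarrow> homogeneous w e q \<Longrightarrow> homogeneous w (d + e) (p * q)"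
  unfolding homogeneous_def using keys_mult[of p q] by fastforce

lemma homogeneous_power: "homogeneous w d p \<Longrightarrow> homogeneous w (d * k) (p ^ k)"
  by (induction k) (auto dest: homogeneous_mult)

lemma homogeneous_prod:
  "(\<And>a. a \<in> A \<Longrightarrow> homogeneous w (e a) (g a)) \<Longrightarrow> homogeneous w (sum e A) (prod g A)"
  by (induction A rule: infinite_finite_induct) (auto intro: homogeneous_mult)

lift_definition hcomp :: "('v \<Rightarrow> nat) \<Rightarrow> nat \<Rightarrow> (('v \<Rightarrow>\<^sub>0 nat) \<Rightarrow>\<^sub>0 'k::comm_ring_1) \<Rightarrow> ('v \<Rightarrow>\<^sub>0 nat) \<Rightarrow>\<^sub>0 'k"
  is "\<lambda>w d p m. if wdeg w m = d then p m else 0"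
  by (rule finite_subset) auto

lemma lookup_hcomp: "lookup (hcomp w d p) m = (if wdeg w m = d then lookup p m else 0)"
  by transfer simp

lemma hcomp_add: "hcomp w d (p + q) = hcomp w d p + hcomp w d q"
  by (rule poly_mapping_eqI) (simp add: lookup_hcomp lookup_add)

lemma hcomp_0 [simp]: "hcomp w d 0 = 0"
  by (rule poly_mapping_eqI) (simp add: lookup_hcomp)

lemma hcomp_sum: "hcomp w d (sum g A) = (\<Sum>a\<in>A. hcomp w d (g a))"
  by (induction A rule: infinite_finite_induct) (auto simp: hcomp_add)

lemma homogeneous_hcomp: "homogeneous w d (hcomp w d p)"
  by (auto simp: homogeneous_def in_keys_iff lookup_hcomp split: if_splits)

lemma hcomp_homogeneous: "homogeneous w d p \<Longrightarrow> hcomp w e p = (if e = d then p else 0)"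
  by (rule poly_mapping_eqI) (auto simp: homogeneous_def in_keys_iff lookup_hcomp)

lemma sum_hcomp: "\<exists>N. p = (\<Sum>d<N. hcomp w d p)"
proof
  define N where "N = Suc (Max (wdeg w ` Poly_Mapping.keys p))"
  show "p = (\<Sum>d<N. hcomp w d p)"
  proof (rule poly_mapping_eqI)
    fix m
    show "lookup p m = lookup (\<Sum>d<N. hcomp w d p) m"
    proof (cases "m \<in> Poly_Mapping.keys p")
      case True
      then have "wdeg w m < N" unfolding N_def by (auto simp: less_Suc_eq_le)
      then show ?thesis by (simp add: lookup_sum lookup_hcomp)
    qed (simp add: lookup_sum lookup_hcomp in_keys_iff)
  qed
qed

lemma hcomp_mult:
  assumes "homogeneous w d p"
  shows "hcomp w e (p * q) = (if d \<le> e then p * hcomp w (e - d) q else 0)"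
proof -
  obtain N where N: "q = (\<Sum>k<N. hcomp w k q)" using sum_hcomp by blast
  have "hcomp w e (p * q) = (\<Sum>k<N. hcomp w e (p * hcomp w k q))"
    by (subst N) (simp add: sum_distrib_left hcomp_sum)
  also have "\<dots> = (\<Sum>k<N. if d \<le> e then p * hcomp w (e - d) (hcomp w k q) else 0)"
    by (rule sum.cong)
      (auto simp: hcomp_homogeneous[OF homogeneous_mult[OF assms homogeneous_hcomp]]
        hcomp_homogeneous[OF homogeneous_hcomp])
  also have "\<dots> = (if d \<le> e then p * hcomp w (e - d) (\<Sum>k<N. hcomp w k q) else 0)"
    by (simp add: hcomp_sum sum_distrib_left)
  finally show ?thesis using N by simp
qed

definition graded :: "('v \<Rightarrow> nat) \<Rightarrow> (('v \<Rightarrow>\<^sub>0 nat) \<Rightarrow>\<^sub>0 'k::comm_ring_1) set \<Rightarrow> bool"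
  where "graded w I \<longleftrightarrow> (\<forall>p\<in>I. \<forall>d. hcomp w d p \<in> I)"

lemma graded_span:
  assumes "\<And>a d. a \<in> A \<Longrightarrow> hcomp w d a \<in> ideal.span A"
  shows "graded w (ideal.span A)"
  unfolding graded_def
proof (intro ballI allI)
  fix p d assume "p \<in> ideal.span A"
  then show "hcomp w d p \<in> ideal.span A"
  proof (induction arbitrary: d rule: ideal.span_induct_alt)
    case base then show ?case by (simp add: ideal.span_zero)
  next
    case (step c x y)
    obtain N where N: "c = (\<Sum>k<N. hcomp w k c)" using sum_hcomp by blast
    have "hcomp w d (hcomp w k c * x) \<in> ideal.span A" for k
      by (simp add: hcomp_mult[OF homogeneous_hcomp] assms[OF step(1)] ideal.span_scale ideal.span_zero)
    then have "hcomp w d (c * x) \<in> ideal.span A"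
      by (subst N) (simp add: sum_distrib_right hcomp_sum ideal.span_sum)
    then show ?case using step(2) by (simp add: hcomp_add ideal.span_add)
  qed
qed

lemma graded_span_homogeneous:
  "(\<And>a. a \<in> A \<Longrightarrow> \<exists>d. homogeneous w d a) \<Longrightarrow> graded w (ideal.span A)"
  by (rule graded_span)
    (metis (full_types) hcomp_homogeneous ideal.span_base ideal.span_zero)

lemma graded_span_insert:
  "graded w I \<Longrightarrow> homogeneous w d x \<Longrightarrow> graded w (ideal.span (insert x I))"
  by (rule graded_span)
    (auto simp: graded_def hcomp_homogeneous intro: ideal.span_base ideal.span_zero)

text \<open>Nakayama's lemma: \<open>K \<subseteq> I + x K\<close> and the degrees in \<open>x K\<close> are larger.\<close>

lemma graded_nakayama:
  assumes I: "ideal.subspace I" "graded w I" and K: "ideal.subspace K" "graded w K" and "I \<subseteq> K"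
    and x: "homogeneous w e x" "0 < e"
    and KI: "K \<subseteq> ideal.span (insert x I)" and xK: "\<And>q. x * q \<in> K \<Longrightarrow> q \<in> K"
  shows "K \<subseteq> I"
proof
  have "p \<in> I" if "p \<in> K" "homogeneous w d p" for p d
    using that
  proof (induction d arbitrary: p rule: less_induct)
    case (less d)
    obtain q where q: "p - q * x \<in> I" using KI less.prems(1) mem_span_insert[OF I(1)] by blast
    have "p = (p - q * x) + x * q" by (simp add: mult.commute)
    then have "hcomp w d p = hcomp w d (p - q * x) + hcomp w d (x * q)" by (metis hcomp_add)
    moreover have "hcomp w d p = p" using hcomp_homogeneous[OF less.prems(2)] by simp
    ultimately have p: "p = hcomp w d (p - q * x) + (if e \<le> d then x * hcomp w (d - e) q else 0)"
      using hcomp_mult[OF x(1)] by simp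
    have i: "hcomp w d (p - q * x) \<in> I" using q I(2) by (simp add: graded_def)
    show ?case
    proof (cases "e \<le> d")
      case True
      have "p - hcomp w d (p - q * x) \<in> K"
        using less.prems(1) i \<open>I \<subseteq> K\<close> by (intro ideal.subspace_diff[OF K(1)]) auto
      moreover have "p - hcomp w d (p - q * x) = x * hcomp w (d - e) q"
        using p True by (metis add_diff_cancel_left')
      ultimately have "hcomp w (d - e) q \<in> K" using xK by simp
      then have "hcomp w (d - e) q \<in> I"
        using less.IH[OF _ _ homogeneous_hcomp, of "d - e" q] x(2) True by simp
      then have "x * hcomp w (d - e) q \<in> I" by (rule ideal.subspace_scale[OF I(1)])
      then show ?thesis using p True i ideal.subspace_add[OF I(1)] by metis
    qed (use p i in simp)
  qed
  then have hc: "hcomp w d p \<in> I" if "p \<in> K" for p d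
    using that K(2) homogeneous_hcomp unfolding graded_def by blast
  fix p assume "p \<in> K"
  obtain N where "p = (\<Sum>k<N. hcomp w k p)" using sum_hcomp by blast
  then show "p \<in> I" using hc[OF \<open>p \<in> K\<close>] ideal.subspace_sum[OF I(1), of "{..<N}"] by metis
qed

definition pos_homogeneous :: "('v \<Rightarrow> nat) \<Rightarrow> (('v \<Rightarrow>\<^sub>0 nat) \<Rightarrow>\<^sub>0 'k::comm_ring_1) \<Rightarrow> bool"
  where "pos_homogeneous w p \<longleftrightarrow> (\<exists>d>0. homogeneous w d p)"

text \<open>The point that is not formal is that \<open>y\<close> is regular modulo
  \<open>I\<close>. The colon ideal \<open>K\<close> of \<open>I\<close> by \<open>y\<close> is
  contained in \<open>I + (x)\<close>, because \<open>y\<close> is regular there, and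
  \<open>x\<close> cancels in \<open>K\<close>; hence Nakayama's lemma gives
  \<open>K \<subseteq> I\<close>. That \<open>x\<close> is regular modulo \<open>I + (y)\<close> is
  then an exchange of the coefficients of \<open>x\<close> and \<open>y\<close>.\<close>

lemma regular_on_swap:
  assumes I: "ideal.subspace I" "graded w I" and "pos_homogeneous w x" "pos_homogeneous w y"
    and reg: "regular_on I (x # y # zs)"
  shows "regular_on I (y # x # zs)"
proof -
  obtain d e where x: "homogeneous w d x" "0 < d" and y: "homogeneous w e y"
    using assms(3,4) by (auto simp: pos_homogeneous_def)
  have rx: "nonzerodivisor I x" and ry: "nonzerodivisor (ideal.span (insert x I)) y"
    using reg by auto
  define K where "K = {p. y * p \<in> I}"
  have K: "ideal.subspace K"
    using I(1) unfolding K_def ideal.subspace_def by (auto simp: distrib_left mult.left_commute)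
  have "hcomp w k p \<in> K" if "p \<in> K" for p k
  proof -
    have "hcomp w (e + k) (y * p) \<in> I" using that I(2) by (auto simp: K_def graded_def)
    then show ?thesis using hcomp_mult[OF y, of "e + k" p] by (simp add: K_def)
  qed
  then have "graded w K" by (simp add: graded_def)
  moreover have "I \<subseteq> K" using I(1) by (auto simp: K_def intro: ideal.subspace_scale)
  moreover have "K \<subseteq> ideal.span (insert x I)"
    using ry by (auto simp: K_def nonzerodivisor_def intro: ideal.span_base)
  moreover have "q \<in> K" if "x * q \<in> K" for q
    using that nonzerodivisorD[OF rx, of "y * q"] by (simp add: K_def mult.left_commute)
  ultimately have "K \<subseteq> I" using graded_nakayama[OF I K] x by blast
  then have ryI: "nonzerodivisor I y" by (auto simp: K_def nonzerodivisor_def)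
  have "nonzerodivisor (ideal.span (insert y I)) x"
    unfolding nonzerodivisor_def
  proof (intro allI impI)
    fix p assume "x * p \<in> ideal.span (insert y I)"
    then obtain q where q: "x * p - q * y \<in> I" using mem_span_insert[OF I(1)] by blast
    have "p * x - (x * p - q * y) \<in> ideal.span (insert x I)"
      by (rule ideal.span_diff[OF ideal.span_scale]) (use q in \<open>auto intro: ideal.span_base\<close>)
    then have "y * q \<in> ideal.span (insert x I)" by (simp add: mult.commute)
    then have "q \<in> ideal.span (insert x I)" by (rule nonzerodivisorD[OF ry])
    then obtain r where "q - r * x \<in> I" using mem_span_insert[OF I(1)] by blast
    then have "y * (q - r * x) \<in> I" by (rule ideal.subspace_scale[OF I(1)])
    from ideal.subspace_add[OF I(1) q this] have "x * (p - r * y) \<in> I"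
      by (simp add: algebra_simps)
    then have "p - r * y \<in> I" by (rule nonzerodivisorD[OF rx])
    then show "p \<in> ideal.span (insert y I)" using mem_span_insert[OF I(1)] by blast
  qed
  then show ?thesis using reg ryI by (simp add: span_insert_span insert_commute)
qed

lemma regular_on_move:
  "ideal.subspace I \<Longrightarrow> graded w I \<Longrightarrow> (\<And>x. x \<in> set (xs @ y # ys) \<Longrightarrow> pos_homogeneous w x) \<Longrightarrow>
    regular_on I (xs @ y # ys) \<Longrightarrow> regular_on I (y # xs @ ys)"
proof (induction xs arbitrary: I)
  case (Cons x xs)
  have "pos_homogeneous w x" using Cons.prems by simp
  then have "graded w (ideal.span (insert x I))"
    using Cons.prems(2) graded_span_insert by (auto simp: pos_homogeneous_def)
  then have "regular_on (ideal.span (insert x I)) (y # xs @ ys)"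
    using Cons.prems by (intro Cons.IH) auto
  then have "regular_on I (x # y # xs @ ys)" using Cons.prems by simp
  then show ?case
    using regular_on_swap[of I w x y "xs @ ys"] Cons.prems(1-3) by simp
qed simp

lemma regular_on_perm:
  "ideal.subspace I \<Longrightarrow> graded w I \<Longrightarrow> (\<And>x. x \<in> set xs \<Longrightarrow> pos_homogeneous w x) \<Longrightarrow>
    regular_on I xs \<Longrightarrow> mset xs = mset ys \<Longrightarrow> regular_on I ys"
proof (induction ys arbitrary: I xs)
  case (Cons y ys)
  then have "y \<in> set xs" by (metis list.set_intros(1) mset_eq_setD)
  then obtain as bs where xs: "xs = as @ y # bs" by (meson split_list)
  have reg: "regular_on I (y # as @ bs)"
    using Cons.prems regular_on_move[of I w as y bs] unfolding xs by blast
  have "pos_homogeneous w y" using Cons.prems(3) xs by simp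
  then have "graded w (ideal.span (insert y I))"
    using Cons.prems(2) graded_span_insert by (auto simp: pos_homogeneous_def)
  moreover have "mset (as @ bs) = mset ys" using Cons.prems(5) xs by simp
  ultimately have "regular_on (ideal.span (insert y I)) ys"
    using reg Cons.prems(3) xs by (intro Cons.IH[of _ "as @ bs"]) auto
  then show ?case using reg by simp
qed simp

section \<open>Homogeneous substitutions and their kernels\<close>

lemma homogeneous_subst:
  assumes "\<And>v. homogeneous w' (w v) (f v)" "homogeneous w d p"
  shows "homogeneous w' d (subst f p)"
  unfolding subst_def
proof (rule homogeneous_sum)
  fix m assume m: "m \<in> Poly_Mapping.keys p"
  have "homogeneous w' (wdeg w m) (mono_subst f m)"
    unfolding mono_subst_def wdeg_def by (intro homogeneous_prod homogeneous_power assms(1))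
  then show "homogeneous w' d (const (lookup p m) * mono_subst f m)"
    using homogeneous_mult[OF homogeneous_const] assms(2) m by (fastforce simp: homogeneous_def)
qed

lemma graded_kernel:
  assumes "\<And>v. homogeneous w' (w v) (f v)"
  shows "graded w {p. subst f p = 0}"
  unfolding graded_def
proof clarify
  fix p d assume p: "subst f p = 0"
  obtain N where N: "p = (\<Sum>k<N. hcomp w k p)" using sum_hcomp by blast
  have "hcomp w' d (subst f (hcomp w k p)) = (if d = k then subst f (hcomp w k p) else 0)" for k
    by (rule hcomp_homogeneous[OF homogeneous_subst[OF assms homogeneous_hcomp]])
  then have "hcomp w' d (subst f p) = (if d < N then subst f (hcomp w d p) else 0)"
    by (subst N) (simp add: subst_sum hcomp_sum)
  moreover have "hcomp w d p = 0" if "\<not> d < N"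
    by (subst N) (use that in \<open>auto simp: hcomp_sum hcomp_homogeneous[OF homogeneous_hcomp]\<close>)
  ultimately show "subst f (hcomp w d p) = 0" using p by (auto split: if_splits)
qed

lemma subspace_kernel: "ideal.subspace {p. subst f p = 0}"
  by (auto simp: ideal.subspace_def)

subsection \<open>The ideal of 2-minors\<close>

definition minor :: "nat \<Rightarrow> nat \<Rightarrow> 'k::field xypoly"
  where "minor i j = indet (Xvar i) * indet (Yvar j) - indet (Xvar j) * indet (Yvar i)"

definition minors_ideal :: "nat set \<Rightarrow> 'k::field xypoly set"
  where "minors_ideal C = ideal.span {minor i j | i j. i \<in> C \<and> j \<in> C}"

lemma minor_in_minors_ideal: "i \<in> C \<Longrightarrow> j \<in> C \<Longrightarrow> minor i j \<in> minors_ideal C"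
  unfolding minors_ideal_def by (auto intro: ideal.span_base)

lemma subspace_minors_ideal: "ideal.subspace (minors_ideal C)"
  by (simp add: minors_ideal_def)

lemma minors_ideal_mono: "C \<subseteq> D \<Longrightarrow> minors_ideal C \<subseteq> minors_ideal D"
  unfolding minors_ideal_def by (rule ideal.span_mono) auto

lemma minors_ideal_least:
  "ideal.subspace I \<Longrightarrow> (\<And>i j. i \<in> C \<Longrightarrow> j \<in> C \<Longrightarrow> minor i j \<in> I) \<Longrightarrow> minors_ideal C \<subseteq> I"
  unfolding minors_ideal_def by (rule ideal.span_minimal) auto

definition std_wt :: "xyvar \<Rightarrow> nat" where [simp]: "std_wt v = 1"

lemma homogeneous_minor: "homogeneous std_wt 2 (minor i j)"
proof -
  have "homogeneous std_wt (1 + 1) (minor i j)"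
    unfolding minor_def by (intro homogeneous_diff homogeneous_mult homogeneous_indet) auto
  then show ?thesis by (simp only: one_add_one)
qed

lemma graded_minors_ideal: "graded std_wt (minors_ideal C)"
  unfolding minors_ideal_def by (rule graded_span_homogeneous) (use homogeneous_minor in blast)

lemma minors_ideal_subset_span_X: "minors_ideal C \<subseteq> ideal.span (indet ` Xvar ` C)"
  by (rule minors_ideal_least) (auto simp: minor_def span_indets)

lemma kill_minors_ideal:
  fixes p :: "'k::field xypoly"
  assumes "W \<inter> (Xvar ` C \<union> Yvar ` C) = {}" "p \<in> minors_ideal C"
  shows "kill W p \<in> minors_ideal C"
proof -
  have "kill W (minor i j :: 'k xypoly) = minor i j" if "i \<in> C" "j \<in> C" for i j
    using that assms(1) by (auto simp: minor_def)
  then have "minors_ideal C \<subseteq> {p :: 'k xypoly. kill W p \<in> minors_ideal C}"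
    by (intro minors_ideal_least kill_subspace subspace_minors_ideal)
      (simp add: minor_in_minors_ideal)
  then show ?thesis using assms(2) by blast
qed

text \<open>The hypotheses test \<open>p\<close> where column \<open>c\<close> vanishes and where
  the whole row of \<open>x\<close> vanishes. Write \<open>p = p' + r x_c + s y_c\<close> with
  \<open>p'\<close> free of column \<open>c\<close>. The first test puts \<open>p'\<close> into the
  ideal; the second puts \<open>s\<close> into the ideal of the \<open>x_j\<close>, and
  \<open>x_j y_c\<close> is the minor of \<open>j\<close> and \<open>c\<close> plus
  \<open>x_c y_j\<close>.\<close>

lemma mem_span_insert_minors_ideal:
  fixes p :: "'k::field xypoly"
  assumes "c \<notin> C" and p1: "kill {Xvar c, Yvar c} p \<in> minors_ideal C"
    and p2: "kill (Xvar ` insert c C) p = 0"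
  shows "p \<in> ideal.span (insert (indet (Xvar c)) (minors_ideal (insert c C)))" (is "p \<in> ?S")
proof -
  let ?k = "kill (Xvar ` insert c C) :: 'k xypoly \<Rightarrow> _" and ?X = "indet (Xvar c) :: 'k xypoly"
    and ?Y = "indet (Yvar c) :: 'k xypoly"
  have I: "minors_ideal C \<subseteq> ?S"
    using minors_ideal_mono[of C "insert c C"] ideal.span_superset by blast
  have "p - kill {Xvar c, Yvar c} p \<in> ideal.span (insert ?X (insert ?Y {}))"
    using diff_kill_in_span[of p "{Xvar c, Yvar c}"] by simp
  then obtain r s where rs: "p - kill {Xvar c, Yvar c} p - r * ?X - s * ?Y = 0"
    unfolding ideal.span_breakdown_eq by auto
  have "?k (kill {Xvar c, Yvar c} p) = 0"
  proof -
    have "kill {Xvar c, Yvar c} p \<in> ideal.span (indet ` Xvar ` insert c C)"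
      using p1 minors_ideal_mono[of C "insert c C"] minors_ideal_subset_span_X[of "insert c C"] by blast
    then show ?thesis unfolding span_indets .
  qed
  then have "?k s * ?Y = 0"
    using arg_cong[OF rs, of ?k] p2 by (simp add: image_iff)
  then have "?k s = 0" by (auto split: if_splits)
  then have "s \<in> ideal.span (indet ` Xvar ` insert c C)" unfolding span_indets .
  moreover have "indet ` Xvar ` insert c C \<subseteq> {s. s * ?Y \<in> ?S}"
  proof clarify
    fix j assume "j \<in> insert c C"
    then have "minor j c \<in> ?S"
      by (intro ideal.span_base) (auto intro: minor_in_minors_ideal)
    then have "minor j c + indet (Yvar j) * ?X \<in> ?S"
      by (intro ideal.span_add ideal.span_scale[OF ideal.span_base]) auto
    then show "indet (Xvar j) * ?Y \<in> ?S" by (simp add: minor_def mult.commute)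
  qed
  moreover have "ideal.subspace {s. s * ?Y \<in> ?S}"
    by (auto simp: ideal.subspace_def distrib_right mult.assoc ideal.span_zero ideal.span_add ideal.span_scale)
  ultimately have "s * ?Y \<in> ?S" using ideal.span_minimal by blast
  moreover have "r * ?X \<in> ?S" by (intro ideal.span_scale ideal.span_base) simp
  ultimately have "kill {Xvar c, Yvar c} p + r * ?X + s * ?Y \<in> ?S"
    using p1 I by (intro ideal.span_add) auto
  moreover have "p = kill {Xvar c, Yvar c} p + r * ?X + s * ?Y"
    using rs by (simp add: algebra_simps)
  ultimately show ?thesis by simp
qed

text \<open>The parametrisation of the rank one matrices; the indices are shifted so that
  \<open>Xvar 0\<close> and \<open>Yvar 0\<close> are available as the two row variables.\<close>

fun segre_var :: "nat set \<Rightarrow> xyvar \<Rightarrow> 'k::field xypoly" where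
  "segre_var C (Xvar i) = (if i \<in> C then indet (Xvar 0) else 1) * indet (Xvar (Suc i))"
| "segre_var C (Yvar i) = (if i \<in> C then indet (Yvar 0) * indet (Xvar (Suc i)) else indet (Yvar (Suc i)))"

definition segre :: "nat set \<Rightarrow> 'k xypoly \<Rightarrow> 'k::field xypoly"
  where "segre C = subst (segre_var C)"

lemma segre_minor: "i \<in> C \<Longrightarrow> j \<in> C \<Longrightarrow> segre C (minor i j) = 0"
  by (simp add: segre_def minor_def mult_ac)

lemma segre_indet_neq_0: "segre C (indet v) \<noteq> (0 :: 'k::field xypoly)"
  by (cases v) (simp_all add: segre_def)

text \<open>The row parameters \<open>Xvar 0\<close> and \<open>Yvar 0\<close> get degree zero, so
  that the images of all variables, inside and outside \<open>C\<close>, have degree one and the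
  kernel of the Segre map is graded for \<open>std_wt\<close>.\<close>

fun row_wt :: "xyvar \<Rightarrow> nat" where
  "row_wt (Xvar i) = (if i = 0 then 0 else 1)"
| "row_wt (Yvar i) = (if i = 0 then 0 else 1)"

lemma homogeneous_segre_var: "homogeneous row_wt (std_wt v) (segre_var C v :: 'k::field xypoly)"
proof -
  have X: "homogeneous row_wt 1 (indet (Xvar (Suc i)) :: 'k xypoly)"
    and Y: "homogeneous row_wt 1 (indet (Yvar (Suc i)) :: 'k xypoly)" for i
    by (rule homogeneous_indet, simp)+
  have X0: "homogeneous row_wt 0 (indet (Xvar 0) :: 'k xypoly)"
    and Y0: "homogeneous row_wt 0 (indet (Yvar 0) :: 'k xypoly)"
    by (rule homogeneous_indet, simp)+
  show ?thesis
    using homogeneous_mult[OF X0 X] homogeneous_mult[OF Y0 X] X Y by (cases v) auto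
qed

text \<open>The kernel is prime and does not contain \<open>x_c\<close>, so by Nakayama's lemma it
  suffices to find it inside the minors plus \<open>x_c\<close>. For this
  \<open>mem_span_insert_minors_ideal\<close> asks for two specialisations of a kernel element:
  erasing column \<open>c\<close>, which is the induction hypothesis, and erasing the row of
  \<open>x\<close>.\<close>

lemma segre_kernel_subset:
  "finite C \<Longrightarrow> segre C p = 0 \<Longrightarrow> p \<in> minors_ideal C" for p :: "'k::field xypoly"
proof (induction C arbitrary: p rule: finite_induct)
  case empty
  \<comment> \<open>With no column in \<open>C\<close> the Segre map only shifts the indices, and
    \<open>f\<close> shifts them back.\<close>
  define f :: "xyvar \<Rightarrow> 'k xypoly"
    where "f = case_xyvar (\<lambda>i. indet (Xvar (i - 1))) (\<lambda>i. indet (Yvar (i - 1)))"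
  have "subst f (segre_var {} v) = indet v" for v by (cases v) (simp_all add: f_def)
  then have "subst f (segre {} p) = p" by (simp add: segre_def subst_subst)
  then show ?case using empty subspace_minors_ideal ideal.subspace_0 by fastforce
next
  case (insert c C)
  let ?I = "minors_ideal (insert c C) :: 'k xypoly set" and ?K = "{p :: 'k xypoly. segre (insert c C) p = 0}"
    and ?X = "indet (Xvar c) :: 'k xypoly"
  have "?K \<subseteq> ideal.span (insert ?X ?I)"
  proof clarify
    fix p :: "'k xypoly" assume p: "segre (insert c C) p = 0"
    have "segre C (kill {Xvar c, Yvar c} p) = kill {Xvar (Suc c), Yvar (Suc c)} (segre (insert c C) p)"
      unfolding segre_def kill_def subst_subst
    proof (rule subst_cong[of p UNIV])
      fix v show "subst (segre_var C) (if v \<in> {Xvar c, Yvar c} then 0 else indet v) =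
          subst (\<lambda>v. if v \<in> {Xvar (Suc c), Yvar (Suc c)} then 0 else indet v) (segre_var (insert c C) v :: 'k xypoly)"
        by (cases v) auto
    qed simp
    then have p1: "kill {Xvar c, Yvar c} p \<in> minors_ideal C" using insert.IH p by simp
    \<comment> \<open>The row parameters are specialised to 0 and 1 and the column parameters to the
      variables \<open>y_i\<close>; the Segre map then becomes the erasure of the row of
      \<open>x\<close> on the columns considered, while the other columns are shifted back.\<close>
    define f :: "xyvar \<Rightarrow> 'k xypoly"
      where "f = case_xyvar
        (\<lambda>i. if i = 0 then 0 else if i - 1 \<in> insert c C then indet (Yvar (i - 1)) else indet (Xvar (i - 1)))
        (\<lambda>i. if i = 0 then 1 else indet (Yvar (i - 1)))"
    have "kill (Xvar ` insert c C) p = subst f (segre (insert c C) p)"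
      unfolding segre_def kill_def subst_subst
    proof (rule subst_cong[of p UNIV])
      fix v show "(if v \<in> Xvar ` insert c C then 0 else indet v) = subst f (segre_var (insert c C) v)"
        by (cases v) (auto simp: f_def)
    qed simp
    then show "p \<in> ideal.span (insert ?X ?I)"
      using mem_span_insert_minors_ideal[OF insert.hyps(2) p1] p by simp
  qed
  moreover have "q \<in> ?K" if "?X * q \<in> ?K" for q
    using that segre_indet_neq_0[of "insert c C" "Xvar c"] by (simp add: segre_def)
  moreover have "ideal.subspace ?K" "graded std_wt ?K"
    unfolding segre_def
    by (rule subspace_kernel, rule graded_kernel, rule homogeneous_segre_var)
  moreover have "?I \<subseteq> ?K"
    using \<open>ideal.subspace ?K\<close> by (rule minors_ideal_least) (simp add: segre_minor)
  ultimately have "?K \<subseteq> ?I"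
    using graded_nakayama[OF subspace_minors_ideal graded_minors_ideal, of ?K "insert c C" 1 ?X]
    by (simp add: homogeneous_indet)
  then show ?case using insert.prems by blast
qed

lemma mem_minors_ideal: "finite C \<Longrightarrow> p \<in> minors_ideal C \<longleftrightarrow> segre C p = 0"
  using segre_kernel_subset[of C p] minors_ideal_least[OF subspace_kernel[of "segre_var C"], of C]
    segre_minor unfolding segre_def by blast

lemma nonzerodivisor_minors_ideal:
  "finite C \<Longrightarrow> segre C x \<noteq> 0 \<Longrightarrow> nonzerodivisor (minors_ideal C) x"
  unfolding nonzerodivisor_def by (simp add: mem_minors_ideal) (simp add: segre_def)

text \<open>Preceded by \<open>x_c\<close> for the first index \<open>c\<close>, these are the sums
  along the antidiagonals of the \<open>2 \<times> m\<close> matrix with rows \<open>x\<close> and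
  \<open>y\<close>: \<open>m + 1\<close> forms, as many as the dimension of the ring of matrices of
  rank at most one.\<close>

fun hankel :: "nat list \<Rightarrow> 'k::field xypoly list" where
  "hankel [] = []"
| "hankel [c] = [indet (Yvar c)]"
| "hankel (c # d # cs) = (indet (Yvar c) + indet (Xvar d)) # hankel (d # cs)"

lemma length_hankel [simp]: "length (hankel cs) = length cs"
  by (induction cs rule: hankel.induct) auto

lemma hankel_neq_Nil [simp]: "hankel cs = [] \<longleftrightarrow> cs = []"
  by (metis length_0_conv length_hankel)

lemma hankel_polys_over: "x \<in> set (hankel cs) \<Longrightarrow> x \<in> polys_over (Xvar ` set cs \<union> Yvar ` set cs)"
proof -
  have "set cs \<subseteq> C \<Longrightarrow> x \<in> set (hankel cs) \<Longrightarrow> x \<in> polys_over (Xvar ` C \<union> Yvar ` C)" for C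
    by (induction cs rule: hankel.induct) auto
  then show "x \<in> set (hankel cs) \<Longrightarrow> x \<in> polys_over (Xvar ` set cs \<union> Yvar ` set cs)" by blast
qed

lemma pos_homogeneous_indet: "pos_homogeneous std_wt (indet v)"
  unfolding pos_homogeneous_def by (intro exI[of _ 1]) (simp add: homogeneous_indet)

lemma pos_homogeneous_indet_add: "pos_homogeneous std_wt (indet u + indet v)"
  unfolding pos_homogeneous_def by (intro exI[of _ 1]) (simp add: homogeneous_indet homogeneous_add)

lemma pos_homogeneous_minor: "pos_homogeneous std_wt (minor i j)"
  unfolding pos_homogeneous_def using homogeneous_minor by (intro exI[of _ 2]) simp

lemma pos_homogeneous_hankel: "x \<in> set (hankel cs) \<Longrightarrow> pos_homogeneous std_wt x"
  by (induction cs rule: hankel.induct)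
    (auto intro: pos_homogeneous_indet pos_homogeneous_indet_add)

lemmas pos_homogeneous_intros =
  pos_homogeneous_indet pos_homogeneous_indet_add pos_homogeneous_minor pos_homogeneous_hankel

lemma hankel_mod_X:
  "set cs \<subseteq> C \<Longrightarrow> list_all2 (\<lambda>x y. x - y \<in> ideal.span (indet ` Xvar ` C))
    (map indet (map Yvar cs)) (hankel cs)"
  by (induction cs rule: hankel.induct) (auto simp: span_indets)

lemma hankel_eq_snoc: "cs \<noteq> [] \<Longrightarrow> hankel cs = butlast (hankel cs) @ [indet (Yvar (last cs))]"
  by (induction cs rule: hankel.induct) auto

lemma hankel_last: "indet (Yvar l) \<in> set (hankel (us @ [l]))"
  by (induction us rule: hankel.induct) auto

lemma hankel_last_two: "indet (Yvar k) + indet (Xvar l) \<in> set (hankel (us @ [k, l]))"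
  by (induction us rule: hankel.induct) auto

lemma graded_span_indets: "graded std_wt (ideal.span (indet ` W))"
  by (rule graded_span_homogeneous) (auto intro!: exI[of _ 1] homogeneous_indet)

lemma span_Un_minors_indets:
  "ideal.span (minors_ideal C \<union> indet ` {Xvar c, Yvar c} \<union> ideal.span (indet ` Xvar ` insert c C)) =
    ideal.span (indet ` insert (Yvar c) (Xvar ` insert c C))"
proof -
  have "minors_ideal C \<subseteq> ideal.span (indet ` Xvar ` insert c C)"
    using minors_ideal_subset_span_X[of C] ideal.span_mono[of "indet ` Xvar ` C" "indet ` Xvar ` insert c C"]
    by auto
  moreover have "ideal.span (indet ` Xvar ` insert c C) \<subseteq> ideal.span (indet ` insert (Yvar c) (Xvar ` insert c C))"
    by (rule ideal.span_mono) auto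
  ultimately have "minors_ideal C \<union> indet ` {Xvar c, Yvar c} \<union> ideal.span (indet ` Xvar ` insert c C)
      \<subseteq> ideal.span (indet ` insert (Yvar c) (Xvar ` insert c C))"
    by (auto intro: ideal.span_base)
  then have "ideal.span (minors_ideal C \<union> indet ` {Xvar c, Yvar c} \<union> ideal.span (indet ` Xvar ` insert c C))
      \<subseteq> ideal.span (indet ` insert (Yvar c) (Xvar ` insert c C))"
    by (rule ideal.span_minimal) simp
  moreover have "ideal.span (indet ` insert (Yvar c) (Xvar ` insert c C)) \<subseteq>
      ideal.span (minors_ideal C \<union> indet ` {Xvar c, Yvar c} \<union> ideal.span (indet ` Xvar ` insert c C))"
    by (rule ideal.span_mono) (auto intro: ideal.span_base)
  ultimately show ?thesis by blast
qed

text \<open>On matrices of rank at most one, \<open>x_c = 0\<close> forces \<open>y_c = 0\<close>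
  or, because \<open>x_j y_c\<close> is then a minor, the vanishing of all \<open>x_j\<close>. That
  the intersection of these two loci gives no larger ideal is
  \<open>mem_span_insert_minors_ideal\<close>.\<close>

lemma span_insert_minors_ideal:
  assumes "c \<notin> C"
  shows "ideal.span (insert (indet (Xvar c)) (minors_ideal (insert c C))) =
    ideal.span (minors_ideal C \<union> indet ` {Xvar c, Yvar c}) \<inter> ideal.span (indet ` Xvar ` insert c C)"
    (is "?L = ?P1 \<inter> ?P2")
proof
  have P1: "?P1 = {p. kill {Xvar c, Yvar c} p \<in> minors_ideal C}"
    by (rule span_Un_indets[OF subspace_minors_ideal], rule kill_minors_ideal) (use assms in auto)
  show "?P1 \<inter> ?P2 \<subseteq> ?L"
  proof clarify
    fix p assume "p \<in> ?P1" "p \<in> ?P2"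
    then show "p \<in> ?L"
      using mem_span_insert_minors_ideal[OF assms, of p] unfolding P1 span_indets by blast
  qed
  have "minor i j \<in> ?P1" if "i \<in> insert c C" "j \<in> insert c C" for i j
  proof (cases "i = c \<or> j = c")
    case True
    have "kill {Xvar c, Yvar c} (minor i j :: 'a xypoly) = 0"
      using True by (auto simp: minor_def)
    then show ?thesis unfolding P1 by (simp add: ideal.subspace_0 subspace_minors_ideal)
  next
    case False
    then show ?thesis using that by (auto intro!: ideal.span_base minor_in_minors_ideal)
  qed
  then have "minors_ideal (insert c C) \<subseteq> ?P1" by (intro minors_ideal_least) auto
  moreover have "minors_ideal (insert c C) \<subseteq> ?P2" by (rule minors_ideal_subset_span_X)
  ultimately show "?L \<subseteq> ?P1 \<inter> ?P2"
    by (intro ideal.span_minimal ideal.subspace_inter) (auto intro: ideal.span_base)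
qed

text \<open>Modulo \<open>x_c\<close> the ideal is an intersection. On \<open>?P1\<close> column
  \<open>c\<close> is zero and \<open>y_c + x_d\<close> turns into \<open>x_d\<close>, so the
  shorter list applies; on \<open>?P2\<close> the \<open>x\<close>-variables are zero and the Hankel
  forms turn into variables \<open>y\<close>. The sum of the two is generated by variables.\<close>

lemma regular_on_minors_ideal:
  "distinct (c # cs) \<Longrightarrow>
    regular_on (minors_ideal (set (c # cs)) :: 'k::field xypoly set) (indet (Xvar c) # hankel (c # cs))"
proof (induction cs arbitrary: c)
  case Nil
  have "minors_ideal {c} \<subseteq> ({0} :: 'k xypoly set)"
    by (rule minors_ideal_least) (auto simp: minor_def)
  then have "minors_ideal {c} = (ideal.span (indet ` {}) :: 'k xypoly set)"
    using ideal.subspace_0[OF subspace_minors_ideal] by auto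
  then show ?case using regular_on_indets[of "[Xvar c, Yvar c]" "{}", where 'k = 'k] by simp
next
  case (Cons d cs)
  let ?C = "set (d # cs)" and ?X = "indet (Xvar c) :: 'k xypoly" and ?Y = "indet (Yvar c) :: 'k xypoly"
    and ?H = "hankel (d # cs) :: 'k xypoly list" and ?Xd = "indet (Xvar d) :: 'k xypoly"
  let ?P1 = "ideal.span (minors_ideal ?C \<union> indet ` {Xvar c, Yvar c}) :: 'k xypoly set"
    and ?P2 = "ideal.span (indet ` Xvar ` insert c ?C) :: 'k xypoly set"
  have c: "c \<notin> ?C" and d: "distinct (d # cs)" using Cons.prems by auto
  \<comment> \<open>\<open>x_d\<close> goes to the end because it will become
    \<open>y_c + x_d\<close>. This form is zero modulo \<open>?P1 + ?P2\<close>, so it has to be the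
    entry that \<open>regular_on_Int\<close> does not test there.\<close>
  have "regular_on (minors_ideal ?C) (?H @ [?Xd])"
    by (rule regular_on_perm[OF subspace_minors_ideal graded_minors_ideal _ Cons.IH[OF d]])
      (auto intro: pos_homogeneous_intros)
  then have "regular_on ?P1 (?H @ [?Xd])"
  proof (rule regular_on_Un_indets[OF subspace_minors_ideal, rotated 2])
    fix p :: "'k xypoly" assume "p \<in> minors_ideal ?C"
    then show "kill {Xvar c, Yvar c} p \<in> minors_ideal ?C"
      by (rule kill_minors_ideal[rotated]) (use c in auto)
  next
    fix x assume "x \<in> set (?H @ [?Xd])"
    then have "x \<in> polys_over (Xvar ` ?C \<union> Yvar ` ?C)" using hankel_polys_over[of x "d # cs"] by auto
    then show "kill {Xvar c, Yvar c} x = x" by (rule kill_id) (use c in auto)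
  qed
  moreover have "list_all2 (\<lambda>x y. x - y \<in> ?P1) (?H @ [?Xd]) (?H @ [?Y + ?Xd])"
    by (rule list_all2_appendI)
      (auto simp: list_all2_same intro: ideal.span_zero ideal.span_base
        ideal.span_neg[OF ideal.span_base])
  ultimately have 1: "regular_on ?P1 (?H @ [?Y + ?Xd])"
    by (rule regular_on_cong[OF ideal.subspace_span, rotated])
  have "regular_on ?P2 (map indet (map Yvar (d # cs) @ [Yvar c]))"
    by (rule regular_on_indets) (use Cons.prems in \<open>auto simp: distinct_map inj_on_def\<close>)
  moreover have "list_all2 (\<lambda>x y. x - y \<in> ?P2)
      (map indet (map Yvar (d # cs) @ [Yvar c])) (?H @ [?Y + ?Xd])"
    unfolding map_append
    by (rule list_all2_appendI)
      (use hankel_mod_X[of "d # cs" "insert c ?C", where 'a = 'k] in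
        \<open>auto simp: comp_def intro: ideal.span_neg[OF ideal.span_base]\<close>)
  ultimately have 2: "regular_on ?P2 (?H @ [?Y + ?Xd])"
    by (rule regular_on_cong[OF ideal.subspace_span, rotated])
  let ?P12 = "ideal.span (indet ` insert (Yvar c) (Xvar ` insert c ?C)) :: 'k xypoly set"
  have P12: "ideal.span (?P1 \<union> ?P2) = ?P12"
    unfolding span_Un_minors_indets[symmetric] by (simp only: span_Un_span Un_commute)
  have "regular_on ?P12 (map indet (map Yvar (d # cs)))"
    by (rule regular_on_indets) (use Cons.prems in \<open>auto simp: distinct_map inj_on_def\<close>)
  moreover have "?P2 \<subseteq> ?P12" by (rule ideal.span_mono) auto
  then have "list_all2 (\<lambda>x y. x - y \<in> ?P12) (map indet (map Yvar (d # cs))) ?H"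
    by (intro list_all2_mono[OF hankel_mod_X[of "d # cs" "insert c ?C"]]) auto
  ultimately have 3: "regular_on (ideal.span (?P1 \<union> ?P2)) (butlast (?H @ [?Y + ?Xd]))"
    unfolding P12 butlast_snoc by (rule regular_on_cong[OF ideal.subspace_span, rotated])
  let ?L = "ideal.span (insert ?X (minors_ideal (insert c ?C)))"
  have "regular_on ?L (?H @ [?Y + ?Xd])"
    unfolding span_insert_minors_ideal[OF c] using regular_on_Int[OF _ _ 1 2 3] by simp
  moreover have "graded std_wt ?L"
    by (rule graded_span_insert[OF graded_minors_ideal homogeneous_indet[OF refl]])
  moreover have "pos_homogeneous std_wt x" if "x \<in> set (?H @ [?Y + ?Xd])" for x
    using that pos_homogeneous_hankel[of x "d # cs"] pos_homogeneous_indet_add by auto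
  moreover have "mset (?H @ [?Y + ?Xd]) = mset (hankel (c # d # cs))" by simp
  ultimately have "regular_on ?L (hankel (c # d # cs))"
    using regular_on_perm[OF ideal.subspace_span] by blast
  moreover have "nonzerodivisor (minors_ideal (insert c ?C)) ?X"
    by (rule nonzerodivisor_minors_ideal) (simp_all add: segre_indet_neq_0)
  ultimately show ?case by simp
qed

subsection \<open>Regular sequences for star-like graphs\<close>

text \<open>\<open>F\<close> is room for the minors of edges that avoid the centre \<open>v\<close>;
  in the three types of graphs it is empty or a single minor.\<close>

definition star_ideal :: "nat \<Rightarrow> nat set \<Rightarrow> 'k::field xypoly set \<Rightarrow> 'k xypoly set"
  where "star_ideal v L F = ideal.span ({minor v l | l. l \<in> L} \<union> F)"

lemma subspace_star_ideal: "ideal.subspace (star_ideal v L F)"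
  by (simp add: star_ideal_def)

lemma minor_commute: "minor j i = - minor i j"
  by (simp add: minor_def)

lemma span_Un_vertex:
  assumes "\<And>f. f \<in> F \<Longrightarrow> kill {Xvar v, Yvar v} f = f"
  shows "ideal.span (F \<union> indet ` {Xvar v, Yvar v}) = {p. kill {Xvar v, Yvar v} p \<in> ideal.span F}"
proof -
  have "kill {Xvar v, Yvar v} p \<in> ideal.span F" if "p \<in> ideal.span F" for p
    unfolding kill_def
  proof (rule subst_span[OF ideal.subspace_span _ that])
    fix f assume "f \<in> F"
    then show "subst (\<lambda>u. if u \<in> {Xvar v, Yvar v} then 0 else indet u) f \<in> ideal.span F"
      using assms[of f] unfolding kill_def by (simp only: ideal.span_base)
  qed
  from span_Un_indets[OF ideal.subspace_span this] show ?thesis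
    using span_Un_span[of "indet ` {Xvar v, Yvar v}" F] by (simp add: Un_commute)
qed

lemma minor_self [simp]: "minor i i = 0"
  by (simp add: minor_def)

text \<open>Modulo the minors at \<open>v\<close>, every element of the ideal of all minors is congruent to its
  specialisation at \<open>x\<^sub>v = y\<^sub>v = 0\<close>.\<close>

lemma star_ideal_eq:
  assumes v: "v \<notin> L" and F: "F \<subseteq> minors_ideal L" "\<And>f. f \<in> F \<Longrightarrow> kill {Xvar v, Yvar v} f = f"
  shows "star_ideal v L F = minors_ideal (insert v L) \<inter> ideal.span (F \<union> indet ` {Xvar v, Yvar v})"
    (is "?J = ?P \<inter> ?Q")
proof
  let ?k = "kill {Xvar v, Yvar v} :: 'a xypoly \<Rightarrow> _"
  have "?k (minor v l) = 0" for l by (simp add: minor_def)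
  then have "minor v l \<in> ?P" "minor v l \<in> ?Q" if "l \<in> L" for l
    using that by (auto intro: minor_in_minors_ideal)
      (simp add: span_Un_vertex[OF F(2), simplified] ideal.span_zero)
  moreover have "F \<subseteq> ?P" using F(1) minors_ideal_mono[of L "insert v L"] by blast
  moreover have "F \<subseteq> ?Q" by (auto intro: ideal.span_base)
  ultimately show "?J \<subseteq> ?P \<inter> ?Q"
    unfolding star_ideal_def
    by (intro ideal.span_minimal ideal.subspace_inter subspace_minors_ideal) auto
  have vJ: "minor v l \<in> ?J" if "l \<in> L" for l
    using that by (auto simp: star_ideal_def intro: ideal.span_base)
  have gen: "c * minor i j - ?k (c * minor i j) \<in> ?J" if ij: "i \<in> insert v L" "j \<in> insert v L" for c i j
  proof (cases "i = v \<or> j = v")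
    case True
    then have "?k (minor i j) = 0" by (auto simp: minor_def)
    moreover have "minor i j \<in> ?J"
      using True ij vJ[of i] vJ[of j] ideal.subspace_0[OF subspace_star_ideal]
        ideal.subspace_neg[OF subspace_star_ideal vJ[of i]]
      by (cases "i = j") (auto simp: minor_commute[of i v])
    ultimately show ?thesis by (simp add: ideal.subspace_scale[OF subspace_star_ideal])
  next
    case False
    then have ij: "i \<in> L" "j \<in> L" using ij by auto
    \<comment> \<open>Expansions of the vanishing determinant of the columns \<open>v\<close>,
      \<open>i\<close>, \<open>j\<close> with one row repeated: \<open>x_v\<close> and
      \<open>y_v\<close> multiply every minor into the ideal of the star.\<close>
    have "indet (Xvar v) * minor i j = indet (Xvar i) * minor v j - indet (Xvar j) * (minor v i :: 'a xypoly)"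
      "indet (Yvar v) * minor i j = indet (Yvar i) * minor v j - indet (Yvar j) * (minor v i :: 'a xypoly)"
      by (simp_all add: minor_def algebra_simps)
    then have "indet ` {Xvar v, Yvar v} \<subseteq> {s. s * minor i j \<in> ?J}"
      using ij by (auto intro!: ideal.subspace_diff ideal.subspace_scale subspace_star_ideal vJ)
    moreover have "ideal.subspace {s. s * minor i j \<in> ?J}"
      using subspace_star_ideal[of v L F] unfolding ideal.subspace_def
      by (auto simp: distrib_right mult.assoc)
    ultimately have "ideal.span (indet ` {Xvar v, Yvar v}) \<subseteq> {s. s * minor i j \<in> ?J}"
      by (rule ideal.span_minimal)
    then have "(c - ?k c) * minor i j \<in> ?J" using diff_kill_in_span by blast
    moreover have "?k (minor i j) = minor i j" using False by (simp add: minor_def)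
    ultimately show ?thesis by (simp add: left_diff_distrib)
  qed
  have diff: "p - ?k p \<in> ?J" if "p \<in> ?P" for p
    using that unfolding minors_ideal_def
  proof (induction rule: ideal.span_induct_alt)
    case base then show ?case using ideal.subspace_0[OF subspace_star_ideal] by simp
  next
    case (step c x y)
    then have "c * x - ?k (c * x) \<in> ?J" using gen by blast
    from ideal.subspace_add[OF subspace_star_ideal this step(2)] show ?case
      by (simp add: algebra_simps)
  qed
  show "?P \<inter> ?Q \<subseteq> ?J"
  proof
    fix p assume p: "p \<in> ?P \<inter> ?Q"
    then have "?k p \<in> ideal.span F" using span_Un_vertex[OF F(2)] by blast
    then have "?k p \<in> ?J" using ideal.span_mono[of F] unfolding star_ideal_def by blast
    from ideal.subspace_add[OF subspace_star_ideal diff this, of p] p show "p \<in> ?J" by simp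
  qed
qed

text \<open>For \<open>n\<close> vertices in \<open>v # ls\<close> these are \<open>n + 1\<close>
  forms. On the ideal of all minors \<open>x_v\<close> itself would complete the Hankel forms, but
  it is zero on the component \<open>x_v = y_v = 0\<close>. The added variable of the last leaf
  helps there and is nilpotent on the other component modulo the Hankel forms.\<close>

definition star_seq :: "nat \<Rightarrow> nat list \<Rightarrow> 'k::field xypoly list"
  where "star_seq v ls = hankel (v # ls) @ [indet (Xvar v) + indet (Xvar (last ls))]"

lemma pos_homogeneous_star_seq: "x \<in> set (star_seq v ls) \<Longrightarrow> pos_homogeneous std_wt x"
  unfolding star_seq_def using pos_homogeneous_hankel pos_homogeneous_indet_add by auto

lemma regular_on_minors_star_seq:
  assumes "distinct (v # us @ [k, l])"
  shows "regular_on (minors_ideal (set (v # us @ [k, l])) :: 'k::field xypoly set) (star_seq v (us @ [k, l]))"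
proof -
  let ?ls = "us @ [k, l]" and ?X = "indet (Xvar v) :: 'k xypoly"
  let ?P = "minors_ideal (set (v # ?ls)) :: 'k xypoly set"
  let ?S = "ideal.span (set (hankel (v # ?ls)) \<union> ?P)"
  have "pos_homogeneous std_wt x" if "x \<in> set (?X # hankel (v # ?ls))" for x
    using that pos_homogeneous_hankel[of x "v # ?ls"] pos_homogeneous_indet by auto
  moreover have "mset (?X # hankel (v # ?ls)) = mset (hankel (v # ?ls) @ [?X])" by simp
  ultimately have "regular_on ?P (hankel (v # ?ls) @ [?X])"
    using regular_on_perm[OF subspace_minors_ideal graded_minors_ideal _
        regular_on_minors_ideal[OF assms]] by blast
  then have h: "regular_on ?P (hankel (v # ?ls))" and X: "nonzerodivisor ?S ?X"
    by (simp_all add: regular_on_append subspace_minors_ideal)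
  \<comment> \<open>\<open>x_l ^ 2 = x_l (y_k + x_l) + minor k l - x_k y_l\<close>, so the last two
    Hankel forms and one minor make \<open>x_l\<close> nilpotent.\<close>
  have "indet (Yvar l) \<in> ?S" "indet (Yvar k) + indet (Xvar l) \<in> ?S" "minor k l \<in> ?S"
    using hankel_last[of l "v # us @ [k]"] hankel_last_two[of k l "v # us"]
    by (auto intro!: ideal.span_base minor_in_minors_ideal)
  from ideal.span_diff[OF ideal.span_add[OF ideal.span_scale[OF this(2)] this(3)]
      ideal.span_scale[OF this(1)]]
  have "indet (Xvar l) * (indet (Yvar k) + indet (Xvar l)) + minor k l
      - indet (Xvar k) * indet (Yvar l) \<in> ?S" .
  then have "indet (Xvar l) ^ 2 \<in> ?S" by (simp add: minor_def power2_eq_square algebra_simps)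
  from nonzerodivisor_add_nilpotent[OF ideal.subspace_span X this] h show ?thesis
    by (simp add: star_seq_def regular_on_append subspace_minors_ideal)
qed

text \<open>The assumption \<open>reg\<close> shows the sequence as it appears where column
  \<open>v\<close> is zero: \<open>y_v + x_a\<close> becomes \<open>x_a\<close> for the first leaf
  \<open>a\<close>, and \<open>x_v + x_l\<close> becomes \<open>x_l\<close>. On the sum of the two
  components, which is the ideal of minors of the leaves plus column \<open>v\<close>, the sequence
  without its last form is the one of \<open>regular_on_minors_ideal\<close> for the leaves.\<close>

lemma regular_on_star_ideal_aux:
  fixes F :: "'k::field xypoly set"
  assumes dist: "distinct (v # us @ [k, l])"
    and F: "F \<subseteq> minors_ideal (set (us @ [k, l]))" "\<And>f. f \<in> F \<Longrightarrow> kill {Xvar v, Yvar v} f = f"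
    and reg: "regular_on (ideal.span (F \<union> indet ` {Xvar v, Yvar v}))
      (indet (Xvar (hd (us @ [k, l]))) # hankel (us @ [k, l]) @ [indet (Xvar l)])"
  shows "regular_on (star_ideal v (set (us @ [k, l])) F) (star_seq v (us @ [k, l]))"
proof -
  obtain a ms where ls: "us @ [k, l] = a # ms" by (cases us) auto
  let ?ls = "us @ [k, l]"
  let ?Q = "ideal.span (F \<union> indet ` {Xvar v, Yvar v})" and ?P = "minors_ideal (set (v # ?ls)) :: 'k xypoly set"
  let ?A = "ideal.span (minors_ideal (set ?ls) \<union> indet ` {Xvar v, Yvar v}) :: 'k xypoly set"
  have last: "last (a # ms) = l" unfolding ls[symmetric] by simp
  have "list_all2 (\<lambda>x y. x - y \<in> ?Q)
      (indet (Xvar a) # hankel ?ls @ [indet (Xvar l)]) (star_seq v ?ls)"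
    unfolding star_seq_def ls last hankel.simps append_Cons
    by (intro list_all2_Cons[THEN iffD2] conjI list_all2_appendI)
      (auto simp: list_all2_same ideal.span_zero intro: ideal.span_neg[OF ideal.span_base])
  from regular_on_cong[OF ideal.subspace_span this] reg have 1: "regular_on ?Q (star_seq v ?ls)"
    by (simp add: ls)
  have 2: "regular_on ?P (star_seq v ?ls)" by (rule regular_on_minors_star_seq[OF dist])
  have "regular_on (minors_ideal (set ?ls) :: 'k xypoly set) (indet (Xvar a) # hankel ?ls)"
    using regular_on_minors_ideal[of a ms] dist unfolding ls by simp
  then have "regular_on ?A (indet (Xvar a) # hankel ?ls)"
  proof (rule regular_on_Un_indets[OF subspace_minors_ideal, rotated 2])
    fix p :: "'k xypoly" assume "p \<in> minors_ideal (set ?ls)"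
    then show "kill {Xvar v, Yvar v} p \<in> minors_ideal (set ?ls)"
      by (rule kill_minors_ideal[rotated]) (use dist in auto)
  next
    fix x assume "x \<in> set (indet (Xvar a) # hankel ?ls :: 'k xypoly list)"
    then have "x \<in> polys_over (Xvar ` set ?ls \<union> Yvar ` set ?ls)"
      using hankel_polys_over[of x ?ls] unfolding ls by auto
    then show "kill {Xvar v, Yvar v} x = x" by (rule kill_id) (use dist in auto)
  qed
  moreover have "list_all2 (\<lambda>x y. x - y \<in> ?A) (indet (Xvar a) # hankel ?ls) (hankel (v # ?ls))"
    unfolding ls hankel.simps
    by (auto simp: list_all2_same ideal.span_zero intro: ideal.span_neg[OF ideal.span_base])
  ultimately have 3: "regular_on ?A (hankel (v # ?ls))"
    by (rule regular_on_cong[OF ideal.subspace_span, rotated])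
  have "?A = ideal.span (?Q \<union> ?P)"
  proof
    have "?A \<subseteq> ideal.span (?P \<union> (F \<union> indet ` {Xvar v, Yvar v}))"
      using minors_ideal_mono[of "set ?ls" "set (v # ?ls)"] by (intro ideal.span_mono) auto
    then show "?A \<subseteq> ideal.span (?Q \<union> ?P)" by (simp add: span_Un_span Un_commute)
    have A: "?A = {p. kill {Xvar v, Yvar v} p \<in> minors_ideal (set ?ls)}"
      by (rule span_Un_indets[OF subspace_minors_ideal], rule kill_minors_ideal) (use dist in auto)
    have "minor i j \<in> ?A" if "i \<in> set (v # ?ls)" "j \<in> set (v # ?ls)" for i j
    proof (cases "i = v \<or> j = v")
      case True
      then have "kill {Xvar v, Yvar v} (minor i j :: 'k xypoly) = 0" by (auto simp: minor_def)
      then show ?thesis unfolding A by (simp add: ideal.subspace_0 subspace_minors_ideal)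
    next
      case False
      then show ?thesis using that by (intro ideal.span_base UnI1 minor_in_minors_ideal) auto
    qed
    then have "?P \<subseteq> ?A" by (intro minors_ideal_least) auto
    moreover have "?Q \<subseteq> ?A" using F(1) by (intro ideal.span_mono) auto
    ultimately show "ideal.span (?Q \<union> ?P) \<subseteq> ?A" by (intro ideal.span_minimal) auto
  qed
  with 3 have "regular_on (ideal.span (?Q \<union> ?P)) (butlast (star_seq v ?ls))"
    by (simp add: star_seq_def)
  from regular_on_Int[OF _ subspace_minors_ideal 1 2 this]
  have "regular_on (?Q \<inter> ?P) (star_seq v ?ls)" by simp
  moreover have "star_ideal v (set ?ls) F = ?P \<inter> ?Q"
    using star_ideal_eq[of v "set ?ls" F] F dist by simp
  ultimately show ?thesis by (simp add: Int_commute)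
qed

text \<open>Modulo \<open>x_v\<close> and \<open>y_v\<close>, the \<open>x\<close>-variables of the
  leaves followed by their Hankel forms reduce to independent variables. The reordering puts the
  \<open>x\<close>-variables of the inner leaves last, as spare entries for
  \<open>regular_on_star_edge\<close>.\<close>

lemma regular_on_vertex:
  assumes "distinct (v # a # us @ [l])"
  shows "regular_on (ideal.span (indet ` {Xvar v, Yvar v}) :: 'k::field xypoly set)
    ((indet (Xvar a) # hankel (a # us @ [l]) @ [indet (Xvar l)]) @ map indet (map Xvar us))"
proof -
  let ?ls = "a # us @ [l]" and ?Q = "ideal.span (indet ` {Xvar v, Yvar v}) :: 'k xypoly set"
  let ?xs = "map indet (map Xvar ?ls) :: 'k xypoly list"
  let ?S = "ideal.span (set ?xs \<union> ?Q)"
  have "regular_on ?Q (map indet (map Xvar ?ls @ map Yvar ?ls))"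
    by (rule regular_on_indets) (use assms in \<open>auto simp: distinct_map inj_on_def\<close>)
  then have "regular_on ?Q ?xs" "regular_on ?S (map indet (map Yvar ?ls))"
    unfolding map_append regular_on_append[OF ideal.subspace_span] by auto
  moreover have "ideal.span (indet ` Xvar ` set ?ls) \<subseteq> ?S"
    by (rule ideal.span_mono) auto
  then have "list_all2 (\<lambda>x y. x - y \<in> ?S) (map indet (map Yvar ?ls)) (hankel ?ls)"
    by (intro list_all2_mono[OF hankel_mod_X[of ?ls "set ?ls"]]) auto
  ultimately have "regular_on ?Q (?xs @ hankel ?ls)"
    using regular_on_cong[OF ideal.subspace_span] regular_on_append[OF ideal.subspace_span] by blast
  moreover have "pos_homogeneous std_wt x" if "x \<in> set (?xs @ hankel ?ls)" for x
    using that pos_homogeneous_hankel[of x ?ls] pos_homogeneous_indet by auto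
  moreover have "mset (?xs @ hankel ?ls) = mset ((indet (Xvar a) # hankel ?ls @ [indet (Xvar l)]) @ map indet (map Xvar us))"
    by simp
  ultimately show ?thesis
    using regular_on_perm[OF ideal.subspace_span graded_span_indets] by blast
qed

lemma regular_on_star:
  assumes "distinct (v # ls)" "2 \<le> length ls"
  shows "regular_on (star_ideal v (set ls) {} :: 'k::field xypoly set) (star_seq v ls)"
proof -
  obtain ms l where ls1: "ls = ms @ [l]" using assms(2) by (cases ls rule: rev_cases) auto
  then obtain us k where ls: "ls = us @ [k, l]" using assms(2) by (cases ms rule: rev_cases) auto
  obtain a ws where ls': "ls = a # ws @ [l]" using ls1 assms(2) by (cases ms) auto
  have "regular_on (ideal.span (indet ` {Xvar v, Yvar v}) :: 'k xypoly set)
      (indet (Xvar a) # hankel ls @ [indet (Xvar l)])"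
    using regular_on_vertex[of v a ws l, where 'k = 'k] assms(1)
    unfolding ls'[symmetric] regular_on_append[OF ideal.subspace_span] by simp
  moreover have "hd ls = a" using ls' by simp
  ultimately show ?thesis
    using regular_on_star_ideal_aux[of v us k l "{} :: 'k xypoly set"] assms(1)
    unfolding ls[symmetric] by simp
qed

text \<open>Modulo \<open>x_a\<close> and \<open>y_a + x_b\<close> the minor of the additional edge
  is \<open>x_b ^ 2\<close>, and \<open>x_b\<close> is a spare entry as \<open>b\<close> is neither
  the first nor the last leaf. The minor can therefore be appended to the sequence, moved to the
  front and absorbed into the ideal.\<close>

lemma regular_on_star_edge:
  assumes "distinct (v # a # b # us)" "us \<noteq> []"
  shows "regular_on (star_ideal v (set (a # b # us)) {minor a b :: 'k::field xypoly}) (star_seq v (a # b # us))"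
proof -
  obtain ws l where us: "us = ws @ [l]" using assms(2) by (cases us rule: rev_cases) auto
  let ?ls = "a # b # us" and ?Q = "ideal.span (indet ` {Xvar v, Yvar v}) :: 'k xypoly set"
    and ?f = "minor a b :: 'k xypoly" and ?Xb = "indet (Xvar b) :: 'k xypoly"
  let ?L = "indet (Xvar a) # hankel ?ls @ [indet (Xvar l)] :: 'k xypoly list"
  let ?S = "ideal.span (set ?L \<union> ?Q)"
  have "regular_on ?Q (?L @ [?Xb] @ map indet (map Xvar ws))"
    using regular_on_vertex[of v a "b # ws" l] assms(1) by (simp add: us)
  then have L: "regular_on ?Q ?L" and Xb: "nonzerodivisor ?S ?Xb"
    unfolding regular_on_append[OF ideal.subspace_span] by auto
  have "indet (Xvar a) \<in> ?S" "indet (Yvar a) + ?Xb \<in> ?S"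
    by (auto intro: ideal.span_base)
  then have "?Xb * (indet (Yvar a) + ?Xb) - indet (Yvar b) * indet (Xvar a) \<in> ?S"
    by (intro ideal.span_diff ideal.span_scale)
  then have "?Xb * ?Xb - ?f \<in> ?S" by (simp add: minor_def algebra_simps)
  from nonzerodivisor_cong[OF ideal.subspace_span this nonzerodivisor_mult[OF Xb Xb]] L
  have "regular_on ?Q (?L @ [?f])"
    unfolding regular_on_append[OF ideal.subspace_span] by simp
  moreover have "pos_homogeneous std_wt x" if "x \<in> set (?L @ [?f])" for x
    using that pos_homogeneous_hankel[of x ?ls] pos_homogeneous_indet pos_homogeneous_minor by auto
  moreover have "mset (?L @ [?f]) = mset (?f # ?L)" by simp
  ultimately have "regular_on ?Q (?f # ?L)"
    using regular_on_perm[OF ideal.subspace_span graded_span_indets] by blast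
  then have reg: "regular_on (ideal.span ({?f} \<union> indet ` {Xvar v, Yvar v})) ?L"
    by (simp only: regular_on.simps span_insert_span insert_is_Un[symmetric])
  obtain xs k where k: "?ls = xs @ [k, l]" using us by (cases ws rule: rev_cases) auto
  have f: "{?f} \<subseteq> minors_ideal (set ?ls)" by (simp add: minor_in_minors_ideal)
  have kf: "kill {Xvar v, Yvar v} ?f = ?f" using assms(1) by (simp add: minor_def)
  have hd: "hd ?ls = a" by simp
  show ?thesis
    using regular_on_star_ideal_aux[of v xs k l "{?f}"] f kf reg hd assms(1)
    unfolding k[symmetric] by (simp only: singleton_iff)
qed

text \<open>The Hankel form \<open>y_l\<close> is withheld, and \<open>y_b\<close>,
  \<open>y_l + x_b\<close> are appended. Modulo these two the minor of the pendant edge is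
  \<open>y_l ^ 2\<close>, and the withheld \<open>y_l\<close> is still regular, so the minor can be
  moved to the front. One form is lost and two are gained for the one new vertex.\<close>

lemma regular_on_star_pendant:
  fixes b v :: nat
  assumes dist: "distinct (v # ls)" "2 \<le> length ls" and b: "b \<notin> set (v # ls)"
  defines "l \<equiv> last ls"
  shows "regular_on (star_ideal v (set ls) {minor l b :: 'k::field xypoly})
    ((butlast (hankel (v # ls)) @ [indet (Xvar v) + indet (Xvar l)]) @
      [indet (Yvar b), indet (Yvar l) + indet (Xvar b)])"
proof -
  let ?J = "star_ideal v (set ls) {} :: 'k xypoly set"
  let ?T = "butlast (hankel (v # ls)) @ [indet (Xvar v) + indet (Xvar l)] :: 'k xypoly list"
  let ?Yl = "indet (Yvar l) :: 'k xypoly" and ?Yb = "indet (Yvar b) :: 'k xypoly"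
    and ?Xb = "indet (Xvar b) :: 'k xypoly" and ?f = "minor l b :: 'k xypoly"
  have ls: "ls \<noteq> []" using dist by auto
  then have l: "l \<in> set ls" by (simp add: l_def)
  have hankel: "hankel (v # ls) = butlast (hankel (v # ls)) @ [?Yl]"
    using hankel_eq_snoc[of "v # ls"] ls by (simp add: l_def)
  have pos: "pos_homogeneous std_wt x" if "x \<in> set (?T @ [?Yl, ?Yb, ?Xb, ?Yl + ?Xb, ?f])" for x
    using that pos_homogeneous_hankel[of x "v # ls"] pos_homogeneous_indet pos_homogeneous_indet_add
      pos_homogeneous_minor by (auto dest: in_set_butlastD)
  have J: "ideal.subspace ?J" and gJ: "graded std_wt ?J"
    unfolding star_ideal_def by (simp, rule graded_span_homogeneous) (use homogeneous_minor in blast)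
  have "regular_on ?J (star_seq v ls)" by (rule regular_on_star[OF dist])
  moreover have "mset (star_seq v ls) = mset (?T @ [?Yl])"
    unfolding star_seq_def l_def[symmetric] by (subst (1) hankel) simp
  moreover have "pos_homogeneous std_wt x" if "x \<in> set (star_seq v ls :: 'k xypoly list)" for x
    using that by (rule pos_homogeneous_star_seq)
  ultimately have T: "regular_on ?J (?T @ [?Yl])"
    using regular_on_perm[OF J gJ, of "star_seq v ls" "?T @ [?Yl]"] by blast
  have Jeq: "p \<in> ?J \<longleftrightarrow> segre (insert v (set ls)) p = 0 \<and> kill {Xvar v, Yvar v} p = 0" for p
    using star_ideal_eq[of v "set ls" "{} :: 'k xypoly set"] dist
    by (simp add: mem_minors_ideal span_indets[of _ "{Xvar v, Yvar v}", simplified])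
  have fresh: "nonzerodivisor ?J (indet u)" if "u \<in> {Xvar b, Yvar b}" for u
    using that b segre_indet_neq_0[of "insert v (set ls)" u, where 'k = 'k]
    by (auto simp: nonzerodivisor_def Jeq segre_def)
  have killJ: "kill W p \<in> ?J" if "W \<subseteq> {Xvar b, Yvar b}" "p \<in> ?J" for W p
    unfolding star_ideal_def kill_def
  proof (rule subst_span[OF ideal.subspace_span _ that(2)[unfolded star_ideal_def]])
    fix a :: "'k xypoly" assume "a \<in> {minor v l |l. l \<in> set ls} \<union> {}"
    moreover from this have "subst (\<lambda>u. if u \<in> W then 0 else indet u) a = a"
      using that(1) b by (auto simp: minor_def)
    ultimately show "subst (\<lambda>u. if u \<in> W then 0 else indet u) a \<in> ideal.span ({minor v l |l. l \<in> set ls} \<union> {})"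
      by (simp add: ideal.span_base)
  qed
  have JY: "ideal.span (insert ?Yb ?J) = {p. kill {Yvar b} p \<in> ?J}"
    using span_Un_indets[OF J, of "{Yvar b}"] killJ[of "{Yvar b}"] by simp
  have X: "nonzerodivisor (ideal.span (insert ?Yb ?J)) ?Xb"
    unfolding JY using nonzerodivisorD[OF fresh[of "Xvar b"]] by (simp add: nonzerodivisor_def)
  have "regular_on (ideal.span (?J \<union> indet ` {Xvar b, Yvar b})) (?T @ [?Yl])"
  proof (rule regular_on_Un_indets[OF J _ _ T])
    show "kill {Xvar b, Yvar b} p \<in> ?J" if "p \<in> ?J" for p using killJ that by blast
    fix x assume "x \<in> set (?T @ [?Yl])"
    then have "x \<in> polys_over (Xvar ` set (v # ls) \<union> Yvar ` set (v # ls))"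
      using hankel_polys_over[of x "v # ls"] l by (auto dest: in_set_butlastD)
    then show "kill {Xvar b, Yvar b} x = x" by (rule kill_id) (use b in auto)
  qed
  then have "regular_on ?J ([?Yb, ?Xb] @ ?T @ [?Yl])"
    using fresh X by (simp add: span_insert_span insert_commute)
  then have "regular_on ?J ((?T @ [?Yl]) @ [?Yb, ?Xb])"
    by (rule regular_on_perm[OF J gJ, rotated]) (use pos in auto)
  then have "regular_on ?J (?T @ [?Yl])" "regular_on (ideal.span (set (?T @ [?Yl]) \<union> ?J)) [?Yb, ?Xb]"
    unfolding regular_on_append[OF J] by auto
  \<comment> \<open>As long as \<open>y_l\<close> precedes it, \<open>x_b\<close> may be changed
    into \<open>y_l + x_b\<close>; only afterwards is \<open>y_l\<close> moved to the end.\<close>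
  moreover have "list_all2 (\<lambda>x y. x - y \<in> ideal.span (set (?T @ [?Yl]) \<union> ?J)) [?Yb, ?Xb] [?Yb, ?Yl + ?Xb]"
    by (auto intro: ideal.span_zero ideal.span_neg[OF ideal.span_base])
  ultimately have "regular_on ?J ((?T @ [?Yl]) @ [?Yb, ?Yl + ?Xb])"
    using regular_on_cong[OF ideal.subspace_span] regular_on_append[OF J] by blast
  then have "regular_on ?J ((?T @ [?Yb, ?Yl + ?Xb]) @ [?Yl])"
    by (rule regular_on_perm[OF J gJ, rotated]) (use pos in auto)
  then have T': "regular_on ?J (?T @ [?Yb, ?Yl + ?Xb])"
    and Y: "nonzerodivisor (ideal.span (set (?T @ [?Yb, ?Yl + ?Xb]) \<union> ?J)) ?Yl" (is "nonzerodivisor ?S _")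
    unfolding regular_on_append[OF J] by auto
  have "?Yb \<in> ?S" "?Yl + ?Xb \<in> ?S" by (auto intro: ideal.span_base)
  from ideal.span_diff[OF ideal.span_scale[OF this(2)] ideal.span_scale[OF this(1)]]
  have "?Yl * (?Yl + ?Xb) - indet (Xvar l) * ?Yb \<in> ?S" .
  then have "?Yl * ?Yl - ?f \<in> ?S" by (simp add: minor_def algebra_simps)
  from nonzerodivisor_cong[OF ideal.subspace_span this nonzerodivisor_mult[OF Y Y]] T'
  have "regular_on ?J ((?T @ [?Yb, ?Yl + ?Xb]) @ [?f])"
    unfolding regular_on_append[OF J, of "?T @ [?Yb, ?Yl + ?Xb]" "[?f]"] by simp
  then have "regular_on ?J (?f # (?T @ [?Yb, ?Yl + ?Xb]))"
    by (rule regular_on_perm[OF J gJ, rotated]) (use pos in auto)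
  moreover have "ideal.span (insert ?f ?J) = star_ideal v (set ls) {?f}"
    unfolding star_ideal_def by (simp add: span_insert_span)
  ultimately show ?thesis by simp
qed

subsection \<open>Translation to the quotient modules\<close>

text \<open>Ideals of a subring given by its carrier. The polynomials in the variables
  \<open>V\<close> form only a subset of the type, whose own ideals are the spans; this notion
  mediates between spans and ideals of \<open>poly_ring K V\<close>.\<close>

definition rel_ideal :: "'a::comm_ring_1 set \<Rightarrow> 'a set \<Rightarrow> bool"
  where "rel_ideal R I \<longleftrightarrow> I \<subseteq> R \<and> 0 \<in> I \<and> (\<forall>x\<in>I. \<forall>y\<in>I. x + y \<in> I) \<and> (\<forall>r\<in>R. \<forall>x\<in>I. r * x \<in> I)"

lemma rel_idealD:
  assumes "rel_ideal R I"
  shows "I \<subseteq> R" "0 \<in> I" "x \<in> I \<Longrightarrow> y \<in> I \<Longrightarrow> x + y \<in> I" "r \<in> R \<Longrightarrow> x \<in> I \<Longrightarrow> r * x \<in> I"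
  using assms by (auto simp: rel_ideal_def)

lemma rel_ideal_diff:
  assumes "rel_ideal (polys_over V) I" "x \<in> I" "y \<in> I"
  shows "x - y \<in> I"
proof -
  have "(- 1) * y \<in> I" using assms by (intro rel_idealD(4)[OF assms(1)]) auto
  then show ?thesis using rel_idealD(3)[OF assms(1,2)] by fastforce
qed

lemma a_inv_poly_ring: "p \<in> polys_over V \<Longrightarrow> \<ominus>\<^bsub>poly_ring K V\<^esub> p = - p"
proof -
  interpret cring "poly_ring K V" by (rule cring_poly_ring)
  assume "p \<in> polys_over V"
  then show ?thesis by (intro minus_equality) (auto simp: carrier_poly_ring)
qed

lemma a_minus_poly_ring:
  "p \<in> polys_over V \<Longrightarrow> q \<in> polys_over V \<Longrightarrow> p \<ominus>\<^bsub>poly_ring K V\<^esub> q = p - q"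
  by (simp add: a_minus_def a_inv_poly_ring)

lemma ideal_poly_ring_iff: "ideal I (poly_ring K V) \<longleftrightarrow> rel_ideal (polys_over V) I"
proof -
  interpret R: cring "poly_ring K V" by (rule cring_poly_ring)
  show ?thesis
  proof
    assume "ideal I (poly_ring K V)"
    then interpret I: ideal I "poly_ring K V" .
    show "rel_ideal (polys_over V) I"
      using I.a_subset I.zero_closed I.a_closed I.I_l_closed
      by (auto simp: rel_ideal_def carrier_poly_ring)
  next
    assume I: "rel_ideal (polys_over V) I"
    have "subgroup I (add_monoid (poly_ring K V))"
    proof (rule subgroup.intro)
      fix x assume x: "x \<in> I"
      then have "inv\<^bsub>add_monoid (poly_ring K V)\<^esub> x = - x"
        using a_inv_poly_ring[of x V K] rel_idealD(1)[OF I] by (auto simp: a_inv_def)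
      then show "inv\<^bsub>add_monoid (poly_ring K V)\<^esub> x \<in> I"
        using rel_ideal_diff[OF I rel_idealD(2)[OF I] x] by simp
    qed (use rel_idealD[OF I] in \<open>auto simp: carrier_poly_ring\<close>)
    moreover have "a * x \<in> I" "x * a \<in> I" if "a \<in> I" "x \<in> polys_over V" for a x
      using rel_idealD(4)[OF I that(2,1)] by (simp_all add: mult.commute)
    ultimately show "ideal I (poly_ring K V)"
      by (intro idealI[OF R.ring_axioms]) (auto simp: carrier_poly_ring)
  qed
qed

text \<open>Applied to a combination of elements of \<open>A\<close>, the retraction
  \<open>kill (- V)\<close> fixes these elements and moves the coefficients into the subring.
  Extending an ideal to all variables and contracting it again therefore changes nothing.\<close>

lemma genideal_poly_ring:
  assumes A: "A \<subseteq> polys_over V"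
  shows "Idl\<^bsub>poly_ring K V\<^esub> A = ideal.span A \<inter> polys_over V"
proof
  interpret R: cring "poly_ring K V" by (rule cring_poly_ring)
  have "rel_ideal (polys_over V) (ideal.span A \<inter> polys_over V)"
    by (auto simp: rel_ideal_def intro: ideal.span_zero ideal.span_add ideal.span_scale)
  then show "Idl\<^bsub>poly_ring K V\<^esub> A \<subseteq> ideal.span A \<inter> polys_over V"
    using A by (intro R.genideal_minimal) (auto simp: ideal_poly_ring_iff intro: ideal.span_base)
  have "ideal (Idl\<^bsub>poly_ring K V\<^esub> A) (poly_ring K V)" and AI: "A \<subseteq> Idl\<^bsub>poly_ring K V\<^esub> A"
    using A by (auto intro!: R.genideal_ideal R.genideal_self simp: carrier_poly_ring)
  then have I: "rel_ideal (polys_over V) (Idl\<^bsub>poly_ring K V\<^esub> A)"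
    by (simp add: ideal_poly_ring_iff)
  have "kill (- V) p \<in> Idl\<^bsub>poly_ring K V\<^esub> A" if "p \<in> ideal.span A" for p
    using that
  proof (induction rule: ideal.span_induct_alt)
    case base then show ?case using rel_idealD(2)[OF I] by simp
  next
    case (step c x y)
    have "x \<in> polys_over V" using step A by blast
    then have "kill (- V) x = x" by (rule kill_id) auto
    moreover have "kill (- V) c \<in> polys_over V" using kill_polys_over[of "- V" c] by simp
    ultimately show ?case using step AI by (auto intro!: rel_idealD(3,4)[OF I])
  qed
  moreover have "kill (- V) p = p" if "p \<in> polys_over V" for p :: "('a \<Rightarrow>\<^sub>0 nat) \<Rightarrow>\<^sub>0 'b"
    using that by (rule kill_id) auto
  ultimately show "ideal.span A \<inter> polys_over V \<subseteq> Idl\<^bsub>poly_ring K V\<^esub> A" by (metis IntE subsetI)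
qed

text \<open>The preimage of \<open>list_smult\<close> of the quotient module: the recursion ends in
  \<open>J\<close> where the submodule ends in zero.\<close>

fun lin_sum :: "'a::comm_ring_1 set \<Rightarrow> 'a set \<Rightarrow> 'a list \<Rightarrow> 'a set" where
  "lin_sum R J [] = J"
| "lin_sum R J (x # xs) = {x * p + u | p u. p \<in> R \<and> u \<in> lin_sum R J xs}"

lemma rel_ideal_lin_sum:
  "rel_ideal (polys_over V) J \<Longrightarrow> set xs \<subseteq> polys_over V \<Longrightarrow>
    rel_ideal (polys_over V) (lin_sum (polys_over V) J xs) \<and> J \<subseteq> lin_sum (polys_over V) J xs"
proof (induction xs)
  case (Cons x xs)
  let ?L = "lin_sum (polys_over V) J xs"
  have L: "rel_ideal (polys_over V) ?L" "J \<subseteq> ?L" and x: "x \<in> polys_over V" using Cons by auto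
  have "u \<in> lin_sum (polys_over V) J (x # xs)" if "u \<in> ?L" for u
    unfolding lin_sum.simps mem_Collect_eq
    using that by (intro exI[of _ 0] exI[of _ u]) auto
  moreover have "rel_ideal (polys_over V) (lin_sum (polys_over V) J (x # xs))"
    unfolding rel_ideal_def
  proof (intro conjI ballI)
    show "lin_sum (polys_over V) J (x # xs) \<subseteq> polys_over V" using x rel_idealD(1)[OF L(1)] by auto
    show "0 \<in> lin_sum (polys_over V) J (x # xs)" 
      unfolding lin_sum.simps mem_Collect_eq
      using rel_idealD(2)[OF L(1)] by (intro exI[of _ 0]) auto
    fix a assume "a \<in> lin_sum (polys_over V) J (x # xs)"
    then obtain p u where a: "a = x * p + u" "p \<in> polys_over V" "u \<in> ?L" by auto
    show "r * a \<in> lin_sum (polys_over V) J (x # xs)" if r: "r \<in> polys_over V" for r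
    proof -
      have "r * a = x * (r * p) + r * u" using a by (simp add: algebra_simps)
      then show ?thesis
        using polys_over_closed(2)[OF r a(2)] rel_idealD(4)[OF L(1) r a(3)] by auto
    qed
    fix b assume "b \<in> lin_sum (polys_over V) J (x # xs)"
    then obtain q w where b: "b = x * q + w" "q \<in> polys_over V" "w \<in> ?L" by auto
    have "a + b = x * (p + q) + (u + w)" using a b by (simp add: algebra_simps)
    then show "a + b \<in> lin_sum (polys_over V) J (x # xs)"
      using polys_over_closed(1)[OF a(2) b(2)] rel_idealD(3)[OF L(1) a(3) b(3)]
      unfolding lin_sum.simps mem_Collect_eq by blast
  qed
  ultimately show ?case using L(2) by blast
qed simp

lemma rcoset_poly_ring_eq_iff:
  assumes "rel_ideal (polys_over V) J" "p \<in> polys_over V" "q \<in> polys_over V"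
  shows "J +>\<^bsub>poly_ring K V\<^esub> p = J +>\<^bsub>poly_ring K V\<^esub> q \<longleftrightarrow> p - q \<in> J"
proof -
  interpret R: cring "poly_ring K V" by (rule cring_poly_ring)
  show ?thesis
    using R.quotient_eq_iff_same_a_r_cos[of J p q] assms
    by (simp add: ideal_poly_ring_iff carrier_poly_ring a_minus_poly_ring)
qed

lemma carrier_Quot_poly_ring:
  "carrier (poly_ring K V Quot J) = (\<lambda>p. J +>\<^bsub>poly_ring K V\<^esub> p) ` polys_over V"
  by (auto simp: FactRing_def A_RCOSETS_def' carrier_poly_ring)

lemma list_smult_quotient_module:
  assumes J: "rel_ideal (polys_over V) J"
  shows "set xs \<subseteq> polys_over V \<Longrightarrow> list_smult (quotient_module (poly_ring K V) J) xs =
    (\<lambda>p. J +>\<^bsub>poly_ring K V\<^esub> p) ` lin_sum (polys_over V) J xs"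
proof -
  let ?R = "poly_ring K V" and ?P = "polys_over V"
  let ?h = "\<lambda>p. J +>\<^bsub>?R\<^esub> p"
  interpret R: cring ?R by (rule cring_poly_ring)
  interpret J: ideal J ?R using J by (simp add: ideal_poly_ring_iff)
  interpret h: ring_hom_ring ?R "?R Quot J" ?h by (rule J.rcos_ring_hom_ring)
  show "set xs \<subseteq> ?P \<Longrightarrow> ?thesis"
  proof (induction xs)
    case Nil
    have "?h p = \<zero>\<^bsub>?R Quot J\<^esub>" if "p \<in> J" for p
    proof -
      have "?h p = ?h 0"
        using that rel_idealD(1)[OF J] rcoset_poly_ring_eq_iff[OF J, of p 0] by auto
      then show ?thesis using h.hom_zero by simp
    qed
    then show ?case using rel_idealD(2)[OF J] by auto
  next
    case (Cons x xs)
    let ?L = "lin_sum ?P J xs"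
    have x: "x \<in> ?P" and L: "?L \<subseteq> ?P" using Cons.prems rel_ideal_lin_sum[OF J, of xs] rel_idealD(1) by auto
    have eq: "?h x \<otimes>\<^bsub>?R Quot J\<^esub> ?h p \<oplus>\<^bsub>?R Quot J\<^esub> ?h u = ?h (x * p + u)" if "p \<in> ?P" "u \<in> ?L" for p u
      using that x L h.hom_mult[of x p] h.hom_add[of "x * p" u]
      by (auto simp: carrier_poly_ring)
    have "list_smult (quotient_module ?R J) (x # xs) =
        {?h x \<otimes>\<^bsub>?R Quot J\<^esub> ?h p \<oplus>\<^bsub>?R Quot J\<^esub> ?h u | p u. p \<in> ?P \<and> u \<in> ?L}"
      using Cons by (auto simp: carrier_Quot_poly_ring)
    also have "\<dots> = ?h ` lin_sum ?P J (x # xs)"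
      using eq by (auto simp: image_iff) metis+
    finally show ?case .
  qed
qed

lemma rcoset_mem_image:
  assumes J: "rel_ideal (polys_over V) J" and L: "rel_ideal (polys_over V) L" "J \<subseteq> L"
    and p: "p \<in> polys_over V"
  shows "J +>\<^bsub>poly_ring K V\<^esub> p \<in> (\<lambda>p. J +>\<^bsub>poly_ring K V\<^esub> p) ` L \<longleftrightarrow> p \<in> L"
proof
  assume "J +>\<^bsub>poly_ring K V\<^esub> p \<in> (\<lambda>p. J +>\<^bsub>poly_ring K V\<^esub> p) ` L"
  then obtain q where q: "q \<in> L" "J +>\<^bsub>poly_ring K V\<^esub> p = J +>\<^bsub>poly_ring K V\<^esub> q" by blast
  then have "p - q \<in> L"
    using rcoset_poly_ring_eq_iff[OF J p] rel_idealD(1)[OF L(1)] L(2) by blast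
  then show "p \<in> L" using rel_idealD(3)[OF L(1) _ q(1)] by fastforce
qed simp

text \<open>Every \<open>lin_sum\<close> contains \<open>J\<close>, so a coset lies in its image
  exactly if its representatives lie in it; this turns all conditions into conditions on
  polynomials.\<close>

lemma regular_sequence_quotient_module:
  assumes J: "rel_ideal (polys_over V) J"
  shows "regular_sequence (poly_ring K V) (quotient_module (poly_ring K V) J) xs \<longleftrightarrow>
    set xs \<subseteq> polys_over V \<and> lin_sum (polys_over V) J xs \<noteq> polys_over V \<and>
    (\<forall>i<length xs. \<forall>p\<in>polys_over V. xs ! i * p \<in> lin_sum (polys_over V) J (take i xs) \<longrightarrow>
      p \<in> lin_sum (polys_over V) J (take i xs))"
proof (cases "set xs \<subseteq> polys_over V")
  case True
  let ?R = "poly_ring K V" and ?P = "polys_over V"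
  let ?h = "\<lambda>p. J +>\<^bsub>?R\<^esub> p"
  interpret R: cring ?R by (rule cring_poly_ring)
  interpret J: ideal J ?R using J by (simp add: ideal_poly_ring_iff)
  interpret h: ring_hom_ring ?R "?R Quot J" ?h by (rule J.rcos_ring_hom_ring)
  have tk: "set (take i xs) \<subseteq> ?P" for i using True set_take_subset[of i xs] by blast
  have L: "rel_ideal ?P (lin_sum ?P J ys)" "J \<subseteq> lin_sum ?P J ys" if "set ys \<subseteq> ?P" for ys
    using rel_ideal_lin_sum[OF J that] by auto
  have "list_smult (quotient_module ?R J) xs = carrier (quotient_module ?R J) \<longleftrightarrow> lin_sum ?P J xs = ?P"
    unfolding list_smult_quotient_module[OF J True] quotient_module_simps carrier_Quot_poly_ring
  proof
    assume eq: "?h ` lin_sum ?P J xs = ?h ` ?P"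
    have "p \<in> lin_sum ?P J xs" if "p \<in> ?P" for p
      using rcoset_mem_image[OF J L[OF True] that, of K] imageI[OF that, of ?h]
      unfolding eq by (rule iffD1)
    then show "lin_sum ?P J xs = ?P" using rel_idealD(1)[OF L(1)[OF True]] by (intro equalityI subsetI) auto
  qed simp
  moreover have "(xs ! i) \<odot>\<^bsub>quotient_module ?R J\<^esub> ?h p \<in> list_smult (quotient_module ?R J) (take i xs)
      \<longleftrightarrow> xs ! i * p \<in> lin_sum ?P J (take i xs)" if "i < length xs" "p \<in> ?P" for i p
  proof -
    have x: "xs ! i \<in> ?P" using True that(1) nth_mem by blast
    then have "?h (xs ! i) \<otimes>\<^bsub>?R Quot J\<^esub> ?h p = ?h (xs ! i * p)"
      using that(2) h.hom_mult[of "xs ! i" p] by (simp add: carrier_poly_ring)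
    then show ?thesis
      using rcoset_mem_image[OF J L[OF tk], of "xs ! i * p"] x that(2)
      by (auto simp: list_smult_quotient_module[OF J tk])
  qed
  moreover have "?h p \<in> list_smult (quotient_module ?R J) (take i xs) \<longleftrightarrow> p \<in> lin_sum ?P J (take i xs)"
    if "p \<in> ?P" for i p
    using rcoset_mem_image[OF J L[OF tk] that] by (simp add: list_smult_quotient_module[OF J tk])
  ultimately show ?thesis
    using True by (auto simp: regular_sequence_def carrier_poly_ring carrier_Quot_poly_ring)
qed (simp add: regular_sequence_def carrier_poly_ring)

lemma nonzerodivisor_take:
  assumes "ideal.subspace I" "regular_on I xs" "i < length xs"
  shows "nonzerodivisor (ideal.span (set (take i xs) \<union> I)) (xs ! i)"
proof -
  have "xs = take i xs @ xs ! i # drop (Suc i) xs" using assms(3) by (rule id_take_nth_drop)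
  then have "regular_on I (take i xs @ xs ! i # drop (Suc i) xs)" using assms(2) by simp
  then show ?thesis unfolding regular_on_append[OF assms(1)] by simp
qed

lemma lin_sum_eq:
  assumes A: "A \<subseteq> polys_over V"
  shows "set xs \<subseteq> polys_over V \<Longrightarrow>
    lin_sum (polys_over V) (ideal.span A \<inter> polys_over V) xs = ideal.span (set xs \<union> A) \<inter> polys_over V"
proof (induction xs)
  case (Cons x xs)
  let ?B = "set xs \<union> A"
  have x: "x \<in> polys_over V" and B: "?B \<subseteq> polys_over V" using Cons.prems A by auto
  have IH: "lin_sum (polys_over V) (ideal.span A \<inter> polys_over V) xs = ideal.span ?B \<inter> polys_over V"
    using Cons by simp
  have stable: "kill (- V) p = p" if "p \<in> polys_over V" for p :: "('a \<Rightarrow>\<^sub>0 nat) \<Rightarrow>\<^sub>0 'b"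
    using that by (rule kill_id) auto
  have killB: "kill (- V) p \<in> ideal.span ?B" if "p \<in> ideal.span ?B" for p
    unfolding kill_def
  proof (rule subst_span[OF ideal.subspace_span _ that])
    fix a assume a: "a \<in> ?B"
    then have "kill (- V) a = a" using B by (intro stable) blast
    then show "subst (\<lambda>v. if v \<in> - V then 0 else indet v) a \<in> ideal.span ?B"
      using a unfolding kill_def by (simp only: ideal.span_base)
  qed
  have "p \<in> lin_sum (polys_over V) (ideal.span A \<inter> polys_over V) (x # xs)"
    if p: "p \<in> ideal.span (set (x # xs) \<union> A)" "p \<in> polys_over V" for p
  proof -
    obtain q where q: "p - q * x \<in> ideal.span ?B"
      using p(1) ideal.span_breakdown_eq[of p x ?B] by auto
    then have "p - kill (- V) q * x \<in> ideal.span ?B"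
      using killB[OF q] stable[OF x] stable[OF p(2)] by simp
    moreover have k: "kill (- V) q \<in> polys_over V" using kill_polys_over[of "- V" q] by simp
    ultimately have "p - kill (- V) q * x \<in> ideal.span ?B \<inter> polys_over V" using p x by auto
    moreover have "p = x * kill (- V) q + (p - kill (- V) q * x)" by (simp add: mult.commute)
    ultimately show ?thesis using k unfolding lin_sum.simps mem_Collect_eq IH by blast
  qed
  moreover have "x * p + u \<in> ideal.span (set (x # xs) \<union> A) \<inter> polys_over V"
    if "p \<in> polys_over V" "u \<in> ideal.span ?B \<inter> polys_over V" for p u
  proof -
    have "p * x \<in> ideal.span (set (x # xs) \<union> A)" by (intro ideal.span_scale ideal.span_base) simp
    moreover have "u \<in> ideal.span (set (x # xs) \<union> A)"
      using that ideal.span_mono[of ?B "set (x # xs) \<union> A"] by auto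
    ultimately show ?thesis using that x ideal.span_add[of "p * x" _ u] by (auto simp: mult.commute)
  qed
  ultimately show ?case by (auto simp: IH)
qed simp

text \<open>\<open>kill UNIV\<close> takes the constant term, and a monomial of positive degree
  contains a variable.\<close>

lemma pos_homogeneous_kill_UNIV: "pos_homogeneous std_wt x \<Longrightarrow> kill UNIV x = 0"
  for x :: "'k::field xypoly"
proof -
  assume "pos_homogeneous std_wt x"
  then obtain d where d: "0 < d" "homogeneous std_wt d x" by (auto simp: pos_homogeneous_def)
  have "const (lookup x m) * mono_subst (\<lambda>_. 0) m = (0 :: 'k xypoly)" if "m \<in> Poly_Mapping.keys x" for m
  proof -
    have "m \<noteq> 0" using that d by (auto simp: homogeneous_def)
    then obtain v where "v \<in> Poly_Mapping.keys m" by (auto simp flip: keys_eq_empty)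
    then show ?thesis by (auto simp: mono_subst_def in_keys_iff intro!: prod_zero)
  qed
  then have "(\<Sum>m\<in>Poly_Mapping.keys x. const (lookup x m) * mono_subst (\<lambda>_. 0) m) = (0 :: 'k xypoly)"
    by (intro sum.neutral ballI)
  then show ?thesis by (simp add: kill_def subst_def)
qed

abbreviation xyvars :: "nat \<Rightarrow> xyvar set"
  where "xyvars n \<equiv> Xvar ` {1..n} \<union> Yvar ` {1..n}"

lemma mem_graded_max_ideal:
  "x \<in> graded_max_ideal K n \<longleftrightarrow> x \<in> polys_over (xyvars n) \<and> kill UNIV x = 0"
proof -
  have "kill UNIV x = kill (xyvars n) (kill (- xyvars n) x)" for x :: "'a xypoly"
    by (simp only: kill_kill Compl_partition)
  moreover have "kill (- xyvars n) x = x" if "x \<in> polys_over (xyvars n)" for x :: "'a xypoly"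
    using that by (rule kill_id) auto
  moreover have "indet ` xyvars n \<subseteq> polys_over (xyvars n)" by auto
  from genideal_poly_ring[OF this] have "graded_max_ideal K n = ideal.span (indet ` xyvars n) \<inter> polys_over (xyvars n)"
    by (simp add: graded_max_ideal_def xy_ring_def)
  ultimately show ?thesis by (auto simp: span_indets)
qed

text \<open>Regularity is tested in the ring in all variables and restricted. Properness holds
  because generators and entries have constant term zero, so that 1 is not in the ideal they
  generate.\<close>

lemma depth_ge:
  fixes xs :: "'k::field xypoly list"
  assumes A: "A \<subseteq> polys_over (xyvars n)" "\<And>a. a \<in> A \<Longrightarrow> kill UNIV a = 0"
    and xs: "set xs \<subseteq> polys_over (xyvars n)" "\<And>x. x \<in> set xs \<Longrightarrow> pos_homogeneous std_wt x"
    and reg: "regular_on (ideal.span A) xs"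
  shows "enat (length xs) \<le> depth (xy_ring K n) (graded_max_ideal K n)
    (quotient_module (xy_ring K n) (ideal.span A \<inter> polys_over (xyvars n)))"
proof -
  let ?P = "polys_over (xyvars n) :: 'k xypoly set" and ?J = "ideal.span A \<inter> polys_over (xyvars n)"
  have J: "rel_ideal ?P ?J"
    by (auto simp: rel_ideal_def intro: ideal.span_zero ideal.span_add ideal.span_scale)
  have kx: "kill UNIV x = 0" if "x \<in> set xs" for x using xs(2)[OF that] by (rule pos_homogeneous_kill_UNIV)
  have "kill UNIV p = 0" if "p \<in> ideal.span (set xs \<union> A)" for p
    using that by (induction rule: ideal.span_induct_alt) (auto simp: kx A(2))
  then have "1 \<notin> lin_sum ?P ?J xs" unfolding lin_sum_eq[OF A(1) xs(1)] by fastforce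
  then have "lin_sum ?P ?J xs \<noteq> ?P" by auto
  moreover have "p \<in> lin_sum ?P ?J (take i xs)"
    if "i < length xs" "p \<in> ?P" "xs ! i * p \<in> lin_sum ?P ?J (take i xs)" for i p
  proof -
    have tk: "set (take i xs) \<subseteq> ?P" using xs(1) set_take_subset[of i xs] by blast
    have "nonzerodivisor (ideal.span (set (take i xs) \<union> A)) (xs ! i)"
      using nonzerodivisor_take[OF ideal.subspace_span reg that(1)] by (simp add: span_Un_span)
    then show ?thesis
      using that(2,3) unfolding lin_sum_eq[OF A(1) tk] nonzerodivisor_def by auto
  qed
  ultimately have "regular_sequence (xy_ring K n) (quotient_module (xy_ring K n) ?J) xs"
    unfolding xy_ring_def using xs(1) by (subst regular_sequence_quotient_module[OF J]) auto
  moreover have "set xs \<subseteq> graded_max_ideal K n" using xs(1) kx by (auto simp: mem_graded_max_ideal)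
  ultimately show ?thesis unfolding depth_def by (intro Sup_upper) blast
qed

subsection \<open>The ascending chain condition\<close>

text \<open>Every sequence has a monotone subsequence, and a decreasing sequence of naturals is
  constant from the point where it attains its minimum.\<close>

lemma nat_incseq_subseq:
  "\<exists>r :: nat \<Rightarrow> nat. strict_mono r \<and> (\<forall>i j. i \<le> j \<longrightarrow> f (r i) \<le> f (r j))" for f :: "nat \<Rightarrow> nat"
proof -
  obtain r :: "nat \<Rightarrow> nat" where r: "strict_mono r" "monoseq (\<lambda>n. f (r n))" using seq_monosub by blast
  show ?thesis
  proof (cases "incseq (\<lambda>n. f (r n))")
    case True then show ?thesis using r(1) by (auto simp: incseq_def)
  next
    case False
    then have dec: "decseq (\<lambda>n. f (r n))" using r(2) by (simp add: monoseq_iff)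
    define k where "k = (LEAST k. k \<in> range (\<lambda>n. f (r n)))"
    have "k \<in> range (\<lambda>n. f (r n))" unfolding k_def by (rule LeastI[of _ "f (r 0)"]) simp
    then obtain N where N: "k = f (r N)" by auto
    have "f (r n) = k" if "N \<le> n" for n
      using dec that N Least_le[of "\<lambda>k. k \<in> range (\<lambda>n. f (r n))" "f (r n)"]
      by (auto simp: decseq_def k_def[symmetric] intro: antisym)
    then show ?thesis
      using r(1) by (intro exI[of _ "\<lambda>n. r (N + n)"]) (auto simp: strict_mono_def)
  qed
qed

lemma dickson:
  "finite V \<Longrightarrow> \<exists>r :: nat \<Rightarrow> nat. strict_mono r \<and> (\<forall>v\<in>V. \<forall>i j. i \<le> j \<longrightarrow> a (r i) v \<le> (a (r j) v :: nat))"
proof (induction V rule: finite_induct)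
  case empty then show ?case by (intro exI[of _ id]) (simp add: strict_mono_def)
next
  case (insert v V)
  then obtain r :: "nat \<Rightarrow> nat" where r: "strict_mono r" "\<forall>v\<in>V. \<forall>i j. i \<le> j \<longrightarrow> a (r i) v \<le> a (r j) v" by blast
  obtain s :: "nat \<Rightarrow> nat" where s: "strict_mono s" "\<forall>i j. i \<le> j \<longrightarrow> a (r (s i)) v \<le> a (r (s j)) v"
    using nat_incseq_subseq[of "\<lambda>n. a (r n) v"] by blast
  have "s i \<le> s j" if "i \<le> j" for i j using s(1) that by (simp add: strict_mono_less_eq)
  then show ?case
    using r s by (intro exI[of _ "r \<circ> s"]) (auto simp: strict_mono_def)
qed

lemma monomial_pos: "(0 :: 'v::linorder \<Rightarrow>\<^sub>0 nat) \<le> d"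
proof (cases "d = 0")
  case False
  then have ne: "Poly_Mapping.keys d \<noteq> {}" by simp
  let ?k = "Min (Poly_Mapping.keys d)"
  have "?k \<in> Poly_Mapping.keys d" using ne by simp
  moreover have "k \<notin> Poly_Mapping.keys d" if "k < ?k" for k
    using that ne by (meson Min_le finite_keys leD)
  ultimately have "0 < d"
    by (auto simp: less_poly_mapping.rep_eq less_fun_def in_keys_iff intro!: exI[of _ ?k])
  then show ?thesis by simp
qed simp

lemma monomial_dvd:
  assumes "\<And>v. lookup a v \<le> (lookup b v :: nat)"
  shows "b = a + (b - a)"
  using assms by (intro poly_mapping_eqI) (simp add: lookup_add lookup_minus)

lemma dickson_monomials:
  fixes m :: "nat \<Rightarrow> ('v::linorder \<Rightarrow>\<^sub>0 nat)"
  assumes "finite V" "\<And>i. Poly_Mapping.keys (m i) \<subseteq> V"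
  shows "\<exists>i j. i < j \<and> m j = m i + (m j - m i)"
proof -
  obtain r :: "nat \<Rightarrow> nat" where r: "strict_mono r" "\<forall>v\<in>V. \<forall>i j. i \<le> j \<longrightarrow> lookup (m (r i)) v \<le> lookup (m (r j)) v"
    using dickson[OF assms(1), of "\<lambda>i v. lookup (m i) v"] by blast
  have "lookup (m (r 0)) v \<le> lookup (m (r 1)) v" for v
  proof (cases "v \<in> V")
    case False
    then have "lookup (m (r 0)) v = 0" using assms(2)[of "r 0"] by (auto simp: in_keys_iff)
    then show ?thesis by simp
  qed (use r in simp)
  from monomial_dvd[OF this] show ?thesis
    using r(1) by (intro exI[of _ "r 0"] exI[of _ "r 1"]) (auto simp: strict_mono_def)
qed

text \<open>By Dickson's lemma an infinite descent would contain \<open>f j = f i + m\<close> with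
  \<open>i < j\<close>, which is not below \<open>f i\<close>. In finitely many variables the order
  is thus a well-order.\<close>

lemma monomial_minimum:
  fixes S :: "('v::linorder \<Rightarrow>\<^sub>0 nat) set"
  assumes V: "finite V" "\<And>m. m \<in> S \<Longrightarrow> Poly_Mapping.keys m \<subseteq> V" and "S \<noteq> {}"
  shows "\<exists>m\<in>S. \<forall>m'\<in>S. m \<le> m'"
proof (rule ccontr)
  assume *: "\<not> ?thesis"
  have "\<exists>f :: nat \<Rightarrow> _. \<forall>n. f n \<in> S \<and> f (Suc n) < f n"
  proof (rule dependent_nat_choice)
    show "\<exists>x. x \<in> S" using assms(3) by blast
    show "\<exists>y. y \<in> S \<and> y < x" if "x \<in> S" for x n
      using * that by (meson not_le)
  qed
  then obtain f where f: "\<And>n. f n \<in> S" "\<And>n. f (Suc n) < f n" by blast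
  have dec: "f j < f i" if "i < j" for i j
    using that f(2) by (induction j) (auto simp: less_Suc_eq intro: less_trans)
  obtain i j where ij: "i < j" "f j = f i + (f j - f i)"
    using dickson_monomials[of V f] V f(1) by blast
  have "f i + 0 \<le> f i + (f j - f i)" by (rule add_left_mono[OF monomial_pos])
  then show False using ij dec[OF ij(1)] by simp
qed

text \<open>In each difference \<open>F (Suc i) - F i\<close> choose an element \<open>p i\<close>
  with least leading monomial. By Dickson's lemma the leading monomial of some \<open>p i\<close>
  divides that of a later \<open>p j\<close>. Subtracting a multiple of \<open>p i\<close>, which
  lies in \<open>F j\<close>, cancels the leading term without leaving the difference, against the
  minimality of \<open>p j\<close>.\<close>

lemma polys_over_acc:
  fixes F :: "nat \<Rightarrow> (('v::linorder \<Rightarrow>\<^sub>0 nat) \<Rightarrow>\<^sub>0 'k::field) set"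
  assumes V: "finite V" and F: "\<And>i. rel_ideal (polys_over V) (F i)" and inc: "\<And>i. F i \<subseteq> F (Suc i)"
  shows "\<exists>i. F (Suc i) = F i"
proof (rule ccontr)
  assume "\<not> ?thesis"
  then have ne: "F (Suc i) - F i \<noteq> {}" for i using inc[of i] by blast
  define lm where "lm p = Max (Poly_Mapping.keys p)" for p :: "('v \<Rightarrow>\<^sub>0 nat) \<Rightarrow>\<^sub>0 'k"
  have lm: "lm p \<in> Poly_Mapping.keys p" if "p \<noteq> 0" for p
    unfolding lm_def using that by (intro Max_in) auto
  have nz: "p \<noteq> 0" if "p \<in> F (Suc i) - F i" for p i using that rel_idealD(2)[OF F[of i]] by auto
  have keys: "Poly_Mapping.keys m \<subseteq> V" if "m \<in> Poly_Mapping.keys p" "p \<in> F i" for m p i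
    using that rel_idealD(1)[OF F[of i]] by (auto simp: polys_over_def)
  have "\<exists>p\<in>F (Suc i) - F i. \<forall>q\<in>F (Suc i) - F i. lm p \<le> lm q" for i
  proof -
    have "\<exists>m\<in>lm ` (F (Suc i) - F i). \<forall>m'\<in>lm ` (F (Suc i) - F i). m \<le> m'"
    proof (rule monomial_minimum[OF V])
      fix m assume "m \<in> lm ` (F (Suc i) - F i)"
      then show "Poly_Mapping.keys m \<subseteq> V" using keys lm nz by blast
    qed (use ne in simp)
    then show ?thesis by blast
  qed
  then obtain p where p: "\<And>i. p i \<in> F (Suc i) - F i" "\<And>i q. q \<in> F (Suc i) - F i \<Longrightarrow> lm (p i) \<le> lm q"
    by metis
  have pk: "Poly_Mapping.keys (lm (p i)) \<subseteq> V" for i using keys lm nz p(1) by blast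
  obtain i j where ij: "i < j" "lm (p j) = lm (p i) + (lm (p j) - lm (p i))"
    using dickson_monomials[OF V, of "\<lambda>i. lm (p i)"] pk by blast
  define d where "d = lm (p j) - lm (p i)"
  define c where "c = lookup (p j) (lm (p j)) / lookup (p i) (lm (p i))"
  have d: "lm (p j) = d + lm (p i)" using ij by (simp add: d_def add.commute)
  define s where "s = Poly_Mapping.single d c"
  have "Poly_Mapping.keys d \<subseteq> V"
  proof
    fix v assume "v \<in> Poly_Mapping.keys d"
    then have "lookup (lm (p j)) v \<noteq> 0" by (simp add: d lookup_add in_keys_iff)
    then show "v \<in> V" using pk[of j] by (auto simp: in_keys_iff)
  qed
  then have sP: "s \<in> polys_over V" by (auto simp: s_def polys_over_def split: if_splits)
  have sub: "F (Suc i) \<subseteq> F j" using lift_Suc_mono_le[of F "Suc i" j] inc ij(1) by simp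
  have spF: "s * p i \<in> F j" using p(1)[of i] sub by (intro rel_idealD(4)[OF F sP]) auto
  define q where "q = p j - s * p i"
  have "q \<in> F (Suc j)"
    using p(1)[of j] spF inc[of j] by (auto simp: q_def intro: rel_ideal_diff[OF F])
  moreover have "q \<notin> F j"
  proof
    assume "q \<in> F j"
    then have "q + s * p i \<in> F j" using rel_idealD(3)[OF F] spF by blast
    then show False using p(1)[of j] by (simp add: q_def)
  qed
  ultimately have q: "q \<in> F (Suc j) - F j" by simp
  have kle: "m \<le> lm (p i)" if "m \<in> Poly_Mapping.keys (p i)" for m i
    unfolding lm_def using that by simp
  have ks: "Poly_Mapping.keys (s * p i) \<subseteq> {d + m | m. m \<in> Poly_Mapping.keys (p i)}"
    using keys_mult[of s "p i"] by (auto simp: s_def split: if_splits)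
  have le: "m \<le> lm (p j)" if "m \<in> Poly_Mapping.keys q" for m
  proof -
    have "m \<in> Poly_Mapping.keys (p j) \<or> m \<in> Poly_Mapping.keys (s * p i)"
      using that Poly_Mapping.keys_add[of "p j" "- (s * p i)"] by (auto simp: q_def)
    then show ?thesis
      using kle[of m j] ks kle[of _ i] unfolding d by (auto intro: add_left_mono)
  qed
  have lk: "lookup (s * r) (d + m) = c * lookup r m" for r m
  proof -
    have "s * r = (\<Sum>m'\<in>Poly_Mapping.keys r. Poly_Mapping.single (d + m') (c * lookup r m'))"
      by (subst (1) poly_mapping_sum_single[of r]) (simp add: s_def sum_distrib_left mult_single)
    then show ?thesis
      by (auto simp: lookup_sum lookup_single when_def in_keys_iff)
  qed
  have "lookup (p i) (lm (p i)) \<noteq> 0" using lm[OF nz[OF p(1)[of i]]] by (simp add: in_keys_iff)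
  then have "lookup q (lm (p j)) = 0"
    using lk[of "p i" "lm (p i)"] by (simp add: q_def lookup_minus d[symmetric] c_def)
  then have "lm q \<noteq> lm (p j)" using lm[OF nz[OF q]] by (auto simp: in_keys_iff)
  moreover have "lm q \<le> lm (p j)" using le lm[OF nz[OF q]] by blast
  ultimately show False using p(2)[OF q] by simp
qed

subsection \<open>Algebraic independence\<close>

fun list_monom :: "'a::comm_ring_1 list \<Rightarrow> nat list \<Rightarrow> 'a" where
  "list_monom (x # xs) (k # a) = x ^ k * list_monom xs a"
| "list_monom _ _ = 1"

text \<open>\<open>I\<close> need not be prime: in the bound for the depth it is an annihilator. The
  lengths are prescribed because \<open>list_monom\<close> yields 1 as soon as one of its lists
  ends.\<close>

definition alg_indep :: "(('v \<Rightarrow>\<^sub>0 nat) \<Rightarrow>\<^sub>0 'k::field) set \<Rightarrow> (('v \<Rightarrow>\<^sub>0 nat) \<Rightarrow>\<^sub>0 'k) list \<Rightarrow> bool"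
  where "alg_indep I xs \<longleftrightarrow> (\<forall>A c. finite A \<longrightarrow> (\<forall>a\<in>A. length a = length xs) \<longrightarrow>
    (\<Sum>a\<in>A. const (c a) * list_monom xs a) \<in> I \<longrightarrow> (\<forall>a\<in>A. c a = 0))"

lemma alg_indepD:
  "alg_indep I xs \<Longrightarrow> finite A \<Longrightarrow> (\<And>a. a \<in> A \<Longrightarrow> length a = length xs) \<Longrightarrow>
    (\<Sum>a\<in>A. const (c a) * list_monom xs a) \<in> I \<Longrightarrow> a \<in> A \<Longrightarrow> c a = 0"
  unfolding alg_indep_def by blast

lemma alg_indep_antimono: "alg_indep I xs \<Longrightarrow> J \<subseteq> I \<Longrightarrow> alg_indep J xs"
  unfolding alg_indep_def by blast

lemma list_monom_polys_over: "set xs \<subseteq> polys_over V \<Longrightarrow> list_monom xs a \<in> polys_over V"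
  by (induction xs a rule: list_monom.induct) auto

lemma alg_indep_Nil:
  assumes "rel_ideal (polys_over V) I" "1 \<notin> I"
  shows "alg_indep I []"
  unfolding alg_indep_def
proof (intro allI impI ballI)
  fix A c a assume A: "finite A" "\<forall>a\<in>A. length a = length []" and a: "a \<in> A"
    and s: "(\<Sum>a\<in>A. const (c a) * list_monom [] a) \<in> I"
  have "a = []" using A(2) a by simp
  moreover from this have "A = {[]}" using A(2) a by auto
  ultimately have "const (c a) \<in> I" using s by simp
  then have "const (1 / c a) * const (c a) \<in> I" by (intro rel_idealD(4)[OF assms(1)]) auto
  then show "c a = 0" using assms(2) by (cases "c a = 0") (auto simp flip: const_simps(4))
qed

text \<open>A relation is reduced modulo \<open>x\<close>, where \<open>x\<close> vanishes, and what remains is divided by \<open>x\<close>.\<close>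

lemma alg_indep_Cons:
  fixes I I' :: "(('v \<Rightarrow>\<^sub>0 nat) \<Rightarrow>\<^sub>0 'k::field) set"
  assumes I: "rel_ideal (polys_over V) I" and I': "rel_ideal (polys_over V) I'" and "I \<subseteq> I'"
    and x: "x \<in> I'" and xI: "\<And>p. p \<in> polys_over V \<Longrightarrow> x * p \<in> I \<Longrightarrow> p \<in> I"
    and xs: "set xs \<subseteq> polys_over V" and ind: "alg_indep I' xs"
  shows "alg_indep I (x # xs)"
proof -
  have xV: "x \<in> polys_over V" using x rel_idealD(1)[OF I'] by blast
  have *: "\<forall>a\<in>A. c a = 0"
    if "finite A" "\<forall>a\<in>A. length a = Suc (length xs)" "\<forall>a\<in>A. hd a < N"
      "(\<Sum>a\<in>A. const (c a) * list_monom (x # xs) a) \<in> I" for N A and c :: "nat list \<Rightarrow> 'k"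
    using that
  proof (induction N arbitrary: A c)
    case (Suc N)
    define A0 where "A0 = {a \<in> A. hd a = 0}"
    define A1 where "A1 = {a \<in> A. hd a \<noteq> 0}"
    define dec where "dec a = (hd a - 1) # tl a" for a :: "nat list"
    define inc where "inc a = Suc (hd a) # tl a" for a :: "nat list"
    have A: "finite A0" "finite A1" "A = A0 \<union> A1" "A0 \<inter> A1 = {}"
      using Suc.prems(1) by (auto simp: A0_def A1_def)
    have a0: "a = 0 # tl a" "length (tl a) = length xs" if "a \<in> A0" for a
      using that Suc.prems(2) by (cases a; auto simp: A0_def)+
    have a1: "inc (dec a) = a" "length (dec a) = Suc (length xs)" "hd (dec a) < N"
      "list_monom (x # xs) a = x * list_monom (x # xs) (dec a)" if "a \<in> A1" for a
    proof -
      have "a \<in> A" "hd a \<noteq> 0" using that by (auto simp: A1_def)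
      then have "length a = Suc (length xs)" "hd a < Suc N" using Suc.prems(2,3) by auto
      then obtain k b where a: "a = Suc k # b" "length b = length xs" "k < N"
        using \<open>hd a \<noteq> 0\<close> by (cases a; cases "hd a") auto
      then show "inc (dec a) = a" "length (dec a) = Suc (length xs)" "hd (dec a) < N"
        "list_monom (x # xs) a = x * list_monom (x # xs) (dec a)"
        by (auto simp: inc_def dec_def mult.assoc)
    qed
    define s0 where "s0 = (\<Sum>a\<in>A0. const (c a) * list_monom (x # xs) a)"
    define s1 where "s1 = (\<Sum>a\<in>A1. const (c a) * list_monom (x # xs) (dec a))"
    have "(\<Sum>a\<in>A1. const (c a) * list_monom (x # xs) a) = x * s1"
      unfolding s1_def sum_distrib_left by (rule sum.cong) (auto simp: a1(4) mult_ac simp del: list_monom.simps)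
    then have sum: "(\<Sum>a\<in>A. const (c a) * list_monom (x # xs) a) = s0 + x * s1"
      unfolding A(3) s0_def by (subst sum.union_disjoint[OF A(1,2,4)]) simp
    have s1V: "s1 \<in> polys_over V"
      unfolding s1_def using xs xV
      by (intro polys_over_sum polys_over_closed polys_over_const list_monom_polys_over) auto
    have "s0 + x * s1 \<in> I'" using Suc.prems(4) sum \<open>I \<subseteq> I'\<close> by auto
    moreover have "x * s1 \<in> I'" using rel_idealD(4)[OF I' s1V x] by (simp add: mult.commute)
    ultimately have "s0 + x * s1 - x * s1 \<in> I'" using rel_ideal_diff[OF I'] by blast
    moreover have inj: "inj_on tl A0" by (rule inj_onI) (metis a0(1))
    have "s0 = (\<Sum>b\<in>tl ` A0. const (c (0 # b)) * list_monom xs b)"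
      unfolding s0_def sum.reindex[OF inj]
    proof (rule sum.cong)
      fix a assume "a \<in> A0"
      then show "const (c a) * list_monom (x # xs) a = ((\<lambda>b. const (c (0 # b)) * list_monom xs b) \<circ> tl) a"
        using a0(1)[of a] by (cases a) auto
    qed simp
    ultimately have I'0: "(\<Sum>b\<in>tl ` A0. const (c (0 # b)) * list_monom xs b) \<in> I'" by simp
    have len: "length b = length xs" if "b \<in> tl ` A0" for b using that a0(2) by blast
    have c0: "c (0 # b) = 0" if "b \<in> tl ` A0" for b
      using alg_indepD[OF ind finite_imageI[OF A(1)] len I'0 that] .
    then have cA0: "c a = 0" if "a \<in> A0" for a using a0(1)[OF that] that by (metis imageI)
    then have "s0 = 0" unfolding s0_def by (simp del: list_monom.simps)
    then have "s1 \<in> I" using Suc.prems(4) sum xI[OF s1V] by simp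
    moreover have inj1: "inj_on dec A1" by (rule inj_onI) (metis a1(1))
    have "s1 = (\<Sum>b\<in>dec ` A1. const (c (inc b)) * list_monom (x # xs) b)"
      unfolding s1_def sum.reindex[OF inj1] by (rule sum.cong) (auto simp: a1(1))
    ultimately have "\<forall>b\<in>dec ` A1. c (inc b) = 0"
      using A(2) a1(2,3) by (intro Suc.IH) auto
    then have "c a = 0" if "a \<in> A1" for a using that a1(1) by fastforce
    then show ?case using cA0 A(3) by blast
  qed auto
  then have main: "c a = 0" if "finite A" "\<forall>a\<in>A. length a = Suc (length xs)" "a \<in> A"
      "(\<Sum>a\<in>A. const (c a) * list_monom (x # xs) a) \<in> I" for A a and c :: "nat list \<Rightarrow> 'k"
  proof -
    have "finite (hd ` A)" using that(1) by simp
    then obtain N where "hd ` A \<subseteq> {..<N}" using finite_nat_iff_bounded by blast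
    then have "\<forall>a\<in>A. hd a < N" by auto
    then show ?thesis using *[OF that(1,2) _ that(4)] that(3) by blast
  qed
  show ?thesis unfolding alg_indep_def using main by simp
qed

text \<open>For an ideal \<open>J\<close> of the polynomial ring \<open>R\<close>, the contraction
  of its extension to the local ring at the origin: a polynomial with nonzero constant term can be
  rescaled to constant term 1.\<close>

definition unit_sat :: "(('v \<Rightarrow>\<^sub>0 nat) \<Rightarrow>\<^sub>0 'k::field) set \<Rightarrow> (('v \<Rightarrow>\<^sub>0 nat) \<Rightarrow>\<^sub>0 'k) set \<Rightarrow> (('v \<Rightarrow>\<^sub>0 nat) \<Rightarrow>\<^sub>0 'k) set"
  where "unit_sat R J = {p \<in> R. \<exists>b\<in>R. kill UNIV b = 1 \<and> b * p \<in> J}"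

lemma unit_satI: "p \<in> R \<Longrightarrow> b \<in> R \<Longrightarrow> kill UNIV b = 1 \<Longrightarrow> b * p \<in> J \<Longrightarrow> p \<in> unit_sat R J"
  unfolding unit_sat_def by blast

lemma unit_satE:
  assumes "p \<in> unit_sat R J"
  obtains b where "p \<in> R" "b \<in> R" "kill UNIV b = 1" "b * p \<in> J"
  using assms unfolding unit_sat_def by blast

lemma rel_ideal_unit_sat:
  assumes J: "rel_ideal (polys_over V) J"
  shows "rel_ideal (polys_over V) (unit_sat (polys_over V) J)" "J \<subseteq> unit_sat (polys_over V) J"
proof -
  show "J \<subseteq> unit_sat (polys_over V) J"
    using rel_idealD(1)[OF J] by (auto intro!: unit_satI[of _ _ 1])
  show "rel_ideal (polys_over V) (unit_sat (polys_over V) J)"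
    unfolding rel_ideal_def
  proof (intro conjI ballI)
    show "unit_sat (polys_over V) J \<subseteq> polys_over V" by (auto simp: unit_sat_def)
    show "0 \<in> unit_sat (polys_over V) J" using rel_idealD(2)[OF J] by (intro unit_satI[of _ _ 1]) auto
    fix p assume p: "p \<in> unit_sat (polys_over V) J"
    then obtain b where b: "p \<in> polys_over V" "b \<in> polys_over V" "kill UNIV b = 1" "b * p \<in> J"
      by (rule unit_satE)
    show "r * p \<in> unit_sat (polys_over V) J" if "r \<in> polys_over V" for r
      using b that rel_idealD(4)[OF J that b(4)] by (intro unit_satI[of _ _ b]) (auto simp: mult.left_commute)
    fix q assume "q \<in> unit_sat (polys_over V) J"
    then obtain e where e: "q \<in> polys_over V" "e \<in> polys_over V" "kill UNIV e = 1" "e * q \<in> J"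
      by (rule unit_satE)
    have "e * (b * p) + b * (e * q) \<in> J"
      using rel_idealD(4)[OF J e(2) b(4)] rel_idealD(4)[OF J b(2) e(4)] by (rule rel_idealD(3)[OF J])
    then have "(b * e) * (p + q) \<in> J" by (simp add: algebra_simps)
    then show "p + q \<in> unit_sat (polys_over V) J"
      using b e by (intro unit_satI[of _ _ "b * e"]) auto
  qed
qed

lemma lin_sum_shift: "lin_sum R J (x # xs) = lin_sum R (lin_sum R J [x]) xs"
proof (induction xs)
  case (Cons y xs)
  have "lin_sum R J (x # y # xs) = {y * q + u | q u. q \<in> R \<and> u \<in> lin_sum R J (x # xs)}"
    by (auto, metis add.left_commute, metis add.left_commute)
  then show ?case unfolding Cons lin_sum.simps(2)[of R "lin_sum R J [x]" y xs] .
qed simp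

text \<open>Krull's intersection argument: otherwise there are \<open>w\<^sub>i\<close> with \<open>b\<^sub>i w\<^sub>i = x w\<^sub>i\<^sub>+\<^sub>1\<close> modulo \<open>J\<close>
  and \<open>b\<^sub>i\<close> a unit at the origin, and the ideals \<open>(w\<^sub>i) + J\<close> become stationary.\<close>

lemma exists_not_divisible:
  fixes J :: "(('v::linorder \<Rightarrow>\<^sub>0 nat) \<Rightarrow>\<^sub>0 'k::field) set"
  assumes V: "finite V" and J: "rel_ideal (polys_over V) J"
    and x: "x \<in> polys_over V" "kill UNIV x = 0"
    and xJ: "\<And>p. p \<in> polys_over V \<Longrightarrow> x * p \<in> J \<Longrightarrow> p \<in> J"
    and u: "u \<in> polys_over V" "u \<notin> unit_sat (polys_over V) J"
  shows "\<exists>w\<in>polys_over V. w \<notin> unit_sat (polys_over V) (lin_sum (polys_over V) J [x]) \<and>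
    (\<forall>p\<in>polys_over V. p * u \<in> unit_sat (polys_over V) J \<longrightarrow> p * w \<in> unit_sat (polys_over V) J)"
proof (rule ccontr)
  assume no: "\<not> ?thesis"
  let ?P = "polys_over V :: (('v \<Rightarrow>\<^sub>0 nat) \<Rightarrow>\<^sub>0 'k) set"
  let ?s = "unit_sat ?P"
  \<comment> \<open>The elements that survive at the origin and are annihilated by everything that
    annihilates \<open>u\<close>. The negated claim makes each of them a multiple of
    \<open>x\<close> up to a unit, and the cofactor stays in \<open>N\<close>.\<close>
  define N where "N = {w \<in> ?P. w \<notin> ?s J \<and> (\<forall>p\<in>?P. p * u \<in> ?s J \<longrightarrow> p * w \<in> ?s J)}"
  have step: "\<exists>w'. w' \<in> N \<and> (\<exists>b\<in>?P. kill UNIV b = 1 \<and> b * w - x * w' \<in> J)" if w: "w \<in> N" for w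
  proof -
    have wP: "w \<in> ?P" and wJ: "w \<notin> ?s J" and wp: "\<And>p. p \<in> ?P \<Longrightarrow> p * u \<in> ?s J \<Longrightarrow> p * w \<in> ?s J"
      using w by (auto simp: N_def)
    have "w \<in> ?s (lin_sum ?P J [x])" using no w by (auto simp: N_def)
    then obtain b w' j where b: "b \<in> ?P" "kill UNIV b = 1" "b * w = x * w' + j" "w' \<in> ?P" "j \<in> J"
      by (auto elim!: unit_satE)
    then have bj: "b * w - x * w' \<in> J" by simp
    have "p * w' \<in> ?s J" if p: "p \<in> ?P" "p * u \<in> ?s J" for p
    proof -
      obtain c where c: "c \<in> ?P" "kill UNIV c = 1" "c * (p * w) \<in> J"
        using wp[OF p] by (auto elim: unit_satE)
      have "b * (c * (p * w)) - (c * p) * j \<in> J"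
        using rel_idealD(4)[OF J b(1) c(3)] rel_idealD(4)[OF J _ b(5), of "c * p"] c(1) p(1)
        by (intro rel_ideal_diff[OF J]) auto
      moreover have "b * (c * (p * w)) = (c * p) * (b * w)" by (simp add: mult_ac)
      ultimately have "x * (c * (p * w')) \<in> J" unfolding b(3) by (simp add: algebra_simps)
      moreover have "c * (p * w') \<in> ?P" using c(1) p(1) b(4) by auto
      ultimately have "c * (p * w') \<in> J" by (rule xJ[rotated])
      then show ?thesis using c p b(4) by (intro unit_satI[of _ _ c]) auto
    qed
    moreover have "w' \<notin> ?s J"
    proof
      assume "w' \<in> ?s J"
      then obtain c where c: "c \<in> ?P" "kill UNIV c = 1" "c * w' \<in> J" by (rule unit_satE)
      have "x * (c * w') + c * j \<in> J"
        using rel_idealD(4)[OF J x(1) c(3)] rel_idealD(4)[OF J c(1) b(5)] by (rule rel_idealD(3)[OF J])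
      then have "(c * b) * w \<in> J" by (simp add: mult.assoc b(3)) (simp add: algebra_simps)
      then show False using wJ wP b c by (auto intro: unit_satI[of _ _ "c * b"])
    qed
    ultimately have "w' \<in> N" using b(4) by (simp add: N_def)
    then show ?thesis using b(1,2) bj by blast
  qed
  have "\<exists>f :: nat \<Rightarrow> _. \<forall>i. f i \<in> N \<and> (\<exists>b\<in>?P. kill UNIV b = 1 \<and> b * f i - x * f (Suc i) \<in> J)"
  proof (rule dependent_nat_choice)
    show "\<exists>w. w \<in> N" using u by (auto simp: N_def)
  qed (use step in blast)
  then obtain w where w: "\<And>i. w i \<in> N"
    and "\<And>i. \<exists>b\<in>?P. kill UNIV b = 1 \<and> b * w i - x * w (Suc i) \<in> J" by metis
  then obtain b where b: "\<And>i. b i \<in> ?P" "\<And>i. kill UNIV (b i) = 1"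
    "\<And>i. b i * w i - x * w (Suc i) \<in> J" by metis
  have wP: "w i \<in> ?P" for i using w by (auto simp: N_def)
  define F where "F i = ?s (lin_sum ?P J [w i])" for i
  have L: "rel_ideal ?P (lin_sum ?P J [w i])" for i using rel_ideal_lin_sum[OF J, of "[w i]"] wP by simp
  have "F i \<subseteq> F (Suc i)" for i
  proof
    fix p assume "p \<in> F i"
    then obtain c q j where c: "p \<in> ?P" "c \<in> ?P" "kill UNIV c = 1" "c * p = w i * q + j" "q \<in> ?P" "j \<in> J"
      by (auto simp: F_def elim!: unit_satE)
    have "q * (b i * w i - x * w (Suc i)) + b i * j \<in> J"
      using rel_idealD(4)[OF J c(5) b(3)] rel_idealD(4)[OF J b(1) c(6)] by (rule rel_idealD(3)[OF J])
    moreover have "b i * (c * p) = w (Suc i) * (x * q) + (q * (b i * w i - x * w (Suc i)) + b i * j)"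
      unfolding c(4) by (simp add: algebra_simps)
    ultimately have "(b i * c) * p \<in> lin_sum ?P J [w (Suc i)]"
      using x(1) c(5) unfolding lin_sum.simps mem_Collect_eq mult.assoc by blast
    then show "p \<in> F (Suc i)" unfolding F_def using b c by (intro unit_satI[of _ _ "b i * c"]) auto
  qed
  moreover have "rel_ideal ?P (F i)" for i unfolding F_def by (rule rel_ideal_unit_sat[OF L])
  ultimately obtain i where "F (Suc i) = F i" using polys_over_acc[OF V, of F] by blast
  moreover have "w (Suc i) \<in> F (Suc i)"
  proof -
    have "w (Suc i) = w (Suc i) * 1 + 0" by simp
    then have "1 * w (Suc i) \<in> lin_sum ?P J [w (Suc i)]"
      using rel_idealD(2)[OF J] unfolding lin_sum.simps mem_Collect_eq mult_1 by blast
    then show ?thesis unfolding F_def using wP by (intro unit_satI[of _ _ 1]) auto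
  qed
  ultimately have "w (Suc i) \<in> ?s (lin_sum ?P J [w i])" by (simp add: F_def)
  then obtain c q j where c: "c \<in> ?P" "kill UNIV c = 1" "c * w (Suc i) = w i * q + j" "q \<in> ?P" "j \<in> J"
    by (auto elim!: unit_satE)
  have "q * (b i * w i - x * w (Suc i)) + b i * j \<in> J"
    using rel_idealD(4)[OF J c(4) b(3)] rel_idealD(4)[OF J b(1) c(5)] by (rule rel_idealD(3)[OF J])
  \<comment> \<open>Since \<open>x\<close> has constant term zero, \<open>b i * c - q * x\<close>
    has constant term 1; that it annihilates \<open>w (Suc i)\<close> modulo \<open>J\<close>
    contradicts survival at the origin.\<close>
  moreover have "(b i * c - q * x) * w (Suc i) = b i * (c * w (Suc i)) - q * x * w (Suc i)"
    by (simp add: algebra_simps)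
  moreover have "\<dots> = q * (b i * w i - x * w (Suc i)) + b i * j"
    unfolding c(3) by (simp add: algebra_simps)
  ultimately have "(b i * c - q * x) * w (Suc i) \<in> J" by simp
  then have "w (Suc i) \<in> ?s J"
    using b c x wP by (intro unit_satI[of _ _ "b i * c - q * x"]) auto
  then show False using w[of "Suc i"] by (simp add: N_def)
qed

lemma rel_ideal_colon:
  assumes J: "rel_ideal (polys_over V) J"
  shows "rel_ideal (polys_over V) {p \<in> polys_over V. p * u \<in> J}"
  unfolding rel_ideal_def using rel_idealD[OF J] by (auto simp: distrib_right mult.assoc)

text \<open>\<open>u\<close> is exchanged for an element \<open>w\<close> that survives modulo
  \<open>x\<close> as well and whose annihilator is at least as large. The annihilator of
  \<open>w\<close> modulo \<open>J + (x)\<close> contains \<open>x\<close>, and \<open>x\<close>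
  cancels in the annihilator of \<open>u\<close> modulo \<open>J\<close>: this is what
  \<open>alg_indep_Cons\<close> requires.\<close>

lemma regular_imp_alg_indep:
  fixes J :: "(('v::linorder \<Rightarrow>\<^sub>0 nat) \<Rightarrow>\<^sub>0 'k::field) set"
  assumes V: "finite V"
  shows "rel_ideal (polys_over V) J \<Longrightarrow> set xs \<subseteq> polys_over V \<Longrightarrow> (\<And>x. x \<in> set xs \<Longrightarrow> kill UNIV x = 0) \<Longrightarrow>
    (\<And>i p. i < length xs \<Longrightarrow> p \<in> polys_over V \<Longrightarrow> xs ! i * p \<in> lin_sum (polys_over V) J (take i xs) \<Longrightarrow>
      p \<in> lin_sum (polys_over V) J (take i xs)) \<Longrightarrow>
    u \<in> polys_over V \<Longrightarrow> u \<notin> unit_sat (polys_over V) J \<Longrightarrow>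
    alg_indep {p \<in> polys_over V. p * u \<in> unit_sat (polys_over V) J} xs"
proof (induction xs arbitrary: J u)
  case Nil
  then show ?case
    using alg_indep_Nil[OF rel_ideal_colon[OF rel_ideal_unit_sat(1)[OF Nil(1)]], of u] by simp
next
  case (Cons x xs)
  let ?P = "polys_over V :: (('v \<Rightarrow>\<^sub>0 nat) \<Rightarrow>\<^sub>0 'k) set"
  let ?J1 = "lin_sum ?P J [x]"
  have J: "rel_ideal ?P J" and x: "x \<in> ?P" "kill UNIV x = 0" using Cons.prems by auto
  have J1: "rel_ideal ?P ?J1" "J \<subseteq> ?J1" using rel_ideal_lin_sum[OF J, of "[x]"] x(1) by simp_all
  have xJ: "p \<in> J" if "p \<in> ?P" "x * p \<in> J" for p using Cons.prems(4)[of 0 p] that by simp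
  obtain w where w: "w \<in> ?P" "w \<notin> unit_sat ?P ?J1"
    and wu: "\<And>p. p \<in> ?P \<Longrightarrow> p * u \<in> unit_sat ?P J \<Longrightarrow> p * w \<in> unit_sat ?P J"
    using exists_not_divisible[OF V J x xJ Cons.prems(5,6)] by blast
  have "p \<in> lin_sum ?P ?J1 (take i xs)"
    if "i < length xs" "p \<in> ?P" "xs ! i * p \<in> lin_sum ?P ?J1 (take i xs)" for i p
    using Cons.prems(4)[of "Suc i" p] that unfolding lin_sum_shift[symmetric] by (simp del: lin_sum.simps)
  then have ind: "alg_indep {p \<in> ?P. p * w \<in> unit_sat ?P ?J1} xs"
    using Cons.prems w by (intro Cons.IH[OF J1(1)]) auto
  have sat_mono: "unit_sat ?P J \<subseteq> unit_sat ?P ?J1" using J1(2) unfolding unit_sat_def by blast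
  show ?case
  proof (rule alg_indep_Cons[OF _ _ _ _ _ _ ind])
    show "rel_ideal ?P {p \<in> ?P. p * u \<in> unit_sat ?P J}" "rel_ideal ?P {p \<in> ?P. p * w \<in> unit_sat ?P ?J1}"
      by (intro rel_ideal_colon rel_ideal_unit_sat J J1)+
    show "{p \<in> ?P. p * u \<in> unit_sat ?P J} \<subseteq> {p \<in> ?P. p * w \<in> unit_sat ?P ?J1}"
      using wu sat_mono by blast
    have "x * w + 0 \<in> ?J1" using w(1) rel_idealD(2)[OF J] unfolding lin_sum.simps mem_Collect_eq by blast
    then show "x \<in> {p \<in> ?P. p * w \<in> unit_sat ?P ?J1}"
      using x rel_ideal_unit_sat(2)[OF J1(1)] by auto
    show "set xs \<subseteq> ?P" using Cons.prems by simp
    fix p assume p: "p \<in> ?P" "x * p \<in> {p \<in> ?P. p * u \<in> unit_sat ?P J}"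
    then obtain b where b: "b \<in> ?P" "kill UNIV b = 1" "b * (x * p * u) \<in> J" by (auto elim: unit_satE)
    then have "x * (b * (p * u)) \<in> J" by (simp add: mult_ac)
    moreover have "b * (p * u) \<in> ?P" using b(1) p(1) Cons.prems(5) by auto
    ultimately have "b * (p * u) \<in> J" by (rule xJ[rotated])
    then show "p \<in> {p \<in> ?P. p * u \<in> unit_sat ?P J}"
      using p(1) b Cons.prems(5) by (auto intro!: unit_satI[of _ _ b])
  qed
qed

subsection \<open>Counting monomials\<close>

interpretation kvs: vector_space "\<lambda>c p. const c * (p :: ('v \<Rightarrow>\<^sub>0 nat) \<Rightarrow>\<^sub>0 'k::field)"
  by standard (simp_all add: algebra_simps)

definition bounded_polys :: "'v set \<Rightarrow> nat \<Rightarrow> (('v \<Rightarrow>\<^sub>0 nat) \<Rightarrow>\<^sub>0 'k::field) set"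
  where "bounded_polys D N = {p. \<forall>m\<in>Poly_Mapping.keys p. Poly_Mapping.keys m \<subseteq> D \<and> wdeg (\<lambda>_. 1) m \<le> N}"

lemma bounded_polys_mono: "p \<in> bounded_polys D N \<Longrightarrow> N \<le> M \<Longrightarrow> p \<in> bounded_polys D M"
  by (force simp: bounded_polys_def)

lemma polys_over_mono: "V \<subseteq> W \<Longrightarrow> polys_over V \<subseteq> polys_over W"
  by (auto simp: polys_over_def)

lemma bounded_polys_subset: "bounded_polys D N \<subseteq> polys_over D"
  by (auto simp: bounded_polys_def polys_over_def)

lemma bounded_polys_add: "p \<in> bounded_polys D N \<Longrightarrow> q \<in> bounded_polys D N \<Longrightarrow> p + q \<in> bounded_polys D N"
  unfolding bounded_polys_def using Poly_Mapping.keys_add[of p q] by blast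

lemma bounded_polys_mult:
  assumes "p \<in> bounded_polys D N" "q \<in> bounded_polys D M"
  shows "p * q \<in> bounded_polys D (N + M)"
  unfolding bounded_polys_def
proof (intro CollectI ballI)
  fix m assume "m \<in> Poly_Mapping.keys (p * q)"
  then obtain a b where m: "m = a + b" "a \<in> Poly_Mapping.keys p" "b \<in> Poly_Mapping.keys q"
    using keys_mult[of p q] by blast
  then have "Poly_Mapping.keys a \<subseteq> D" "Poly_Mapping.keys b \<subseteq> D" "wdeg (\<lambda>_. 1) a \<le> N" "wdeg (\<lambda>_. 1) b \<le> M"
    using assms by (auto simp: bounded_polys_def)
  then show "Poly_Mapping.keys m \<subseteq> D \<and> wdeg (\<lambda>_. 1) m \<le> N + M"
    using m(1) Poly_Mapping.keys_add[of a b] by auto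
qed

lemma bounded_polys_const: "const c \<in> bounded_polys D 0"
  by (simp add: bounded_polys_def const_def)

lemma bounded_polys_indet: "v \<in> D \<Longrightarrow> indet v \<in> bounded_polys D 1"
  by (simp add: bounded_polys_def indet_def)

lemma bounded_polys_prod:
  "finite A \<Longrightarrow> (\<And>a. a \<in> A \<Longrightarrow> g a \<in> D) \<Longrightarrow> (\<Prod>a\<in>A. indet (g a)) \<in> bounded_polys D (card A)"
proof (induction A rule: finite_induct)
  case empty then show ?case using bounded_polys_const[of 1 D] by simp
next
  case (insert a A)
  then show ?case using bounded_polys_mult[OF bounded_polys_indet[of "g a" D], of _ "card A"] by simp
qed

lemma card_bounded_monomials:
  fixes D :: "'v set" and N :: nat
  assumes "finite D"
  defines "M \<equiv> {m :: 'v \<Rightarrow>\<^sub>0 nat. Poly_Mapping.keys m \<subseteq> D \<and> wdeg (\<lambda>_. 1) m \<le> N}"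
  shows "finite M" "card M \<le> (N + 1) ^ card D"
proof -
  let ?r = "\<lambda>m. restrict (lookup m) D"
  have inj: "inj_on ?r M"
  proof (rule inj_onI)
    fix m m' assume mm: "m \<in> M" "m' \<in> M" "?r m = ?r m'"
    show "m = m'"
    proof (rule poly_mapping_eqI)
      fix v show "lookup m v = lookup m' v"
      proof (cases "v \<in> D")
        case True
        then show ?thesis using fun_cong[OF mm(3), of v] by (simp only: restrict_apply if_True)
      next
        case False
        then have "v \<notin> Poly_Mapping.keys m" "v \<notin> Poly_Mapping.keys m'" using mm by (auto simp: M_def)
        then show ?thesis by (simp add: in_keys_iff)
      qed
    qed
  qed
  have "lookup m v \<le> N" if "m \<in> M" for m v
  proof (cases "v \<in> Poly_Mapping.keys m")
    case True
    then have "lookup m v \<le> wdeg (\<lambda>_. 1) m"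
      unfolding wdeg_def using member_le_sum[of v "Poly_Mapping.keys m" "lookup m"] by simp
    then show ?thesis using that by (simp add: M_def)
  qed (simp add: in_keys_iff)
  then have im: "?r ` M \<subseteq> PiE D (\<lambda>_. {..N})" by auto
  have fin: "finite (PiE D (\<lambda>_. {..N}))" using assms(1) by (intro finite_PiE) auto
  then show "finite M" using im inj finite_imageD finite_subset by blast
  have "card M = card (?r ` M)" using inj by (simp add: card_image)
  also have "\<dots> \<le> card (PiE D (\<lambda>_. {..N}))" by (rule card_mono[OF fin im])
  also have "\<dots> = (N + 1) ^ card D" using assms(1) by (simp add: card_PiE)
  finally show "card M \<le> (N + 1) ^ card D" .
qed

text \<open>Over the field, the independent family lies in the span of the monomials in
  \<open>D\<close> of degree at most \<open>N\<close>, whose exponents are all at most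
  \<open>N\<close>. The crude count is enough, since only the order of growth in \<open>N\<close>
  matters.\<close>

lemma card_lin_indep_le:
  fixes s :: "'a \<Rightarrow> ('v \<Rightarrow>\<^sub>0 nat) \<Rightarrow>\<^sub>0 'k::field"
  assumes D: "finite D" and A: "finite A" and s: "\<And>a. a \<in> A \<Longrightarrow> s a \<in> bounded_polys D N"
    and ind: "\<And>c a. (\<Sum>a\<in>A. const (c a) * s a) = 0 \<Longrightarrow> a \<in> A \<Longrightarrow> c a = 0"
  shows "card A \<le> (N + 1) ^ card D"
proof -
  define M where "M = {m :: 'v \<Rightarrow>\<^sub>0 nat. Poly_Mapping.keys m \<subseteq> D \<and> wdeg (\<lambda>_. 1) m \<le> N}"
  have finM: "finite M" unfolding M_def by (rule card_bounded_monomials(1)[OF D])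
  have inj: "inj_on s A"
  proof (rule inj_onI, rule ccontr)
    fix a b assume ab: "a \<in> A" "b \<in> A" "s a = s b" "a \<noteq> b"
    define c where "c x = (if x = a then 1 else 0) - (if x = b then 1 else (0 :: 'k))" for x
    have "const (c x) * s x = (if x = a then s x else 0) - (if x = b then s x else 0)" for x
      using ab(4) by (auto simp: c_def)
    then have "(\<Sum>x\<in>A. const (c x) * s x) = s a - s b"
      using A ab(1,2) by (simp add: sum_subtractf)
    then have "c a = 0" using ind ab by simp
    then show False using ab(4) by (simp add: c_def)
  qed
  have "False" if "v \<in> A" "u (s v) \<noteq> 0" "(\<Sum>x\<in>A. const (u (s x)) * s x) = 0" for u v
    using ind[of "\<lambda>x. u (s x)" v] that by simp
  then have "kvs.independent (s ` A)"
    unfolding kvs.dependent_finite[OF finite_imageI[OF A]] sum.reindex[OF inj]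
    by (auto simp: comp_def)
  moreover have "s ` A \<subseteq> kvs.span ((\<lambda>m. Poly_Mapping.single m 1) ` M)"
  proof clarify
    fix a assume "a \<in> A"
    have "(\<Sum>m\<in>Poly_Mapping.keys (s a). const (lookup (s a) m) * Poly_Mapping.single m 1)
        \<in> kvs.span ((\<lambda>m. Poly_Mapping.single m 1) ` M)"
      using s[OF \<open>a \<in> A\<close>]
      by (intro kvs.span_sum kvs.span_scale kvs.span_base) (auto simp: M_def bounded_polys_def)
    then show "s a \<in> kvs.span ((\<lambda>m. Poly_Mapping.single m 1) ` M)"
      by (simp add: single_eq_const_mult[symmetric] poly_mapping_sum_single[symmetric])
  qed
  ultimately have "card (s ` A) \<le> card ((\<lambda>m. Poly_Mapping.single m (1 :: 'k)) ` M)"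
    using kvs.independent_span_bound[OF finite_imageI[OF finM]] by blast
  also have "\<dots> \<le> card M" using card_bounded_monomials(1)[OF D, of N] by (simp add: M_def card_image_le)
  also have "\<dots> \<le> (N + 1) ^ card D" using card_bounded_monomials(2)[OF D, of N] by (simp add: M_def)
  finally show ?thesis using inj by (simp add: card_image)
qed

section \<open>Bounding independent families modulo a prime\<close>

definition rel_prime :: "'a::comm_ring_1 set \<Rightarrow> 'a set \<Rightarrow> bool"
  where "rel_prime R P \<longleftrightarrow> rel_ideal R P \<and> 1 \<notin> P \<and> (\<forall>p\<in>R. \<forall>q\<in>R. p * q \<in> P \<longrightarrow> p \<in> P \<or> q \<in> P)"

lemma rel_prime_kernel: "rel_prime (polys_over V) {p \<in> polys_over V. subst f p = (0 :: 'k::field xypoly)}"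
  unfolding rel_prime_def rel_ideal_def by auto

lemma rel_prime_prod:
  assumes "rel_prime (polys_over V) P"
  shows "finite A \<Longrightarrow> (\<And>a. a \<in> A \<Longrightarrow> g a \<in> polys_over V \<and> g a \<notin> P) \<Longrightarrow>
    (\<Prod>a\<in>A. g a) \<in> polys_over V \<and> (\<Prod>a\<in>A. g a) \<notin> P"
proof (induction A rule: finite_induct)
  case (insert a A)
  then show ?case using assms by (auto simp: rel_prime_def)
qed (use assms in \<open>auto simp: rel_prime_def\<close>)

lemma pow_bound:
  assumes "\<And>M::nat. 0 < M \<Longrightarrow> M ^ r \<le> (K * M + 1) ^ d"
  shows "r \<le> d"
proof (rule ccontr)
  assume "\<not> r \<le> d"
  \<comment> \<open>From \<open>K M + 1 \<le> (K + 1) M\<close> the assumption would give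
    \<open>M \<le> (K + 1) ^ d\<close>; this \<open>M\<close> is the first one for which that
    fails.\<close>
  define M where "M = (K + 1) ^ d + 1"
  have M: "0 < M" by (simp add: M_def)
  have "M ^ (d + 1) \<le> M ^ r" using \<open>\<not> r \<le> d\<close> M by (intro power_increasing) auto
  also have "\<dots> \<le> (K * M + 1) ^ d" by (rule assms[OF M])
  also have "\<dots> \<le> ((K + 1) * M) ^ d" using M by (intro power_mono) (auto simp: algebra_simps)
  also have "\<dots> = (K + 1) ^ d * M ^ d" by (rule power_mult_distrib)
  finally have "M * M ^ d \<le> (K + 1) ^ d * M ^ d" by simp
  then have "M \<le> (K + 1) ^ d" using M by simp
  then show False by (simp add: M_def)
qed

text \<open>Modulo the prime \<open>P\<close> the columns in \<open>U\<close> are nonzero, and each is proportional to a column in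
  \<open>C\<close>. Hence, after multiplication by a power of \<open>f\<close>, which is a product of nonzero entries of the
  columns in \<open>C\<close>, everything is a polynomial in one entry per column of \<open>U\<close> and both entries of the
  columns in \<open>C\<close>.\<close>

lemma alg_indep_length_le:
  fixes P :: "'k::field xypoly set"
  assumes P: "rel_prime (polys_over (xyvars n)) P"
    and U: "U = {i \<in> {1..n}. indet (Xvar i) \<notin> P \<or> indet (Yvar i) \<notin> P}"
    and C: "C \<subseteq> U" and cover: "\<And>i. i \<in> U \<Longrightarrow> \<exists>c\<in>C. minor c i \<in> P"
    and xs: "set xs \<subseteq> polys_over (xyvars n)" and ind: "alg_indep P xs"
  shows "length xs \<le> card U + card C"
proof -
  let ?R = "polys_over (xyvars n) :: 'k xypoly set"
  have I: "rel_ideal ?R P" and prime: "\<And>p q. p \<in> ?R \<Longrightarrow> q \<in> ?R \<Longrightarrow> p * q \<in> P \<Longrightarrow> p \<in> P \<or> q \<in> P"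
    using P by (auto simp: rel_prime_def)
  have fin: "finite U" "finite C" using finite_subset[OF C] by (simp_all add: U)
  define \<rho> where "\<rho> i = (if i \<in> C then i else SOME c. c \<in> C \<and> minor c i \<in> P)" for i
  have \<rho>: "\<rho> i \<in> C" "minor (\<rho> i) i \<in> P" if "i \<in> U" for i
    using someI_ex[of "\<lambda>c. c \<in> C \<and> minor c i \<in> P"] cover[OF that] rel_idealD(2)[OF I]
    by (auto simp: \<rho>_def)
  \<comment> \<open>\<open>L i\<close> is the entry of column \<open>i\<close> in the row where its
    representative \<open>\<rho> i\<close> is nonzero, and \<open>L' i\<close> is the other entry.
    By proportionality \<open>L' i\<close> is the quotient of \<open>L i * L' (\<rho> i)\<close> by
    \<open>L (\<rho> i)\<close>.\<close>
  define L where "L i = (if indet (Xvar (\<rho> i)) \<notin> P then Xvar i else Yvar i)" for i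
  define L' where "L' i = (if indet (Xvar (\<rho> i)) \<notin> P then Yvar i else Xvar i)" for i
  have LC: "indet (L c) \<notin> P" if "c \<in> C" for c using that C U by (auto simp: L_def \<rho>_def)
  have \<rho>\<rho>: "\<rho> (\<rho> i) = \<rho> i" if "i \<in> U" for i using \<rho>(1)[OF that] by (simp add: \<rho>_def)
  have rel: "indet (L (\<rho> i)) * indet (L' i) - indet (L i) * indet (L' (\<rho> i)) \<in> P" if "i \<in> U" for i
    using \<rho>(2)[OF that] rel_ideal_diff[OF I rel_idealD(2)[OF I] \<rho>(2)[OF that]]
    by (auto simp: L_def L'_def \<rho>\<rho>[OF that] minor_def mult.commute)
  define D where "D = L ` U \<union> L' ` C"
  have LV: "L i \<in> xyvars n" "L' i \<in> xyvars n" if "i \<in> U" for i using that U by (auto simp: L_def L'_def)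
  have DV: "D \<subseteq> xyvars n" using LV C by (auto simp: D_def)
  have finD: "finite D" using fin by (simp add: D_def)
  have cardD: "card D \<le> card U + card C"
    unfolding D_def using fin by (meson add_mono card_Un_le card_image_le order_trans)
  have BR: "p \<in> ?R" if "p \<in> bounded_polys D N" for p N
    using that bounded_polys_subset[of D N] polys_over_mono[OF DV] by blast
  \<comment> \<open>Multiplication by \<open>f\<close> gives a variable the degree
    \<open>card C + 1\<close>. For an entry \<open>L' i\<close> to be eliminated, one factor of
    \<open>f\<close> and \<open>L' i\<close> are exchanged for two variables of \<open>D\<close>,
    and the degree is the same.\<close>
  define q where "q = card C + 1"
  define f where "f = (\<Prod>c\<in>C. indet (L c) :: 'k xypoly)"
  have fB: "f \<in> bounded_polys D (card C)"
    unfolding f_def using fin C by (intro bounded_polys_prod) (auto simp: D_def)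
  have fq: "f \<in> bounded_polys D q" using bounded_polys_mono[OF fB, of q] by (simp add: q_def)
  have fR: "f \<in> ?R" and fP: "f \<notin> P"
  proof -
    have "indet (L c) \<in> ?R \<and> indet (L c) \<notin> P" if "c \<in> C" for c
      using LC[OF that] LV(1)[of c] that C by (blast intro: polys_over_closed(4))
    from rel_prime_prod[OF P fin(2) this] show "f \<in> ?R" "f \<notin> P" unfolding f_def by simp_all
  qed
  define T where "T N = {p \<in> ?R. \<exists>s\<in>bounded_polys D (q * N). f ^ N * p - s \<in> P}" for N
  have T_indet: "indet w \<in> T 1" if w: "w \<in> xyvars n" for w
  proof -
    have "\<exists>s\<in>bounded_polys D q. f * indet w - s \<in> P"
    proof (cases "w \<in> L ` U \<union> L' ` U")
      case True
      then obtain i where i: "i \<in> U" "w = L i \<or> w = L' i" by blast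
      show ?thesis
      proof (cases "w = L i")
        case True
        have "f * indet w \<in> bounded_polys D q"
          unfolding q_def using True i fB by (intro bounded_polys_mult bounded_polys_indet) (auto simp: D_def)
        then show ?thesis using rel_idealD(2)[OF I] by (intro bexI[of _ "f * indet w"]) auto
      next
        case False
        define f' where "f' = (\<Prod>c\<in>C - {\<rho> i}. indet (L c) :: 'k xypoly)"
        have c: "\<rho> i \<in> C" using \<rho>(1) i by blast
        have ff': "f = indet (L (\<rho> i)) * f'"
          unfolding f_def f'_def using fin(2) c by (rule prod.remove)
        have f'B: "f' \<in> bounded_polys D (card (C - {\<rho> i}))"
          unfolding f'_def using fin C by (intro bounded_polys_prod) (auto simp: D_def)
        have "f' * (indet (L i) * indet (L' (\<rho> i))) \<in> bounded_polys D (card (C - {\<rho> i}) + (1 + 1))"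
          using i c f'B by (intro bounded_polys_mult bounded_polys_indet) (auto simp: D_def)
        moreover have "card (C - {\<rho> i}) + (1 + 1) = q"
          using c fin(2) card_gt_0_iff[of C] by (auto simp: q_def card_Diff_singleton)
        moreover have "f' * (indet (L (\<rho> i)) * indet (L' i) - indet (L i) * indet (L' (\<rho> i))) \<in> P"
          using rel i BR[OF f'B] by (intro rel_idealD(4)[OF I]) auto
        then have "f * indet w - f' * (indet (L i) * indet (L' (\<rho> i))) \<in> P"
          using False i by (simp add: ff' algebra_simps)
        ultimately show ?thesis by auto
      qed
    next
      case False
      have "indet w \<in> P"
      proof (rule ccontr)
        assume "indet w \<notin> P"
        moreover obtain i where "i \<in> {1..n}" "w = Xvar i \<or> w = Yvar i" using w by blast
        ultimately have "i \<in> U" "w = L i \<or> w = L' i" using U by (auto simp: L_def L'_def)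
        then show False using False by blast
      qed
      then have "f * indet w - 0 \<in> P" using rel_idealD(4)[OF I fR] by simp
      moreover have "0 \<in> bounded_polys D q" by (simp add: bounded_polys_def)
      ultimately show ?thesis by blast
    qed
    then show ?thesis using w by (auto simp: T_def)
  qed
  have T_Suc: "T N \<subseteq> T (Suc N)" for N
  proof
    fix p assume "p \<in> T N"
    then obtain s where s: "p \<in> ?R" "s \<in> bounded_polys D (q * N)" "f ^ N * p - s \<in> P" by (auto simp: T_def)
    have "f * (f ^ N * p - s) \<in> P" by (rule rel_idealD(4)[OF I fR s(3)])
    then have "f ^ Suc N * p - f * s \<in> P" by (simp add: algebra_simps)
    moreover have "f * s \<in> bounded_polys D (q * Suc N)"
      using bounded_polys_mult[OF fq s(2)] by simp
    ultimately show "p \<in> T (Suc N)" using s(1) unfolding T_def by blast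
  qed
  have T_mono: "p \<in> T M" if "p \<in> T N" "N \<le> M" for p N M
    using that lift_Suc_mono_le[of T N M] T_Suc by blast
  have T_add: "p + p' \<in> T N" if p: "p \<in> T N" "p' \<in> T N" for p p' N
  proof -
    obtain s s' where s: "p \<in> ?R" "s \<in> bounded_polys D (q * N)" "f ^ N * p - s \<in> P"
      "p' \<in> ?R" "s' \<in> bounded_polys D (q * N)" "f ^ N * p' - s' \<in> P" using p by (auto simp: T_def)
    have "f ^ N * (p + p') - (s + s') \<in> P"
      using rel_idealD(3)[OF I s(3,6)] by (simp add: algebra_simps)
    then show ?thesis using s bounded_polys_add[OF s(2,5)] unfolding T_def by blast
  qed
  have T_mult: "p * p' \<in> T (N + M)" if p: "p \<in> T N" "p' \<in> T M" for p p' N M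
  proof -
    obtain s s' where s: "p \<in> ?R" "s \<in> bounded_polys D (q * N)" "f ^ N * p - s \<in> P"
      "p' \<in> ?R" "s' \<in> bounded_polys D (q * M)" "f ^ M * p' - s' \<in> P" using p by (auto simp: T_def)
    have "f ^ N * p \<in> ?R" using fR s(1) by auto
    from rel_idealD(3)[OF I rel_idealD(4)[OF I this s(6)] rel_idealD(4)[OF I BR[OF s(5)] s(3)]]
    have "f ^ (N + M) * (p * p') - s * s' \<in> P" by (simp add: algebra_simps power_add)
    moreover have "s * s' \<in> bounded_polys D (q * (N + M))"
      using bounded_polys_mult[OF s(2,5)] by (simp add: distrib_left)
    ultimately show ?thesis using s(1,4) unfolding T_def by blast
  qed
  have T_const: "const c \<in> T 0" for c
    using rel_idealD(2)[OF I] bounded_polys_const[of c D] by (auto simp: T_def intro!: bexI[of _ "const c"])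
  have T_ex: "\<exists>N. p \<in> T N" if "p \<in> ?R" for p
    using that
  proof (induction p rule: polys_over_induct)
    case (add p p')
    then obtain N M where "p \<in> T N" "p' \<in> T M" by blast
    then have "p + p' \<in> T (max N M)" by (intro T_add) (auto intro: T_mono)
    then show ?case by blast
  qed (use T_const T_indet T_mult in blast)+
  then obtain e where e: "\<And>p. p \<in> set xs \<Longrightarrow> p \<in> T (e p)" using xs by (metis subsetD)
  define E where "E = sum_list (map e xs)"
  have eE: "x \<in> T E" if "x \<in> set xs" for x
    using T_mono[OF e[OF that]] member_le_sum_list[of "e x" "map e xs"] that by (simp add: E_def)
  have T_pow: "x ^ k \<in> T (E * k)" if "x \<in> T E" for x k
    using T_const[of 1] T_mult[OF that] by (induction k) auto
  have T_lm: "set ys \<subseteq> T E \<Longrightarrow> list_monom ys a \<in> T (E * sum_list a)" for ys a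
  proof (induction ys a rule: list_monom.induct)
    case (1 y ys k a)
    then have "y ^ k * list_monom ys a \<in> T (E * k + E * sum_list a)" by (intro T_mult T_pow) auto
    then show ?case by (simp add: distrib_left)
  qed (use T_const[of 1] T_mono in auto)
  define r where "r = length xs"
  \<comment> \<open>The \<open>M ^ r\<close> monomials with exponents below \<open>M\<close> stay
    independent modulo \<open>P\<close> after multiplication by a power of \<open>f\<close>, and are
    then represented by polynomials in \<open>D\<close> of degree linear in \<open>M\<close>. The
    growth in \<open>M\<close> compares \<open>r\<close> with \<open>card D\<close>.\<close>
  have "M ^ r \<le> (q * E * r * M + 1) ^ card D" for M
  proof -
    define A where "A = {a :: nat list. set a \<subseteq> {..<M} \<and> length a = r}"
    have A: "finite A" "card A = M ^ r"
      unfolding A_def using finite_lists_length_eq[of "{..<M}" r] card_lists_length_eq[of "{..<M}" r] by auto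
    define B where "B = E * (r * M)"
    have "list_monom xs a \<in> T B" if "a \<in> A" for a
    proof -
      have "sum_list a \<le> length a * M"
        using that sum_list_mono[of a "\<lambda>x. x" "\<lambda>_. M"] by (force simp: A_def sum_list_triv)
      then have "E * sum_list a \<le> B" using that by (simp add: A_def B_def)
      then show ?thesis using T_mono[OF T_lm] eE by blast
    qed
    then have "\<forall>a\<in>A. \<exists>s. s \<in> bounded_polys D (q * B) \<and> f ^ B * list_monom xs a - s \<in> P"
      by (auto simp: T_def)
    then obtain s where s: "\<And>a. a \<in> A \<Longrightarrow> s a \<in> bounded_polys D (q * B)"
      "\<And>a. a \<in> A \<Longrightarrow> f ^ B * list_monom xs a - s a \<in> P" by metis
    have "card A \<le> (q * B + 1) ^ card D"
    proof (rule card_lin_indep_le[OF finD A(1) s(1)])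
      fix c a assume c: "(\<Sum>a\<in>A. const (c a) * s a) = 0" "a \<in> A"
      let ?m = "\<Sum>a\<in>A. const (c a) * list_monom xs a"
      have sumP: "(\<Sum>a\<in>A'. g a) \<in> P" if "finite A'" "\<And>a. a \<in> A' \<Longrightarrow> g a \<in> P" for A' and g :: "nat list \<Rightarrow> 'k xypoly"
        using that by (induction A' rule: finite_induct) (auto intro: rel_idealD[OF I])
      have "(\<Sum>a\<in>A. const (c a) * (f ^ B * list_monom xs a - s a)) \<in> P"
        using s(2) by (intro sumP A(1) rel_idealD(4)[OF I]) auto
      moreover have "(\<Sum>a\<in>A. const (c a) * (f ^ B * list_monom xs a - s a)) = f ^ B * ?m"
        using c(1) by (simp add: right_diff_distrib sum_subtractf sum_distrib_left mult.left_commute)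
      ultimately have "f ^ B * ?m \<in> P" by simp
      moreover have mR: "?m \<in> ?R" by (intro polys_over_sum polys_over_closed polys_over_const list_monom_polys_over xs)
      moreover have "f ^ k * p \<in> P \<Longrightarrow> p \<in> ?R \<Longrightarrow> p \<in> P" for k p
      proof (induction k)
        case (Suc k)
        then have "f * (f ^ k * p) \<in> P" by (simp add: mult.assoc)
        moreover have "f ^ k * p \<in> ?R" using fR Suc.prems(2) by auto
        ultimately have "f ^ k * p \<in> P" using prime[OF fR] fP by blast
        then show ?case using Suc by blast
      qed simp
      ultimately have "?m \<in> P" by blast
      then show "c a = 0" by (rule alg_indepD[OF ind A(1) _ _ c(2), rotated]) (simp add: A_def r_def)
    qed
    then show ?thesis by (simp add: A(2) B_def mult.assoc)
  qed
  then have "r \<le> card D" by (intro pow_bound[of r "q * E * r"])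
  then show ?thesis using cardD by (simp add: r_def)
qed

subsection \<open>Krull dimension and depth\<close>

text \<open>An element of \<open>P 1\<close> outside \<open>P 0\<close> vanishes modulo
  \<open>P 1\<close> and cancels modulo the prime \<open>P 0\<close>, so it can be put in front of a
  family independent modulo \<open>P 1\<close>.\<close>

lemma alg_indep_of_chain:
  fixes P :: "nat \<Rightarrow> (('v \<Rightarrow>\<^sub>0 nat) \<Rightarrow>\<^sub>0 'k::field) set"
  shows "(\<And>i. i \<le> l \<Longrightarrow> rel_prime (polys_over V) (P i)) \<Longrightarrow> (\<And>i. i < l \<Longrightarrow> P i \<subset> P (Suc i)) \<Longrightarrow>
    \<exists>xs. length xs = l \<and> set xs \<subseteq> polys_over V \<and> alg_indep (P 0) xs"
proof (induction l arbitrary: P)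
  case 0
  then have "rel_prime (polys_over V) (P 0)" by simp
  then show ?case by (auto simp: rel_prime_def intro: alg_indep_Nil)
next
  case (Suc l)
  have prime: "rel_prime (polys_over V) (P 0)" "rel_prime (polys_over V) (P 1)" and sub: "P 0 \<subset> P 1"
    using Suc.prems(1)[of 0] Suc.prems(1)[of 1] Suc.prems(2)[of 0] by simp_all
  then have ideal: "rel_ideal (polys_over V) (P 0)" "rel_ideal (polys_over V) (P 1)"
    by (auto simp: rel_prime_def)
  obtain xs where xs: "length xs = l" "set xs \<subseteq> polys_over V" "alg_indep (P 1) xs"
    using Suc.IH[of "\<lambda>i. P (Suc i)"] Suc.prems by auto
  obtain x where x: "x \<in> P 1" "x \<notin> P 0" using sub by blast
  have xV: "x \<in> polys_over V" using x(1) rel_idealD(1)[OF ideal(2)] by blast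
  have "p \<in> P 0" if "p \<in> polys_over V" "x * p \<in> P 0" for p
    using prime(1) that x(2) xV unfolding rel_prime_def by blast
  then have "alg_indep (P 0) (x # xs)"
    using sub by (intro alg_indep_Cons[OF ideal _ x(1) _ xs(2,3)]) auto
  then show ?case using xs xV by (intro exI[of _ "x # xs"]) auto
qed

lemma rel_prime_vimage_rcosets:
  assumes J: "rel_ideal (polys_over V) J" and Q: "primeideal Q (poly_ring K V Quot J)"
  defines "P \<equiv> {p \<in> polys_over V. J +>\<^bsub>poly_ring K V\<^esub> p \<in> Q}"
  shows "rel_prime (polys_over V) P" "J \<subseteq> P"
proof -
  let ?R = "poly_ring K V" and ?P = "polys_over V" and ?h = "\<lambda>p. J +>\<^bsub>poly_ring K V\<^esub> p"
  interpret R: cring ?R by (rule cring_poly_ring)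
  interpret J: ideal J ?R using J by (simp add: ideal_poly_ring_iff)
  interpret h: ring_hom_ring ?R "?R Quot J" ?h by (rule J.rcos_ring_hom_ring)
  interpret Q: primeideal Q "?R Quot J" by (rule Q)
  have hom: "?h (p + q) = ?h p \<oplus>\<^bsub>?R Quot J\<^esub> ?h q" "?h (p * q) = ?h p \<otimes>\<^bsub>?R Quot J\<^esub> ?h q"
    "?h p \<in> carrier (?R Quot J)" if "p \<in> ?P" "q \<in> ?P" for p q
    using that h.hom_add[of p q] h.hom_mult[of p q] h.hom_closed[of p] by (simp_all add: carrier_poly_ring)
  have zero: "?h 0 \<in> Q" using h.hom_zero Q.zero_closed by simp
  have "?h j \<in> Q" if "j \<in> J" for j
  proof -
    have "?h j = ?h 0" using that rel_idealD(1)[OF J] rcoset_poly_ring_eq_iff[OF J, of j 0] by auto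
    then show ?thesis using zero by simp
  qed
  then show "J \<subseteq> P" using rel_idealD(1)[OF J] by (auto simp: P_def)
  have "1 \<notin> P"
  proof
    assume "1 \<in> P"
    then have "\<one>\<^bsub>?R Quot J\<^esub> \<in> Q" using h.hom_one by (simp add: P_def)
    then show False using Q.one_imp_carrier Q.I_notcarr by simp
  qed
  moreover have "rel_ideal ?P P"
    unfolding rel_ideal_def P_def using zero hom Q.a_closed Q.I_l_closed by auto
  moreover have "p \<in> P \<or> q \<in> P" if "p \<in> ?P" "q \<in> ?P" "p * q \<in> P" for p q
    using that hom[OF that(1,2)] hom(3)[OF that(2,1)] Q.I_prime[of "?h p" "?h q"] by (auto simp: P_def)
  ultimately show "rel_prime ?P P" by (simp add: rel_prime_def)
qed

lemma krull_chain_imp_alg_indep: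
  assumes J: "rel_ideal (polys_over V) J"
    and Q: "\<And>i. i \<le> l \<Longrightarrow> primeideal (Q i) (poly_ring K V Quot J)" "\<And>i. i < l \<Longrightarrow> Q i \<subset> Q (Suc i)"
  shows "\<exists>P xs. rel_prime (polys_over V) P \<and> J \<subseteq> P \<and> set xs \<subseteq> polys_over V \<and> alg_indep P xs \<and> length xs = l"
proof -
  define P where "P i = {p \<in> polys_over V. J +>\<^bsub>poly_ring K V\<^esub> p \<in> Q i}" for i
  have prime: "rel_prime (polys_over V) (P i)" "J \<subseteq> P i" if "i \<le> l" for i
    unfolding P_def using rel_prime_vimage_rcosets[OF J Q(1)[OF that]] by auto
  have "P i \<subset> P (Suc i)" if i: "i < l" for i
  proof -
    obtain X where X: "X \<in> Q (Suc i)" "X \<notin> Q i" using Q(2)[OF i] by blast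
    have "ideal (Q (Suc i)) (poly_ring K V Quot J)" using Q(1)[of "Suc i"] i by (simp add: primeideal.axioms(1))
    then have "X \<in> carrier (poly_ring K V Quot J)" using ideal.Icarr X(1) by fastforce
    then obtain p where "p \<in> polys_over V" "X = J +>\<^bsub>poly_ring K V\<^esub> p"
      unfolding carrier_Quot_poly_ring by blast
    then have "p \<in> P (Suc i) - P i" using X by (simp add: P_def)
    then show ?thesis using Q(2)[OF i] by (auto simp: P_def)
  qed
  then obtain xs where "length xs = l" "set xs \<subseteq> polys_over V" "alg_indep (P 0) xs"
    using alg_indep_of_chain[of l V P] prime(1) by blast
  then show ?thesis using prime[of 0] by blast
qed

lemma krull_dim_le:
  assumes J: "rel_ideal (polys_over V) J"
    and "\<And>P xs. rel_prime (polys_over V) P \<Longrightarrow> J \<subseteq> P \<Longrightarrow> set xs \<subseteq> polys_over V \<Longrightarrow> alg_indep P xs \<Longrightarrow>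
      length xs \<le> d"
  shows "krull_dim (poly_ring K V Quot J) \<le> enat d"
  unfolding krull_dim_def
proof (rule Sup_least, clarify)
  fix l Q assume Q: "\<forall>i\<le>l. primeideal (Q i) (poly_ring K V Quot J)" "\<forall>i<l. Q i \<subset> Q (Suc i)"
  obtain P xs where "rel_prime (polys_over V) P" "J \<subseteq> P" "set xs \<subseteq> polys_over V" "alg_indep P xs" "length xs = l"
    using krull_chain_imp_alg_indep[OF J, of l Q] Q by blast
  then show "enat l \<le> enat d" using assms(2) by auto
qed

text \<open>A nonempty set with finite supremum is finite and has a maximum; \<open>0 < d\<close>
  excludes the empty set, whose supremum is 0.\<close>

lemma Sup_enat_attained:
  assumes "Sup S = enat d" "0 < d"
  shows "enat d \<in> S"
proof -
  have "S \<noteq> {}" using assms by (auto simp: Sup_enat_def enat_0_iff)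
  moreover from this have "finite S" using assms(1) by (auto simp: Sup_enat_def split: if_splits)
  ultimately have "Max S \<in> S" "Sup S = Max S" by (simp_all add: Sup_enat_def)
  then show ?thesis using assms(1) by simp
qed

lemma krull_dim_attained:
  assumes J: "rel_ideal (polys_over V) J" and dim: "krull_dim (poly_ring K V Quot J) = enat d" "0 < d"
  shows "\<exists>P xs. rel_prime (polys_over V) P \<and> J \<subseteq> P \<and> set xs \<subseteq> polys_over V \<and> alg_indep P xs \<and> length xs = d"
proof -
  let ?S = "{enat l | l. \<exists>P. (\<forall>i\<le>l. primeideal (P i) (poly_ring K V Quot J)) \<and> (\<forall>i<l. P i \<subset> P (Suc i))}"
  have S: "Sup ?S = enat d" using dim(1) by (simp add: krull_dim_def)
  then have "enat d \<in> ?S" using dim(2) by (rule Sup_enat_attained)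
  then obtain Q where "\<forall>i\<le>d. primeideal (Q i) (poly_ring K V Quot J)" "\<forall>i<d. Q i \<subset> Q (Suc i)"
    by auto
  then show ?thesis using krull_chain_imp_alg_indep[OF J, of d Q] by blast
qed

lemma primeideal_image_rcosets:
  assumes J: "rel_ideal (polys_over V) J" and P: "rel_prime (polys_over V) P" "J \<subseteq> P"
  shows "primeideal ((\<lambda>p. J +>\<^bsub>poly_ring K V\<^esub> p) ` P) (poly_ring K V Quot J)"
proof -
  let ?R = "poly_ring K V" and ?h = "\<lambda>p. J +>\<^bsub>poly_ring K V\<^esub> p"
  interpret R: cring ?R by (rule cring_poly_ring)
  interpret J: ideal J ?R using J by (simp add: ideal_poly_ring_iff)
  interpret h: ring_hom_ring ?R "?R Quot J" ?h by (rule J.rcos_ring_hom_ring)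
  have I: "rel_ideal (polys_over V) P" using P(1) by (simp add: rel_prime_def)
  have mem: "?h p \<in> ?h ` P \<longleftrightarrow> p \<in> P" if "p \<in> polys_over V" for p
    by (rule rcoset_mem_image[OF J I P(2) that])
  show ?thesis
  proof (rule primeidealI)
    show "ideal (?h ` P) (?R Quot J)"
      by (rule R.ring_ideal_imp_quot_ideal[OF J.ideal_axioms]) (simp add: ideal_poly_ring_iff I)
    show "cring (?R Quot J)" by (rule J.quotient_is_cring[OF R.is_cring])
    have "?h 1 \<notin> ?h ` P" using P(1) by (subst mem) (auto simp: rel_prime_def)
    moreover have "?h 1 \<in> carrier (?R Quot J)" unfolding carrier_Quot_poly_ring by (rule imageI) auto
    ultimately show "carrier (?R Quot J) \<noteq> ?h ` P" by metis
    fix X Y assume XY: "X \<in> carrier (?R Quot J)" "Y \<in> carrier (?R Quot J)" "X \<otimes>\<^bsub>?R Quot J\<^esub> Y \<in> ?h ` P"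
    then obtain p q where pq: "p \<in> polys_over V" "q \<in> polys_over V" "X = ?h p" "Y = ?h q"
      unfolding carrier_Quot_poly_ring by blast
    then have "?h (p * q) \<in> ?h ` P"
      using XY(3) h.hom_mult[of p q] by (simp add: carrier_poly_ring)
    then have "p * q \<in> P" using mem[of "p * q"] pq by blast
    then have "p \<in> P \<or> q \<in> P" using P(1) pq(1,2) by (simp add: rel_prime_def)
    then show "X \<in> ?h ` P \<or> Y \<in> ?h ` P" using pq by blast
  qed
qed

lemma krull_dim_ge:
  assumes J: "rel_ideal (polys_over V) J"
    and P: "\<And>i. i \<le> l \<Longrightarrow> rel_prime (polys_over V) (P i)" "J \<subseteq> P 0" "\<And>i. i < l \<Longrightarrow> P i \<subset> P (Suc i)"
  shows "enat l \<le> krull_dim (poly_ring K V Quot J)"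
proof -
  let ?h = "\<lambda>p. J +>\<^bsub>poly_ring K V\<^esub> p"
  have JP: "i \<le> l \<Longrightarrow> J \<subseteq> P i" for i
  proof (induction i)
    case (Suc i) then show ?case using P(3)[of i] by auto
  qed (use P(2) in simp)
  have "?h ` P i \<subset> ?h ` P (Suc i)" if i: "i < l" for i
  proof -
    obtain p where p: "p \<in> P (Suc i)" "p \<notin> P i" using P(3)[OF i] by blast
    have I: "rel_ideal (polys_over V) (P i)" "rel_ideal (polys_over V) (P (Suc i))"
      using P(1)[of i] P(1)[of "Suc i"] i by (auto simp: rel_prime_def)
    then have "?h p \<notin> ?h ` P i"
      using rcoset_mem_image[OF J I(1) JP, of p K] p rel_idealD(1)[OF I(2)] i by auto
    then show ?thesis using p(1) P(3)[OF i] by blast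
  qed
  moreover have "primeideal (?h ` P i) (poly_ring K V Quot J)" if "i \<le> l" for i
    by (rule primeideal_image_rcosets[OF J P(1)[OF that] JP[OF that]])
  ultimately show ?thesis unfolding krull_dim_def
    by (intro Sup_upper CollectI exI[of _ l] exI[of _ "\<lambda>i. ?h ` P i"] conjI) auto
qed

text \<open>The chain consists of the kernels of \<open>\<beta>\<close> followed by setting the variables in \<open>W\<close> to
  zero one after the other.\<close>

lemma krull_dim_ge_kill:
  fixes \<beta> :: "xyvar \<Rightarrow> 'k::field xypoly" and g :: "nat \<Rightarrow> 'k xypoly"
  assumes J: "rel_ideal (polys_over V) J" "\<And>p. p \<in> J \<Longrightarrow> subst \<beta> p = 0"
    and g: "\<And>i. i < length W \<Longrightarrow> g i \<in> polys_over V"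
      "\<And>i. i < length W \<Longrightarrow> kill (set (take i W)) (subst \<beta> (g i)) \<noteq> 0"
      "\<And>i. i < length W \<Longrightarrow> kill {W ! i} (subst \<beta> (g i)) = 0"
  shows "enat (length W) \<le> krull_dim (poly_ring K V Quot J)"
proof (rule krull_dim_ge[OF J(1)])
  define P where "P i = {p \<in> polys_over V. kill (set (take i W)) (subst \<beta> p) = 0}" for i
  show "rel_prime (polys_over V) (P i)" for i
    unfolding P_def kill_def subst_subst by (rule rel_prime_kernel)
  show "J \<subseteq> P 0" using J(2) rel_idealD(1)[OF J(1)] by (auto simp: P_def)
  fix i assume i: "i < length W"
  have "set (take (Suc i) W) = {W ! i} \<union> set (take i W)" using i by (simp add: take_Suc_conv_app_nth)
  then have *: "kill (set (take (Suc i) W)) p = kill {W ! i} (kill (set (take i W)) p)"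
    "kill (set (take (Suc i) W)) p = kill (set (take i W)) (kill {W ! i} p)" for p :: "'k xypoly"
    by (simp_all only: kill_kill Un_commute)
  have "P i \<subseteq> P (Suc i)" unfolding P_def *(1) by auto
  moreover have "g i \<in> P (Suc i)" unfolding P_def *(2) using g(1,3)[OF i] by simp
  moreover have "g i \<notin> P i" using g(2)[OF i] by (simp add: P_def)
  ultimately show "P i \<subset> P (Suc i)" by blast
qed

lemma minor_polys_over:
  "i \<in> {1..n} \<Longrightarrow> j \<in> {1..n} \<Longrightarrow> minor i j \<in> polys_over (xyvars n)"
  unfolding minor_def by (intro polys_over_closed' polys_over_closed) auto

text \<open>A regular sequence is independent modulo the annihilator of \<open>u\<close>. As
  \<open>u\<close> multiplies all minors into the ideal, this annihilator contains the kernel of the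
  Segre map, modulo which a single column is proportional to all \<open>n\<close> columns: at most
  \<open>n + 1\<close> forms.\<close>

lemma depth_le:
  fixes A :: "'k::field xypoly set"
  assumes n: "1 \<le> n" and A: "A \<subseteq> polys_over (xyvars n)" "A \<subseteq> minors_ideal {1..n}"
    and u: "u \<in> polys_over (xyvars n)" "segre {1..n} u \<noteq> 0"
      "\<And>i j. i \<in> {1..n} \<Longrightarrow> j \<in> {1..n} \<Longrightarrow> u * minor i j \<in> ideal.span A"
  shows "depth (xy_ring K n) (graded_max_ideal K n)
    (quotient_module (xy_ring K n) (ideal.span A \<inter> polys_over (xyvars n))) \<le> enat (n + 1)"
  unfolding depth_def
proof (rule Sup_least, clarify)
  let ?R = "polys_over (xyvars n) :: 'k xypoly set"
  let ?J = "ideal.span A \<inter> ?R"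
  define P where "P = {p \<in> ?R. segre {1..n} p = 0}"
  fix xs assume xs: "set xs \<subseteq> graded_max_ideal K n"
    and reg: "regular_sequence (xy_ring K n) (quotient_module (xy_ring K n) ?J) xs"
  have J: "rel_ideal ?R ?J"
    by (auto simp: rel_ideal_def intro: ideal.span_zero ideal.span_add ideal.span_scale)
  have xsR: "set xs \<subseteq> ?R" and reg': "\<And>i p. i < length xs \<Longrightarrow> p \<in> ?R \<Longrightarrow>
      xs ! i * p \<in> lin_sum ?R ?J (take i xs) \<Longrightarrow> p \<in> lin_sum ?R ?J (take i xs)"
    using reg unfolding xy_ring_def regular_sequence_quotient_module[OF J] by auto
  have prime: "rel_prime ?R P" unfolding P_def segre_def by (rule rel_prime_kernel)
  have AP: "segre {1..n} p = 0" if "p \<in> ideal.span A" for p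
    using that A(2) ideal.span_minimal[OF A(2) subspace_minors_ideal] mem_minors_ideal[of "{1..n}" p] by auto
  have kill0: "kill UNIV p = 0" if "p \<in> minors_ideal {1..n}" for p :: "'k xypoly"
  proof -
    have "minors_ideal {1..n} \<subseteq> {p :: 'k xypoly. kill UNIV p = 0}"
      using kill_subspace[of "{0}" UNIV] by (intro minors_ideal_least) (auto simp: minor_def)
    then show ?thesis using that by blast
  qed
  \<comment> \<open>The Segre map has a domain as target, so \<open>b u = 0\<close> there would put
    \<open>b\<close> into the ideal of minors, where constant terms vanish.\<close>
  have "u \<notin> unit_sat ?R ?J"
  proof
    assume "u \<in> unit_sat ?R ?J"
    then obtain b where b: "kill UNIV b = 1" "b * u \<in> ?J" by (rule unit_satE)
    then have "segre {1..n} (b * u) = 0" using AP by blast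
    then have "segre {1..n} b = 0" using u(2) by (simp add: segre_def)
    then show False using b(1) kill0[of b] by (simp add: mem_minors_ideal)
  qed
  then have ind: "alg_indep {p \<in> ?R. p * u \<in> unit_sat ?R ?J} xs"
    using xs by (intro regular_imp_alg_indep[OF _ J xsR _ reg' u(1)]) (auto simp: mem_graded_max_ideal)
  have "P \<subseteq> {p \<in> ?R. p * u \<in> unit_sat ?R ?J}"
  proof
    fix p assume p: "p \<in> P"
    have "ideal.subspace {p. p * u \<in> ideal.span A}"
      by (auto simp: ideal.subspace_def distrib_right mult.assoc ideal.span_zero ideal.span_add ideal.span_scale)
    then have "minors_ideal {1..n} \<subseteq> {p. p * u \<in> ideal.span A}"
      using u(3) by (intro minors_ideal_least) (auto simp: mult.commute)
    then have "p * u \<in> ?J" using p u(1) by (auto simp: P_def mem_minors_ideal)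
    then show "p \<in> {p \<in> ?R. p * u \<in> unit_sat ?R ?J}"
      using p rel_ideal_unit_sat(2)[OF J] by (auto simp: P_def)
  qed
  then have "alg_indep P xs" by (rule alg_indep_antimono[OF ind])
  moreover have "{1..n} = {i \<in> {1..n}. indet (Xvar i) \<notin> P \<or> indet (Yvar i) \<notin> P}"
    by (auto simp: P_def segre_indet_neq_0)
  moreover have "minor 1 i \<in> P" if "i \<in> {1..n}" for i
    using that n minor_polys_over[of 1 n i] segre_minor[of 1 "{1..n}" i] by (simp add: P_def)
  ultimately have "length xs \<le> card {1..n} + card {1::nat}"
    using n xsR by (intro alg_indep_length_le[OF prime]) auto
  then show "enat (length xs) \<le> enat (n + 1)" by simp
qed

subsection \<open>Binomial edge ideals\<close>

lemma pair_graph_arcs: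
  assumes "pair_graph G" "(i, j) \<in> parcs G"
  shows "i \<in> pverts G" "j \<in> pverts G" "i \<noteq> j" "(j, i) \<in> parcs G"
proof -
  interpret pair_graph G by (rule assms(1))
  show "i \<in> pverts G" "j \<in> pverts G" "i \<noteq> j"
    using arc_fst_in_verts[OF assms(2)] arc_snd_in_verts[OF assms(2)] pair_no_loops[OF assms(2)] by auto
  show "(j, i) \<in> parcs G"
    using pair_sym_arcs assms(2) by (auto simp: symmetric_def sym_def)
qed

lemma connected_pair_graph_iff:
  assumes "pair_graph G"
  shows "connected (with_proj G) \<longleftrightarrow>
    pverts G \<noteq> {} \<and> (\<forall>u\<in>pverts G. \<forall>v\<in>pverts G. (u, v) \<in> rtrancl_on (pverts G) (parcs G))"
proof -
  have "parcs (mk_symmetric (with_proj G)) = parcs G"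
    using pair_graph_arcs(4)[OF assms] by (auto simp: parcs_mk_symmetric)
  then show ?thesis by (simp add: connected_def strongly_connected_def reachable_def)
qed

lemma connected_closed_set:
  assumes "pair_graph G" "connected (with_proj G)" and S: "u \<in> S" "\<And>i j. (i, j) \<in> parcs G \<Longrightarrow> i \<in> S \<Longrightarrow> j \<in> S"
    and "u \<in> pverts G" "v \<in> pverts G"
  shows "v \<in> S"
proof -
  have "(u, v) \<in> rtrancl_on (pverts G) (parcs G)"
    using assms connected_pair_graph_iff[OF assms(1)] by blast
  then have "u \<in> S \<longrightarrow> v \<in> S" by induction (use S(2) in auto)
  then show ?thesis using S(1) by simp
qed

definition edge_minors :: "nat pair_pre_digraph \<Rightarrow> 'k::field xypoly set"
  where "edge_minors G = {minor i j | i j. (i, j) \<in> parcs G}"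

lemma edge_minors_polys_over:
  assumes G: "pair_graph G" "pverts G = {1..n}"
  shows "edge_minors G \<subseteq> polys_over (xyvars n)"
  unfolding edge_minors_def
proof clarify
  fix i j assume "(i, j) \<in> parcs G"
  then show "minor i j \<in> polys_over (xyvars n)"
    using pair_graph_arcs(1,2)[OF G(1)] G(2) by (intro minor_polys_over) auto
qed

lemma binomial_edge_ideal_eq:
  fixes K :: "'k::field itself"
  assumes G: "pair_graph G" "pverts G = {1..n}"
  shows "binomial_edge_ideal K n G = ideal.span (edge_minors G) \<inter> polys_over (xyvars n)"
proof -
  define A where "A = {minor i j :: 'k xypoly | i j. i < j \<and> (i, j) \<in> parcs G}"
  have AE: "A \<subseteq> edge_minors G" by (auto simp: A_def edge_minors_def)
  have "minor i j \<in> ideal.span A" if "(i, j) \<in> parcs G" for i j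
  proof (cases "i < j")
    case True then show ?thesis using that by (auto simp: A_def intro: ideal.span_base)
  next
    case False
    then have "j < i" "(j, i) \<in> parcs G" using pair_graph_arcs(3,4)[OF G(1) that] by auto
    then have "minor j i \<in> ideal.span A" by (auto simp: A_def intro: ideal.span_base)
    then show ?thesis unfolding minor_commute[of i j] by (rule ideal.span_neg)
  qed
  then have "edge_minors G \<subseteq> ideal.span A" by (auto simp: edge_minors_def)
  then have "ideal.span A = ideal.span (edge_minors G)"
    using ideal.span_mono[OF AE] ideal.span_minimal[of "edge_minors G" "ideal.span A"] by auto
  moreover have "A \<subseteq> polys_over (xyvars n)" using AE edge_minors_polys_over[OF G] by blast
  ultimately show ?thesis
    unfolding binomial_edge_ideal_def xy_ring_def
    by (subst genideal_poly_ring) (simp_all add: A_def minor_def)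
qed

lemma depth_ge_graph:
  fixes K :: "'k::field itself" and xs :: "'k xypoly list"
  assumes G: "pair_graph G" "pverts G = {1..n}"
    and xs: "set xs \<subseteq> polys_over (xyvars n)" "\<And>x. x \<in> set xs \<Longrightarrow> pos_homogeneous std_wt x"
    and reg: "regular_on (ideal.span (edge_minors G)) xs"
  shows "enat (length xs) \<le> depth (xy_ring K n) (graded_max_ideal K n)
    (quotient_module (xy_ring K n) (binomial_edge_ideal K n G))"
  unfolding binomial_edge_ideal_eq[OF G]
  by (rule depth_ge[OF edge_minors_polys_over[OF G] _ xs reg]) (auto simp: edge_minors_def minor_def)

lemma span_edge_minors_star:
  assumes G: "pair_graph G" and L: "\<And>l. l \<in> L \<Longrightarrow> (v, l) \<in> parcs G" and F: "F \<subseteq> edge_minors G"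
    and E: "\<And>i j. (i, j) \<in> parcs G \<Longrightarrow>
      i = v \<and> j \<in> L \<or> j = v \<and> i \<in> L \<or> minor i j \<in> F \<or> minor j i \<in> F"
  shows "ideal.span (edge_minors G) = star_ideal v L F"
proof
  have "minor i j \<in> star_ideal v L F" if "(i, j) \<in> parcs G" for i j
  proof -
    have "minor i j \<in> star_ideal v L F \<or> minor j i \<in> star_ideal v L F"
      using E[OF that] unfolding star_ideal_def by (blast intro: ideal.span_base)
    then show ?thesis
      using ideal.subspace_neg[OF subspace_star_ideal, of "minor j i"] minor_commute[of i j] by metis
  qed
  then show "ideal.span (edge_minors G) \<subseteq> star_ideal v L F"
    by (intro ideal.span_minimal subspace_star_ideal) (auto simp: edge_minors_def)
  show "star_ideal v L F \<subseteq> ideal.span (edge_minors G)"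
    unfolding star_ideal_def using L F by (intro ideal.span_mono) (auto simp: edge_minors_def)
qed

lemma star_seq_polys_over:
  assumes "set (v # ls) \<subseteq> {1..n}" "ls \<noteq> []" "x \<in> set (star_seq v ls)"
  shows "x \<in> polys_over (xyvars n)"
proof -
  have "polys_over (Xvar ` set (v # ls) \<union> Yvar ` set (v # ls)) \<subseteq> polys_over (xyvars n)"
    using assms(1) by (intro polys_over_mono Un_mono image_mono)
  moreover have "x \<in> polys_over (Xvar ` set (v # ls) \<union> Yvar ` set (v # ls))"
  proof (cases "x \<in> set (hankel (v # ls))")
    case False
    then have "x = indet (Xvar v) + indet (Xvar (last ls))" using assms(3) by (simp add: star_seq_def)
    moreover have "last ls \<in> set ls" using assms(2) by simp
    ultimately show ?thesis by auto
  qed (rule hankel_polys_over)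
  ultimately show ?thesis by blast
qed

section \<open>Depth of connected graphs with at most one edge off a vertex\<close>

context
  fixes K :: "'k::field itself" and G :: "nat pair_pre_digraph" and n v :: nat
  assumes G: "pair_graph G" "pverts G = {1..n}" and v: "v \<in> {1..n}"
begin

lemma depth_ge_star:
  assumes n: "3 \<le> n" and adj: "\<And>l. l \<in> {1..n} - {v} \<Longrightarrow> (v, l) \<in> parcs G"
    and E: "\<And>i j. (i, j) \<in> parcs G \<Longrightarrow> i = v \<or> j = v"
  shows "enat (n + 1) \<le> depth (xy_ring K n) (graded_max_ideal K n)
    (quotient_module (xy_ring K n) (binomial_edge_ideal K n G))"
proof -
  obtain ls where ls: "set ls = {1..n} - {v}" "distinct ls"
    using finite_distinct_list[of "{1..n} - {v}"] by auto
  then have len: "length ls = n - 1" using v distinct_card[of ls] by simp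
  have "ideal.span (edge_minors G) = star_ideal v (set ls) ({} :: 'k xypoly set)"
  proof (rule span_edge_minors_star[OF G(1)])
    show "(v, l) \<in> parcs G" if "l \<in> set ls" for l using adj that ls(1) by blast
    fix i j assume ij: "(i, j) \<in> parcs G"
    have "i \<in> {1..n}" "j \<in> {1..n}" "i \<noteq> j" using pair_graph_arcs[OF G(1) ij] G(2) by auto
    then show "i = v \<and> j \<in> set ls \<or> j = v \<and> i \<in> set ls \<or> minor i j \<in> ({} :: 'k xypoly set)
        \<or> minor j i \<in> ({} :: 'k xypoly set)"
      using E[OF ij] unfolding ls(1) by blast
  qed simp
  moreover have "regular_on (star_ideal v (set ls) {} :: 'k xypoly set) (star_seq v ls)"
    using ls len n by (intro regular_on_star) auto
  moreover have "set (star_seq v ls :: 'k xypoly list) \<subseteq> polys_over (xyvars n)"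
  proof
    have "set (v # ls) \<subseteq> {1..n}" unfolding set_simps(2) ls(1) using v by blast
    moreover have "ls \<noteq> []" using len n by auto
    ultimately show "x \<in> polys_over (xyvars n)" if "x \<in> set (star_seq v ls)" for x :: "'k xypoly"
      using that by (rule star_seq_polys_over)
  qed
  ultimately have "enat (length (star_seq v ls :: 'k xypoly list)) \<le> depth (xy_ring K n) (graded_max_ideal K n)
      (quotient_module (xy_ring K n) (binomial_edge_ideal K n G))"
    by (intro depth_ge_graph[OF G _ pos_homogeneous_star_seq]) (assumption, assumption, simp only:)
  then show ?thesis using len n by (simp add: star_seq_def)
qed

lemma depth_ge_star_edge:
  assumes n: "4 \<le> n" and adj: "\<And>l. l \<in> {1..n} - {v} \<Longrightarrow> (v, l) \<in> parcs G"
    and ab: "(a, b) \<in> parcs G" "a \<noteq> v" "b \<noteq> v"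
    and E: "\<And>i j. (i, j) \<in> parcs G \<Longrightarrow> i = v \<or> j = v \<or> {i, j} = {a, b}"
  shows "enat (n + 1) \<le> depth (xy_ring K n) (graded_max_ideal K n)
    (quotient_module (xy_ring K n) (binomial_edge_ideal K n G))"
proof -
  obtain us where us: "set us = {1..n} - {v, a, b}" "distinct us"
    using finite_distinct_list[of "{1..n} - {v, a, b}"] by auto
  have abn: "a \<in> {1..n}" "b \<in> {1..n}" "a \<noteq> b" using pair_graph_arcs[OF G(1) ab(1)] G(2) by auto
  let ?ls = "a # b # us"
  have "set ?ls = {a, b} \<union> ({1..n} - {v, a, b})" using us(1) by auto
  also have "\<dots> = {1..n} - {v}" using abn ab by blast
  finally have ls: "set ?ls = {1..n} - {v}" "distinct (v # ?ls)" using us abn(3) ab by simp_all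
  then have len: "length ?ls = n - 1" using v distinct_card[of ?ls] by simp
  then have ne: "us \<noteq> []" using n by auto
  have "ideal.span (edge_minors G) = star_ideal v (set ?ls) {minor a b :: 'k xypoly}"
  proof (rule span_edge_minors_star[OF G(1)])
    show "{minor a b} \<subseteq> edge_minors G" using ab(1) by (auto simp: edge_minors_def)
    show "(v, l) \<in> parcs G" if "l \<in> set ?ls" for l using adj that ls(1) by blast
    fix i j assume ij: "(i, j) \<in> parcs G"
    have "i = v \<and> j \<in> set ?ls \<or> j = v \<and> i \<in> set ?ls \<or> {i, j} = {a, b}"
      unfolding ls(1) using E[OF ij] pair_graph_arcs[OF G(1) ij] unfolding G(2) by blast
    then show "i = v \<and> j \<in> set ?ls \<or> j = v \<and> i \<in> set ?ls \<or> minor i j \<in> {minor a b :: 'k xypoly}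
        \<or> minor j i \<in> {minor a b :: 'k xypoly}"
      by (metis doubleton_eq_iff singletonI)
  qed
  moreover have "regular_on (star_ideal v (set ?ls) {minor a b :: 'k xypoly}) (star_seq v ?ls)"
    by (rule regular_on_star_edge[OF ls(2) ne])
  moreover have "set (star_seq v ?ls :: 'k xypoly list) \<subseteq> polys_over (xyvars n)"
  proof
    have "set (v # ?ls) \<subseteq> {1..n}" unfolding set_simps(2)[of v] ls(1) using v by blast
    then show "x \<in> polys_over (xyvars n)" if "x \<in> set (star_seq v ?ls)" for x :: "'k xypoly"
      using that by (intro star_seq_polys_over[of v ?ls n x]) simp_all
  qed
  ultimately have "enat (length (star_seq v ?ls :: 'k xypoly list)) \<le> depth (xy_ring K n) (graded_max_ideal K n)
      (quotient_module (xy_ring K n) (binomial_edge_ideal K n G))"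
    by (intro depth_ge_graph[OF G _ pos_homogeneous_star_seq]) (assumption, assumption, simp only:)
  moreover have "length (star_seq v ?ls :: 'k xypoly list) = n + 1"
    using len n unfolding star_seq_def length_append length_hankel by simp
  ultimately show ?thesis by simp
qed

lemma depth_ge_star_pendant:
  assumes n: "4 \<le> n" and adj: "\<And>l. l \<in> {1..n} - {v, b} \<Longrightarrow> (v, l) \<in> parcs G" and vb: "(v, b) \<notin> parcs G"
    and ab: "(a, b) \<in> parcs G" "a \<noteq> v" "b \<noteq> v"
    and E: "\<And>i j. (i, j) \<in> parcs G \<Longrightarrow> i = v \<or> j = v \<or> {i, j} = {a, b}"
  shows "enat (n + 1) \<le> depth (xy_ring K n) (graded_max_ideal K n)
    (quotient_module (xy_ring K n) (binomial_edge_ideal K n G))"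
proof -
  obtain us where us: "set us = {1..n} - {v, a, b}" "distinct us"
    using finite_distinct_list[of "{1..n} - {v, a, b}"] by auto
  have abn: "a \<in> {1..n}" "b \<in> {1..n}" "a \<noteq> b" using pair_graph_arcs[OF G(1) ab(1)] G(2) by auto
  \<comment> \<open>\<open>a\<close> comes last because \<open>regular_on_star_pendant\<close>
    attaches the new vertex \<open>b\<close> to the last leaf.\<close>
  let ?ls = "us @ [a]"
  have "set ?ls = {a} \<union> ({1..n} - {v, a, b})" using us(1) by auto
  also have "\<dots> = {1..n} - {v, b}" using abn ab by blast
  finally have ls: "set ?ls = {1..n} - {v, b}" "distinct (v # ?ls)" using us abn(3) ab by auto
  have "card ({1..n} - {v, b}) = n - 2" using v abn ab(3) by (simp add: card_Diff_subset)
  then have len: "length ?ls = n - 2" using ls distinct_card[of ?ls] by simp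
  have "ideal.span (edge_minors G) = star_ideal v (set ?ls) {minor a b :: 'k xypoly}"
  proof (rule span_edge_minors_star[OF G(1)])
    show "{minor a b} \<subseteq> edge_minors G" using ab(1) by (auto simp: edge_minors_def)
    show "(v, l) \<in> parcs G" if "l \<in> set ?ls" for l using adj that ls(1) by blast
    fix i j assume ij: "(i, j) \<in> parcs G"
    have "i = v \<and> j \<in> set ?ls \<or> j = v \<and> i \<in> set ?ls \<or> {i, j} = {a, b}"
      unfolding ls(1) using E[OF ij] pair_graph_arcs[OF G(1) ij] ij vb unfolding G(2) by blast
    then show "i = v \<and> j \<in> set ?ls \<or> j = v \<and> i \<in> set ?ls \<or> minor i j \<in> {minor a b :: 'k xypoly}
        \<or> minor j i \<in> {minor a b :: 'k xypoly}"
      by (metis doubleton_eq_iff singletonI)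
  qed
  moreover define xs :: "'k xypoly list"
    where "xs = (butlast (hankel (v # ?ls)) @ [indet (Xvar v) + indet (Xvar a)]) @
      [indet (Yvar b), indet (Yvar a) + indet (Xvar b)]"
  have "regular_on (star_ideal v (set ?ls) {minor a b :: 'k xypoly}) xs"
  proof -
    have "2 \<le> length ?ls" "b \<notin> set (v # ?ls)" using len n ls(1) ab(3) by auto
    from regular_on_star_pendant[OF ls(2) this] show ?thesis unfolding xs_def last_snoc .
  qed
  moreover have "x \<in> polys_over (xyvars n) \<and> pos_homogeneous std_wt x" if "x \<in> set xs" for x
  proof -
    consider "x \<in> set (star_seq v ?ls)" | "x = indet (Yvar b)" | "x = indet (Yvar a) + indet (Xvar b)"
      using \<open>x \<in> set xs\<close> unfolding xs_def star_seq_def by (auto dest: in_set_butlastD)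
    then show ?thesis
    proof cases
      case 1
      have "set (v # ?ls) \<subseteq> {1..n}" unfolding set_simps(2)[of v] ls(1) using v by blast
      then show ?thesis
        using star_seq_polys_over[of v ?ls n x] pos_homogeneous_star_seq[OF 1] 1 by simp
    next
      case 2
      then show ?thesis
        using abn pos_homogeneous_indet by (auto simp del: atLeastAtMost_iff)
    next
      case 3
      have "indet (Yvar a) \<in> polys_over (xyvars n)" "indet (Xvar b) \<in> polys_over (xyvars n)"
        using abn by (auto simp del: atLeastAtMost_iff)
      then show ?thesis using 3 pos_homogeneous_indet_add by auto
    qed
  qed
  then have "set xs \<subseteq> polys_over (xyvars n)" "\<And>x. x \<in> set xs \<Longrightarrow> pos_homogeneous std_wt x"
    by blast+
  ultimately have "enat (length xs) \<le> depth (xy_ring K n) (graded_max_ideal K n)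
      (quotient_module (xy_ring K n) (binomial_edge_ideal K n G))"
    by (intro depth_ge_graph[OF G]) (assumption, assumption, simp only:)
  moreover have "length xs = n + 1"
    using len n unfolding xs_def length_append length_butlast length_hankel by simp
  ultimately show ?thesis by simp
qed

text \<open>Let \<open>{a, b}\<close> be the edge that avoids \<open>v\<close>. A vertex outside
  \<open>{v, a, b}\<close> can only be adjacent to \<open>v\<close>, so connectedness makes it
  adjacent to \<open>v\<close>; likewise \<open>a\<close> or \<open>b\<close> is adjacent to
  \<open>v\<close>. If both are, the graph is a star with an edge, otherwise a star with a pendant
  edge.\<close>

lemma depth_ge_near_star:
  assumes n: "4 \<le> n" and conn: "connected (with_proj G)"
    and one: "\<And>i j i' j'. (i, j) \<in> parcs G \<Longrightarrow> (i', j') \<in> parcs G \<Longrightarrow> v \<notin> {i, j, i', j'} \<Longrightarrow> {i, j} = {i', j'}"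
  shows "enat (n + 1) \<le> depth (xy_ring K n) (graded_max_ideal K n)
    (quotient_module (xy_ring K n) (binomial_edge_ideal K n G))"
proof (cases "\<exists>a b. (a, b) \<in> parcs G \<and> a \<noteq> v \<and> b \<noteq> v")
  case False
  have adj: "(v, l) \<in> parcs G" if "l \<in> {1..n} - {v}" for l
  proof (rule ccontr)
    assume vl: "(v, l) \<notin> parcs G"
    have no: "(l, j) \<notin> parcs G" for j
    proof
      assume lj: "(l, j) \<in> parcs G"
      then have "j = v" using False that by blast
      then show False using pair_graph_arcs(4)[OF G(1) lj] vl by simp
    qed
    have "v \<in> {l}"
      by (rule connected_closed_set[OF G(1) conn, of l]) (use no that v G(2) in auto)
    then show False using that by simp
  qed
  have E: "i = v \<or> j = v" if "(i, j) \<in> parcs G" for i j using False that by blast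
  show ?thesis by (rule depth_ge_star[OF _ adj E]) (use n in auto)
next
  case True
  then obtain a b where ab: "(a, b) \<in> parcs G" "a \<noteq> v" "b \<noteq> v" by blast
  have abn: "a \<in> {1..n}" "b \<in> {1..n}" "a \<noteq> b" "(b, a) \<in> parcs G"
    using pair_graph_arcs[OF G(1) ab(1)] G(2) by auto
  have E: "i = v \<or> j = v \<or> {i, j} = {a, b}" if "(i, j) \<in> parcs G" for i j
    using one[OF that ab(1)] ab by auto
  have adj: "(v, l) \<in> parcs G" if "l \<in> {1..n} - {v, a, b}" for l
  proof (rule ccontr)
    assume vl: "(v, l) \<notin> parcs G"
    have no: "(l, j) \<notin> parcs G" for j
    proof
      assume lj: "(l, j) \<in> parcs G"
      then have "j = v" using E[OF lj] that by blast
      then show False using pair_graph_arcs(4)[OF G(1) lj] vl by simp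
    qed
    have "v \<in> {l}"
      by (rule connected_closed_set[OF G(1) conn, of l]) (use no that v G(2) in auto)
    then show False using that by simp
  qed
  have vab: "(v, a) \<in> parcs G \<or> (v, b) \<in> parcs G"
  proof (rule ccontr)
    assume no: "\<not> ?thesis"
    have "j \<in> {a, b}" if ij: "(i, j) \<in> parcs G" "i \<in> {a, b}" for i j
    proof (cases "j = v")
      case True
      then have "(v, i) \<in> parcs G" using pair_graph_arcs(4)[OF G(1) ij(1)] by simp
      then show ?thesis using no ij(2) by blast
    next
      case False
      then show ?thesis using E[OF ij(1)] ij(2) ab by blast
    qed
    then have "v \<in> {a, b}"
      by (rule connected_closed_set[OF G(1) conn, of a, rotated]) (use abn v G(2) in auto)
    then show False using ab by simp
  qed
  consider "(v, a) \<in> parcs G" "(v, b) \<in> parcs G" | "(v, b) \<notin> parcs G" | "(v, a) \<notin> parcs G" by blast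
  then show ?thesis
  proof cases
    case 1
    then have "(v, l) \<in> parcs G" if "l \<in> {1..n} - {v}" for l using that adj[of l] by blast
    then show ?thesis using E by (rule depth_ge_star_edge[OF n _ ab])
  next
    case 2
    have "(v, l) \<in> parcs G" if "l \<in> {1..n} - {v, b}" for l using that adj[of l] vab 2 by blast
    then show ?thesis using E by (rule depth_ge_star_pendant[OF n _ 2 ab])
  next
    case 3
    have "(v, l) \<in> parcs G" if "l \<in> {1..n} - {v, a}" for l using that adj[of l] vab 3 by blast
    moreover have "i = v \<or> j = v \<or> {i, j} = {b, a}" if "(i, j) \<in> parcs G" for i j
      using E[OF that] by (simp add: insert_commute)
    ultimately show ?thesis by (rule depth_ge_star_pendant[OF n _ 3 abn(4) ab(3,2)])
  qed
qed

end

section \<open>Proportional columns modulo a prime\<close>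

definition nonzero_columns :: "nat \<Rightarrow> 'k::field xypoly set \<Rightarrow> nat set"
  where "nonzero_columns n P = {i \<in> {1..n}. indet (Xvar i) \<notin> P \<or> indet (Yvar i) \<notin> P}"

lemma rel_prime_zero: "rel_prime R P \<Longrightarrow> 0 \<in> P"
  by (auto simp: rel_prime_def rel_ideal_def)

context
  fixes n :: nat and P :: "'k::field xypoly set" and xs :: "'k xypoly list"
  assumes P: "rel_prime (polys_over (xyvars n)) P"
    and xs: "set xs \<subseteq> polys_over (xyvars n)" "alg_indep P xs"
begin

lemma length_le_cover:
  "C \<subseteq> nonzero_columns n P \<Longrightarrow> (\<And>i. i \<in> nonzero_columns n P \<Longrightarrow> i \<notin> C \<Longrightarrow> \<exists>c\<in>C. minor c i \<in> P) \<Longrightarrow>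
    length xs \<le> card (nonzero_columns n P) + card C"
proof (rule alg_indep_length_le[OF P nonzero_columns_def _ _ xs])
  have "minor i i \<in> P" for i using rel_prime_zero[OF P] by simp
  then show "(\<And>i. i \<in> nonzero_columns n P \<Longrightarrow> i \<notin> C \<Longrightarrow> \<exists>c\<in>C. minor c i \<in> P) \<Longrightarrow>
      \<exists>c\<in>C. minor c i \<in> P" if "i \<in> nonzero_columns n P" for i
    using that by blast
qed

lemma length_le_column:
  assumes "c \<in> nonzero_columns n P" "\<And>i. i \<in> nonzero_columns n P \<Longrightarrow> minor c i \<in> P"
  shows "length xs \<le> card (nonzero_columns n P) + 1"
  using length_le_cover[of "{c}"] assms by simp

lemma length_le_all: "length xs \<le> 2 * card (nonzero_columns n P)"
  using length_le_cover[of "nonzero_columns n P"] by simp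

lemma length_le_remove_one:
  assumes "a \<in> nonzero_columns n P" "b \<in> nonzero_columns n P" "a \<noteq> b" "minor a b \<in> P"
  shows "length xs \<le> 2 * card (nonzero_columns n P) - 1"
proof -
  have "finite (nonzero_columns n P)" by (simp add: nonzero_columns_def)
  then have "card (nonzero_columns n P - {b}) = card (nonzero_columns n P) - 1" "0 < card (nonzero_columns n P)"
    using assms(2) by (auto simp: card_gt_0_iff)
  moreover have "length xs \<le> card (nonzero_columns n P) + card (nonzero_columns n P - {b})"
    by (rule length_le_cover) (use assms in auto)
  ultimately show ?thesis by simp
qed

lemma length_le_remove_two:
  assumes "x \<in> nonzero_columns n P" "y \<in> nonzero_columns n P" "p \<in> nonzero_columns n P" "q \<in> nonzero_columns n P"
    and "x \<noteq> y" "p \<notin> {x, y}" "q \<notin> {x, y}" "minor p x \<in> P" "minor q y \<in> P"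
  shows "length xs \<le> 2 * card (nonzero_columns n P) - 2"
proof -
  have fin: "finite (nonzero_columns n P)" by (simp add: nonzero_columns_def)
  then have "card (nonzero_columns n P - {x, y}) = card (nonzero_columns n P) - 2"
    using assms(1,2,5) by (simp add: card_Diff_subset)
  moreover have "2 \<le> card (nonzero_columns n P)"
    using card_mono[OF fin, of "{x, y}"] assms(1,2,5) by simp
  moreover have "length xs \<le> card (nonzero_columns n P) + card (nonzero_columns n P - {x, y})"
    by (rule length_le_cover) (use assms in auto)
  ultimately show ?thesis by simp
qed

end

lemma nonzero_columns_subset: "nonzero_columns n P \<subseteq> {1..n}"
  by (auto simp: nonzero_columns_def)

text \<open>Proportionality is transitive through a nonzero column \<open>i\<close>:
  \<open>x_i\<close> and \<open>y_i\<close> multiply the minor of \<open>c\<close> and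
  \<open>j\<close> into \<open>P\<close>, and one of them is outside the prime.\<close>

lemma minor_cancel:
  assumes P: "rel_prime (polys_over (xyvars n)) P" and i: "i \<in> nonzero_columns n P"
    and n: "c \<in> {1..n}" "j \<in> {1..n}" and ci: "minor c i \<in> P" and ij: "minor i j \<in> P"
  shows "minor c j \<in> (P :: 'k::field xypoly set)"
proof -
  let ?R = "polys_over (xyvars n) :: 'k xypoly set"
  have I: "rel_ideal ?R P" using P by (simp add: rel_prime_def)
  have i': "i \<in> {1..n}" using i nonzero_columns_subset by blast
  have var: "indet (Xvar k) \<in> ?R" "indet (Yvar k) \<in> ?R" if "k \<in> {1..n}" for k
    using that by (blast intro: polys_over_closed(4))+
  have cj: "minor c j \<in> ?R" by (rule minor_polys_over[OF n])
  have "indet (Xvar i) * minor c j = indet (Xvar c) * minor i j + indet (Xvar j) * (minor c i :: 'k xypoly)"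
    "indet (Yvar i) * minor c j = indet (Yvar c) * minor i j + indet (Yvar j) * (minor c i :: 'k xypoly)"
    by (simp_all add: minor_def algebra_simps)
  moreover have "indet (Xvar c) * minor i j + indet (Xvar j) * minor c i \<in> P"
    by (rule rel_idealD(3)[OF I rel_idealD(4)[OF I var(1)[OF n(1)] ij] rel_idealD(4)[OF I var(1)[OF n(2)] ci]])
  moreover have "indet (Yvar c) * minor i j + indet (Yvar j) * minor c i \<in> P"
    by (rule rel_idealD(3)[OF I rel_idealD(4)[OF I var(2)[OF n(1)] ij] rel_idealD(4)[OF I var(2)[OF n(2)] ci]])
  ultimately have XY: "indet (Xvar i) * minor c j \<in> P" "indet (Yvar i) * minor c j \<in> P" by simp_all
  have prime: "p \<in> P \<or> q \<in> P" if "p * q \<in> P" "p \<in> ?R" "q \<in> ?R" for p q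
    using P that unfolding rel_prime_def by blast
  show ?thesis
    using prime[OF XY(1) var(1)[OF i'] cj] prime[OF XY(2) var(2)[OF i'] cj] i
    unfolding nonzero_columns_def by blast
qed

text \<open>If no column vanished, connectedness would make all columns proportional and the length
  at most \<open>n + 1\<close>. Two vanishing columns would leave at most
  \<open>2(n - 2) < 2n - 3\<close>. So exactly one column vanishes, and two distinct edges avoiding
  its vertex would allow two columns to be dropped from the cover, leaving at most
  \<open>2(n - 1) - 2 < 2n - 3\<close>.\<close>

lemma near_star_of_large_dimension:
  fixes P :: "'k::field xypoly set"
  assumes G: "pair_graph G" "pverts G = {1..n}" "connected (with_proj G)"
    and P: "rel_prime (polys_over (xyvars n)) P" and E: "\<And>i j. (i, j) \<in> parcs G \<Longrightarrow> minor i j \<in> P"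
    and xs: "set xs \<subseteq> polys_over (xyvars n)" "alg_indep P xs"
    and len: "n + 1 < length xs" "2 * n - 3 \<le> length xs" and n: "4 \<le> n"
  shows "\<exists>v\<in>{1..n}. \<forall>i j i' j'. (i, j) \<in> parcs G \<longrightarrow> (i', j') \<in> parcs G \<longrightarrow> v \<notin> {i, j, i', j'} \<longrightarrow> {i, j} = {i', j'}"
proof -
  let ?U = "nonzero_columns n P"
  have "?U \<noteq> {1..n}"
  proof
    assume U: "?U = {1..n}"
    have 1: "1 \<in> {1..n}" using n by simp
    have "i \<in> {i \<in> {1..n}. minor 1 i \<in> P}" if "i \<in> {1..n}" for i
    proof (rule connected_closed_set[OF G(1,3)])
      show "1 \<in> {i \<in> {1..n}. minor 1 i \<in> P}"
        using 1 rel_prime_zero[OF P] by simp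
      show "j \<in> {i \<in> {1..n}. minor 1 i \<in> P}" if "(i, j) \<in> parcs G" "i \<in> {i \<in> {1..n}. minor 1 i \<in> P}" for i j
      proof -
        have "i \<in> {1..n}" "j \<in> {1..n}" using pair_graph_arcs(1,2)[OF G(1) that(1)] G(2) by simp_all
        moreover have "i \<in> ?U" using calculation(1) U by simp
        moreover have "minor 1 i \<in> P" using that(2) by simp
        ultimately show ?thesis using minor_cancel[OF P _ 1 _ _ E[OF that(1)]] by simp
      qed
    qed (use 1 that G(2) in auto)
    then have "length xs \<le> card ?U + 1"
      using 1 unfolding U[symmetric] by (intro length_le_column[OF P xs, of 1]) (auto simp: U)
    then show False using len(1) by (simp add: U)
  qed
  then obtain v where v: "v \<in> {1..n}" "v \<notin> ?U" using nonzero_columns_subset by blast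
  have Uv: "?U \<subseteq> {1..n} - {v}" using v(2) nonzero_columns_subset by blast
  have cardv: "card ({1..n} - {v}) = n - 1" using v(1) by simp
  have "length xs \<le> 2 * card ?U" by (rule length_le_all[OF P xs])
  moreover have "card ?U \<le> n - 1" using card_mono[OF _ Uv] cardv by simp
  ultimately have card: "card ?U = n - 1" using len(2) n by linarith
  then have U: "?U = {1..n} - {v}" using Uv cardv by (intro card_subset_eq) auto
  \<comment> \<open>Column \<open>x\<close> is covered by \<open>p\<close> and column
    \<open>y\<close> by \<open>q\<close>; the conditions say that neither covering column is
    dropped, and \<open>p = q\<close> is permitted.\<close>
  have key: False
    if "(x, p) \<in> parcs G" "(y, q) \<in> parcs G" "v \<notin> {x, p, y, q}" "x \<notin> {y, q}" "p \<noteq> y" for x p y q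
  proof -
    have "x \<in> ?U" "p \<in> ?U" "y \<in> ?U" "q \<in> ?U" "p \<noteq> x" "q \<noteq> y"
      using pair_graph_arcs[OF G(1) that(1)] pair_graph_arcs[OF G(1) that(2)] that(3) unfolding U G(2) by auto
    moreover have "minor p x \<in> P" "minor q y \<in> P"
      using E pair_graph_arcs(4)[OF G(1)] that(1,2) by blast+
    ultimately have "length xs \<le> 2 * card ?U - 2"
      using that by (intro length_le_remove_two[OF P xs, of x y p q]) auto
    then show False using card len(2) n by linarith
  qed
  have "{i, j} = {i', j'}"
    if e: "(i, j) \<in> parcs G" "(i', j') \<in> parcs G" "v \<notin> {i, j, i', j'}" for i j i' j'
  proof (rule ccontr)
    assume ne: "{i, j} \<noteq> {i', j'}"
    have "i \<noteq> j" "i' \<noteq> j'" "(j, i) \<in> parcs G" "(j', i') \<in> parcs G"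
      using pair_graph_arcs(3,4)[OF G(1)] e by blast+
    note arcs = this
    \<comment> \<open>\<open>x\<close> is an endpoint of the first edge off the second one. The
      second edge is oriented so that the endpoint dropped from the cover differs from
      \<open>p\<close>.\<close>
    have sep: False if "(x, p) \<in> parcs G" "v \<notin> {x, p}" "x \<notin> {i', j'}" for x p
    proof (cases "p = i'")
      case True
      then show ?thesis using key[OF that(1) arcs(4)] that e(3) arcs(2) by simp
    next
      case False
      then show ?thesis using key[OF that(1) e(2)] that e(3) by simp
    qed
    have "i \<notin> {i', j'} \<or> j \<notin> {i', j'}" using ne arcs(1) by blast
    then show False using sep[OF e(1)] sep[OF arcs(3)] e(3) by blast
  qed
  then show ?thesis using v(1) by blast
qed

subsection \<open>The star and the star with an edge\<close>

text \<open>The cone with apex 1 over the edges \<open>E\<close>, given as a symmetric set of arcs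
  on the other vertices.\<close>

definition cone_graph :: "nat \<Rightarrow> (nat \<times> nat) set \<Rightarrow> nat pair_pre_digraph"
  where "cone_graph n E = \<lparr>pverts = {1..n}, parcs = {1} \<times> {2..n} \<union> {2..n} \<times> {1} \<union> E\<rparr>"

lemma pair_graph_cone_graph:
  assumes "E \<subseteq> {2..n} \<times> {2..n}" "sym E" "irrefl E"
  shows "pair_graph (cone_graph n E)"
proof unfold_locales
  show "finite (parcs (cone_graph n E))"
    using finite_subset[OF assms(1)] by (simp add: cone_graph_def)
  show "symmetric (with_proj (cone_graph n E))"
    using assms(2) by (auto simp: symmetric_def cone_graph_def sym_def)
qed (use assms in \<open>auto simp: cone_graph_def irrefl_def\<close>)

lemma connected_cone_graph:
  assumes "pair_graph (cone_graph n E)" "2 \<le> n"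
  shows "connected (with_proj (cone_graph n E))"
proof -
  let ?G = "cone_graph n E"
  have "(u, 1) \<in> rtrancl_on (pverts ?G) (parcs ?G)" if "u \<in> {1..n}" for u
  proof (cases "u = 1")
    case True then show ?thesis using assms(2) by (auto simp: cone_graph_def)
  next
    case False
    then have "(u, 1) \<in> parcs ?G" using that by (auto simp: cone_graph_def)
    then show ?thesis
      by (rule rtrancl_on_into_rtrancl_on[OF rtrancl_on_refl, rotated])
        (use that assms(2) in \<open>auto simp: cone_graph_def\<close>)
  qed
  moreover have "(u, v) \<in> rtrancl_on (pverts ?G) (parcs ?G)"
    if "(u, 1) \<in> rtrancl_on (pverts ?G) (parcs ?G)" "v \<in> {1..n}" for u v
  proof (cases "v = 1")
    case False
    then have "(1, v) \<in> parcs ?G" using that(2) by (auto simp: cone_graph_def)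
    then show ?thesis
      by (rule rtrancl_on_into_rtrancl_on[OF that(1)]) (use that(2) in \<open>simp add: cone_graph_def\<close>)
  qed (use that in simp)
  moreover have "pverts ?G = {1..n}" by (simp add: cone_graph_def)
  ultimately show ?thesis unfolding connected_pair_graph_iff[OF assms(1)] using assms(2) by auto
qed

text \<open>The apex is adjacent to every vertex, so \<open>x_1\<close> times the minor of
  \<open>i\<close> and \<open>j\<close> equals \<open>x_i\<close> times a generator minus
  \<open>x_j\<close> times a generator; \<open>u = x_1\<close> serves in
  \<open>depth_le\<close>.\<close>

lemma depth_cone_graph_le:
  fixes K :: "'k::field itself"
  assumes G: "pair_graph (cone_graph n E)" and n: "1 \<le> n"
  shows "depth (xy_ring K n) (graded_max_ideal K n)
    (quotient_module (xy_ring K n) (binomial_edge_ideal K n (cone_graph n E))) \<le> enat (n + 1)"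
proof -
  let ?G = "cone_graph n E" and ?A = "edge_minors (cone_graph n E) :: 'k xypoly set"
  have V: "pverts ?G = {1..n}" by (simp add: cone_graph_def)
  have arc: "minor 1 i \<in> ideal.span ?A" if "i \<in> {1..n}" for i
  proof (cases "i = 1")
    case False
    then have "(1, i) \<in> parcs ?G" using that by (auto simp: cone_graph_def)
    then show ?thesis by (auto simp: edge_minors_def intro: ideal.span_base)
  qed (simp add: ideal.span_zero)
  show ?thesis
    unfolding binomial_edge_ideal_eq[OF G V]
  proof (rule depth_le[OF n edge_minors_polys_over[OF G V]])
    show "?A \<subseteq> minors_ideal {1..n}"
      using pair_graph_arcs(1,2)[OF G] unfolding V edge_minors_def by (blast intro: minor_in_minors_ideal)
    show "indet (Xvar 1) \<in> polys_over (xyvars n)" using n by (intro polys_over_closed(4)) auto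
    show "segre {1..n} (indet (Xvar 1)) \<noteq> (0 :: 'k xypoly)" by (rule segre_indet_neq_0)
    fix i j assume ij: "i \<in> {1..n}" "j \<in> {1..n}"
    have "indet (Xvar 1) * minor i j = indet (Xvar i) * minor 1 j - indet (Xvar j) * (minor 1 i :: 'k xypoly)"
      by (simp add: minor_def algebra_simps)
    then show "indet (Xvar 1) * minor i j \<in> ideal.span ?A"
      using arc ij by (simp add: ideal.span_diff ideal.span_scale del: atLeastAtMost_iff)
  qed
qed

text \<open>Since \<open>\<beta>\<close> annihilates the apex column, the edges at the apex impose
  nothing further. \<open>W\<close> lists the parameters to be set to zero in turn, and the variable
  \<open>gs ! i\<close> witnesses that the \<open>i\<close>-th step enlarges the kernel
  strictly.\<close>

lemma krull_dim_cone_graph_ge: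
  fixes K :: "'k::field itself"
  assumes G: "pair_graph (cone_graph n E)"
    and \<beta>: "\<beta> (Xvar 1) = 0" "\<beta> (Yvar 1) = 0" "\<And>i j. (i, j) \<in> E \<Longrightarrow> subst \<beta> (minor i j) = (0 :: 'k xypoly)"
    and g: "length gs = length W" "set gs \<subseteq> xyvars n"
      "\<And>i. i < length W \<Longrightarrow> kill (set (take i W)) (\<beta> (gs ! i)) \<noteq> 0"
      "\<And>i. i < length W \<Longrightarrow> kill {W ! i} (\<beta> (gs ! i)) = 0"
  shows "enat (length W) \<le> krull_dim (xy_ring K n Quot binomial_edge_ideal K n (cone_graph n E))"
proof -
  let ?G = "cone_graph n E" and ?R = "polys_over (xyvars n) :: 'k xypoly set"
  have V: "pverts ?G = {1..n}" by (simp add: cone_graph_def)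
  have "subst \<beta> (minor i j) = 0" if "(i, j) \<in> parcs ?G" for i j
    using that \<beta> by (auto simp: cone_graph_def minor_def)
  then have "edge_minors ?G \<subseteq> {p. subst \<beta> p = 0}" by (auto simp: edge_minors_def)
  then have J0: "ideal.span (edge_minors ?G) \<subseteq> {p. subst \<beta> p = 0}"
    by (rule ideal.span_minimal) (rule subspace_kernel)
  have J: "rel_ideal ?R (ideal.span (edge_minors ?G) \<inter> ?R)"
    by (auto simp: rel_ideal_def intro: ideal.span_zero ideal.span_add ideal.span_scale)
  have gR: "indet (gs ! i) \<in> ?R" if "i < length W" for i
  proof -
    have "gs ! i \<in> set gs" using g(1) that by simp
    then show ?thesis using g(2) by (intro polys_over_closed(4)) blast
  qed
  show ?thesis
    unfolding binomial_edge_ideal_eq[OF G V] xy_ring_def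
  proof (rule krull_dim_ge_kill[OF J, of \<beta> W "\<lambda>i. indet (gs ! i)"])
    show "subst \<beta> p = 0" if "p \<in> ideal.span (edge_minors ?G) \<inter> ?R" for p using that J0 by blast
  qed (use gR g(3,4) in simp_all)
qed

lemma rel_prime_edge_minors:
  assumes "pair_graph G" "pverts G = {1..n}"
    and "ideal.span (edge_minors G) \<inter> polys_over (xyvars n) \<subseteq> P" "(i, j) \<in> parcs G"
  shows "minor i j \<in> P"
proof -
  have "minor i j \<in> edge_minors G" using assms(4) by (auto simp: edge_minors_def)
  then show ?thesis using edge_minors_polys_over[OF assms(1,2)] assms(3) ideal.span_base by blast
qed

text \<open>If the apex column is nonzero modulo \<open>P\<close>, all nonzero columns are
  proportional to it and the count is at most \<open>n + 1\<close>. Only primes containing the apex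
  column are left to the second assumption on \<open>d\<close>.\<close>

lemma krull_dim_cone_graph_le:
  fixes K :: "'k::field itself"
  assumes G: "pair_graph (cone_graph n E)"
    and d: "n + 1 \<le> d"
      "\<And>P xs. rel_prime (polys_over (xyvars n)) P \<Longrightarrow> (\<And>i j. (i, j) \<in> E \<Longrightarrow> minor i j \<in> (P :: 'k xypoly set)) \<Longrightarrow>
        set xs \<subseteq> polys_over (xyvars n) \<Longrightarrow> alg_indep P xs \<Longrightarrow>
        nonzero_columns n P \<subseteq> {2..n} \<Longrightarrow> length xs \<le> d"
  shows "krull_dim (xy_ring K n Quot binomial_edge_ideal K n (cone_graph n E)) \<le> enat d"
proof -
  let ?G = "cone_graph n E" and ?R = "polys_over (xyvars n) :: 'k xypoly set"
  have V: "pverts ?G = {1..n}" by (simp add: cone_graph_def)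
  have J: "rel_ideal ?R (ideal.span (edge_minors ?G) \<inter> ?R)"
    by (auto simp: rel_ideal_def intro: ideal.span_zero ideal.span_add ideal.span_scale)
  show ?thesis
    unfolding binomial_edge_ideal_eq[OF G V] xy_ring_def
  proof (rule krull_dim_le[OF J])
    fix P :: "'k xypoly set" and xs
    assume P: "rel_prime ?R P" and JP: "ideal.span (edge_minors ?G) \<inter> ?R \<subseteq> P"
      and xs: "set xs \<subseteq> ?R" "alg_indep P xs"
    have edge: "minor i j \<in> P" if "(i, j) \<in> parcs ?G" for i j
      by (rule rel_prime_edge_minors[OF G V JP that])
    show "length xs \<le> d"
    proof (cases "1 \<in> nonzero_columns n P")
      case True
      have "minor 1 i \<in> P" if "i \<in> nonzero_columns n P" for i
      proof (cases "i = 1")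
        case True then show ?thesis using rel_prime_zero[OF P] by simp
      next
        case False
        then have "(1, i) \<in> parcs ?G" using that by (auto simp: cone_graph_def nonzero_columns_def)
        then show ?thesis by (rule edge)
      qed
      from length_le_column[OF P xs True this]
      show ?thesis using d(1) card_mono[OF _ nonzero_columns_subset[of n P]] by simp
    next
      case False
      then have "nonzero_columns n P \<subseteq> {2..n}"
        by (auto simp: nonzero_columns_def Suc_le_eq le_less numeral_2_eq_2)
      then show ?thesis using edge by (intro d(2)[OF P _ xs]) (auto simp: cone_graph_def)
    qed
  qed
qed

lemma distinct_nth_notin_take: "distinct W \<Longrightarrow> i < length W \<Longrightarrow> W ! i \<notin> set (take i W)"
  by (auto simp: in_set_conv_nth nth_eq_iff_index_eq)

lemma krull_dim_star:
  fixes K :: "'k::field itself"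
  assumes n: "3 \<le> n"
  shows "krull_dim (xy_ring K n Quot binomial_edge_ideal K n (cone_graph n {})) = enat (2 * n - 2)"
proof (rule antisym)
  have G: "pair_graph (cone_graph n {})" by (rule pair_graph_cone_graph) (auto simp: sym_def irrefl_def)
  show "krull_dim (xy_ring K n Quot binomial_edge_ideal K n (cone_graph n {})) \<le> enat (2 * n - 2)"
  proof (rule krull_dim_cone_graph_le[OF G])
    show "n + 1 \<le> 2 * n - 2" using n by simp
    fix P :: "'k xypoly set" and xs
    assume P: "rel_prime (polys_over (xyvars n)) P" and xs: "set xs \<subseteq> polys_over (xyvars n)" "alg_indep P xs"
      and U: "nonzero_columns n P \<subseteq> {2..n}"
    have "card (nonzero_columns n P) \<le> n - 1" using card_mono[OF _ U] by simp
    then show "length xs \<le> 2 * n - 2" using length_le_all[OF P xs] n by linarith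
  qed
  define W where "W = map Xvar [2..<n + 1] @ map Yvar [2..<n + 1]"
  define \<beta> :: "xyvar \<Rightarrow> 'k xypoly" where "\<beta> u = (if u \<in> {Xvar 1, Yvar 1} then 0 else indet u)" for u
  have dist: "distinct W" by (auto simp: W_def distinct_map inj_on_def)
  have \<beta>W: "\<beta> (W ! i) = indet (W ! i)" if "i < length W" for i
  proof -
    have "W ! i \<in> set W" using that by simp
    then show ?thesis by (auto simp: \<beta>_def W_def simp del: nth_mem)
  qed
  have "enat (length W) \<le> krull_dim (xy_ring K n Quot binomial_edge_ideal K n (cone_graph n {}))"
  proof (rule krull_dim_cone_graph_ge[OF G, of \<beta> W])
    show "set W \<subseteq> xyvars n" by (auto simp: W_def)
    show "kill (set (take i W)) (\<beta> (W ! i)) \<noteq> 0" "kill {W ! i} (\<beta> (W ! i)) = 0" if "i < length W" for i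
      using \<beta>W[OF that] distinct_nth_notin_take[OF dist that] by simp_all
  qed (auto simp: \<beta>_def)
  moreover have "length W = 2 * n - 2" using n by (simp add: W_def)
  ultimately show "enat (2 * n - 2) \<le> krull_dim (xy_ring K n Quot binomial_edge_ideal K n (cone_graph n {}))"
    by simp
qed

lemma krull_dim_star_edge:
  fixes K :: "'k::field itself"
  assumes n: "5 \<le> n"
  defines "E \<equiv> {(2, 3), (3, 2)}"
  shows "krull_dim (xy_ring K n Quot binomial_edge_ideal K n (cone_graph n E)) = enat (2 * n - 3)"
proof (rule antisym)
  have G: "pair_graph (cone_graph n E)"
    by (rule pair_graph_cone_graph) (use n in \<open>auto simp: E_def sym_def irrefl_def\<close>)
  show "krull_dim (xy_ring K n Quot binomial_edge_ideal K n (cone_graph n E)) \<le> enat (2 * n - 3)"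
  proof (rule krull_dim_cone_graph_le[OF G])
    show "n + 1 \<le> 2 * n - 3" using n by simp
    fix P :: "'k xypoly set" and xs
    assume P: "rel_prime (polys_over (xyvars n)) P" and E: "\<And>i j. (i, j) \<in> E \<Longrightarrow> minor i j \<in> P"
      and xs: "set xs \<subseteq> polys_over (xyvars n)" "alg_indep P xs" and U: "nonzero_columns n P \<subseteq> {2..n}"
    have card: "card (nonzero_columns n P) \<le> n - 1" using card_mono[OF _ U] by simp
    \<comment> \<open>If columns 2 and 3 are both nonzero, their proportionality saves one from
      \<open>2(n - 1)\<close>; if one of them vanishes, at most \<open>2(n - 2)\<close>
      remains.\<close>
    consider "2 \<in> nonzero_columns n P" "3 \<in> nonzero_columns n P"
      | k where "k \<in> {2, 3}" "nonzero_columns n P \<subseteq> {2..n} - {k}"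
      using U by blast
    then show "length xs \<le> 2 * n - 3"
    proof cases
      case 1
      have "length xs \<le> 2 * card (nonzero_columns n P) - 1"
        by (rule length_le_remove_one[OF P xs 1]) (use E in \<open>auto simp: E_def\<close>)
      then show ?thesis using card n by linarith
    next
      case 2
      have "k \<in> {2..n}" using 2(1) n by auto
      then have "card ({2..n} - {k}) = n - 2" by simp
      then have "card (nonzero_columns n P) \<le> n - 2" using card_mono[OF _ 2(2)] by simp
      then show ?thesis using length_le_all[OF P xs] n by linarith
    qed
  qed
  define W0 where "W0 = map Xvar [4..<n + 1] @ map Yvar [4..<n + 1]"
  \<comment> \<open>Killing \<open>Xvar 2\<close>, \<open>Yvar 2\<close>, \<open>Xvar 3\<close> in
    this order successively annihilates the images of the variables \<open>Yvar 2\<close>,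
    \<open>Xvar 3\<close>, \<open>Yvar 3\<close>. The length is
    \<open>2(n - 3) + 3 = 2n - 3\<close>.\<close>
  define W where "W = W0 @ [Xvar 2, Yvar 2, Xvar 3]"
  define gs where "gs = W0 @ [Yvar 2, Xvar 3, Yvar 3]"
  \<comment> \<open>Columns 2 and 3 are parametrised as a matrix of rank one,
    \<open>(a p, a q)\<close> and \<open>(b p, b q)\<close>, with their four variables reused as
    parameters: \<open>a\<close> is \<open>Xvar 2\<close>, \<open>b\<close> is
    \<open>Xvar 3\<close>, \<open>p\<close> is \<open>Yvar 2\<close>, \<open>q\<close> is
    \<open>Yvar 3\<close>.\<close>
  define \<beta> :: "xyvar \<Rightarrow> 'k xypoly" where "\<beta> u =
    (if u \<in> {Xvar 1, Yvar 1} then 0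
     else if u = Xvar 2 then indet (Xvar 2) * indet (Yvar 2) else if u = Yvar 2 then indet (Xvar 2) * indet (Yvar 3)
     else if u = Xvar 3 then indet (Xvar 3) * indet (Yvar 2) else if u = Yvar 3 then indet (Xvar 3) * indet (Yvar 3)
     else indet u)" for u
  have dist: "distinct W0" by (auto simp: W0_def distinct_map inj_on_def)
  have notin: "Xvar 2 \<notin> set W0" "Yvar 2 \<notin> set W0" "Xvar 3 \<notin> set W0" "Yvar 3 \<notin> set W0"
    "Xvar 1 \<notin> set W0" "Yvar 1 \<notin> set W0"
    by (auto simp: W0_def)
  have \<beta>W0: "\<beta> u = indet u" if "u \<in> set W0" for u
  proof -
    have "u \<noteq> Xvar 2" "u \<noteq> Yvar 2" "u \<noteq> Xvar 3" "u \<noteq> Yvar 3" "u \<noteq> Xvar 1" "u \<noteq> Yvar 1"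
      using that notin by blast+
    then show ?thesis unfolding \<beta>_def by simp
  qed
  have \<beta>23: "\<beta> (Yvar 2) = indet (Xvar 2) * indet (Yvar 3)" "\<beta> (Xvar 3) = indet (Xvar 3) * indet (Yvar 2)"
    "\<beta> (Yvar 3) = indet (Xvar 3) * indet (Yvar 3)" "\<beta> (Xvar 2) = indet (Xvar 2) * indet (Yvar 2)"
    by (simp_all add: \<beta>_def)
  have steps: "kill (set (take i W)) (\<beta> (gs ! i)) \<noteq> 0 \<and> kill {W ! i} (\<beta> (gs ! i)) = 0" if "i < length W" for i
  proof -
    have "i < length W0 \<or> i = length W0 \<or> i = length W0 + 1 \<or> i = length W0 + 2"
      using that by (auto simp: W_def)
    then consider "i < length W0" | "i = length W0" | "i = length W0 + 1" | "i = length W0 + 2"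
      by blast
    then show ?thesis
    proof cases
      case 1
      then have "W0 ! i \<in> set W0" "W0 ! i \<notin> set (take i W0)" using distinct_nth_notin_take[OF dist] by simp_all
      then show ?thesis using 1 \<beta>W0 by (simp add: W_def gs_def nth_append)
    qed (use notin \<beta>23 in \<open>auto simp: W_def gs_def nth_append\<close>)
  qed
  have "enat (length W) \<le> krull_dim (xy_ring K n Quot binomial_edge_ideal K n (cone_graph n E))"
  proof (rule krull_dim_cone_graph_ge[OF G, of \<beta> gs W])
    show "set gs \<subseteq> xyvars n" using n by (auto simp: gs_def W0_def)
    show "length gs = length W" by (simp add: gs_def W_def)
    show "subst \<beta> (minor i j) = 0" if "(i, j) \<in> E" for i j
      using that by (auto simp: E_def minor_def \<beta>23 mult_ac)
  qed (use steps in \<open>auto simp: \<beta>_def\<close>)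
  moreover have "length W = 2 * n - 3" using n by (simp add: W_def W0_def)
  ultimately show "enat (2 * n - 3) \<le> krull_dim (xy_ring K n Quot binomial_edge_ideal K n (cone_graph n E))"
    by simp
qed

theorem corollary1p5:
  fixes K :: "'k::field itself" and t n d :: nat
  assumes "4 \<le> t" and "t \<le> n + 1"
    and "(n \<ge> 3 \<and> d = 2 * n - 2) \<or> (n \<ge> 5 \<and> d = 2 * n - 3)"
  shows "(\<exists>G :: nat pair_pre_digraph.
            pair_graph G \<and> pverts G = {1..n} \<and> connected (with_proj G) \<and>
            depth (xy_ring K n) (graded_max_ideal K n)
              (quotient_module (xy_ring K n) (binomial_edge_ideal K n G)) = enat t \<and>
            krull_dim (xy_ring K n Quot binomial_edge_ideal K n G) = enat d)
         \<longleftrightarrow> t = n + 1"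
proof
  assume "\<exists>G :: nat pair_pre_digraph.
            pair_graph G \<and> pverts G = {1..n} \<and> connected (with_proj G) \<and>
            depth (xy_ring K n) (graded_max_ideal K n)
              (quotient_module (xy_ring K n) (binomial_edge_ideal K n G)) = enat t \<and>
            krull_dim (xy_ring K n Quot binomial_edge_ideal K n G) = enat d"
  then obtain G :: "nat pair_pre_digraph" where G: "pair_graph G" "pverts G = {1..n}" "connected (with_proj G)"
    and depth: "depth (xy_ring K n) (graded_max_ideal K n)
      (quotient_module (xy_ring K n) (binomial_edge_ideal K n G)) = enat t"
    and dim: "krull_dim (xy_ring K n Quot binomial_edge_ideal K n G) = enat d" by blast
  show "t = n + 1"
  \<comment> \<open>For \<open>n = 3\<close> the dimension \<open>d = 4\<close> equals
    \<open>n + 1\<close>, so the argument on columns does not apply, but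
    \<open>4 \<le> t \<le> n + 1\<close> leaves only one value. For larger \<open>n\<close> both
    cases for \<open>d\<close> exceed \<open>n + 1\<close>.\<close>
  proof (cases "n = 3")
    case False
    then have n: "4 \<le> n" and d: "n + 1 < d" "2 * n - 3 \<le> d" using assms(3) by auto
    let ?R = "polys_over (xyvars n) :: 'k xypoly set" and ?J = "ideal.span (edge_minors G) \<inter> polys_over (xyvars n) :: 'k xypoly set"
    have J: "rel_ideal ?R ?J"
      by (auto simp: rel_ideal_def intro: ideal.span_zero ideal.span_add ideal.span_scale)
    have "krull_dim (poly_ring K (xyvars n) Quot ?J) = enat d"
      using dim unfolding binomial_edge_ideal_eq[OF G(1,2)] xy_ring_def .
    moreover have "0 < d" using d by simp
    ultimately obtain P xs where P: "rel_prime ?R P" "?J \<subseteq> P" and xs: "set xs \<subseteq> ?R" "alg_indep P xs" "length xs = d"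
      using krull_dim_attained[OF J] by blast
    have "minor i j \<in> P" if "(i, j) \<in> parcs G" for i j
      by (rule rel_prime_edge_minors[OF G(1,2) P(2) that])
    then obtain v where v: "v \<in> {1..n}" and one: "\<And>i j i' j'. (i, j) \<in> parcs G \<Longrightarrow> (i', j') \<in> parcs G \<Longrightarrow>
        v \<notin> {i, j, i', j'} \<Longrightarrow> {i, j} = {i', j'}"
      using near_star_of_large_dimension[OF G P(1) _ xs(1,2)] d n unfolding xs(3) by blast
    have "enat (n + 1) \<le> enat t"
      using depth_ge_near_star[OF G(1,2) v n G(3) one, of K] unfolding depth .
    then show ?thesis using assms(2) by simp
  qed (use assms(1,2) in simp)
next
  assume t: "t = n + 1"
  have n: "3 \<le> n" using assms(3) by auto
  have ex: "\<exists>G :: nat pair_pre_digraph.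
            pair_graph G \<and> pverts G = {1..n} \<and> connected (with_proj G) \<and>
            depth (xy_ring K n) (graded_max_ideal K n)
              (quotient_module (xy_ring K n) (binomial_edge_ideal K n G)) = enat t \<and>
            krull_dim (xy_ring K n Quot binomial_edge_ideal K n G) = enat d"
    if G: "pair_graph (cone_graph n E)"
      and ge: "enat (n + 1) \<le> depth (xy_ring K n) (graded_max_ideal K n)
        (quotient_module (xy_ring K n) (binomial_edge_ideal K n (cone_graph n E)))"
      and dim: "krull_dim (xy_ring K n Quot binomial_edge_ideal K n (cone_graph n E)) = enat d" for E
    using G dim antisym[OF depth_cone_graph_le[OF G, of K] ge] connected_cone_graph[OF G] n t
    by (intro exI[of _ "cone_graph n E"]) (auto simp: cone_graph_def)
  from assms(3) show "\<exists>G :: nat pair_pre_digraph.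
            pair_graph G \<and> pverts G = {1..n} \<and> connected (with_proj G) \<and>
            depth (xy_ring K n) (graded_max_ideal K n)
              (quotient_module (xy_ring K n) (binomial_edge_ideal K n G)) = enat t \<and>
            krull_dim (xy_ring K n Quot binomial_edge_ideal K n G) = enat d"
  proof (elim disjE conjE)
    assume d: "d = 2 * n - 2"
    have G: "pair_graph (cone_graph n {})" by (rule pair_graph_cone_graph) (auto simp: sym_def irrefl_def)
    show ?thesis
    proof (rule ex[OF G])
      show "enat (n + 1) \<le> depth (xy_ring K n) (graded_max_ideal K n)
          (quotient_module (xy_ring K n) (binomial_edge_ideal K n (cone_graph n {})))"
        by (rule depth_ge_star[OF G, of n 1]) (use n in \<open>auto simp: cone_graph_def\<close>)
      show "krull_dim (xy_ring K n Quot binomial_edge_ideal K n (cone_graph n {})) = enat d"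
        unfolding d by (rule krull_dim_star[OF n])
    qed
  next
    assume n5: "5 \<le> n" and d: "d = 2 * n - 3"
    \<comment> \<open>The edge between two leaves makes their columns proportional where the apex
      column vanishes and so lowers the dimension of the star by one, while the depth stays
      \<open>n + 1\<close>.\<close>
    let ?E = "{(2, 3), (3, 2)} :: (nat \<times> nat) set"
    have G: "pair_graph (cone_graph n ?E)"
      by (rule pair_graph_cone_graph) (use n5 in \<open>auto simp: sym_def irrefl_def\<close>)
    show ?thesis
    proof (rule ex[OF G])
      show "enat (n + 1) \<le> depth (xy_ring K n) (graded_max_ideal K n)
          (quotient_module (xy_ring K n) (binomial_edge_ideal K n (cone_graph n ?E)))"
        by (rule depth_ge_star_edge[OF G, of n 1 2 3]) (use n5 in \<open>auto simp: cone_graph_def\<close>)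
      show "krull_dim (xy_ring K n Quot binomial_edge_ideal K n (cone_graph n ?E)) = enat d"
        unfolding d by (rule krull_dim_star_edge[OF n5])
    qed
  qed
qed

end
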